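(* Let $A\in\operatorname{M}_n(\mathbb{Z})$ be non-singular with $\mathcal{P}'\neq\emptyset$, let $F\subset\overline{\mathbb{Q}}$ be any finite extension of $\mathbb{Q}$ containing all eigenvalues of $A$, and assume $G_A$ has a characteristic $\{\alpha_{pij}\in\mathbb{Z}_p\mid p\in\mathcal{P}',\ 1\le i\le t_p<j\le n\}$ relative to the standard basis $\mathbf{e}_1,\ldots,\mathbf{e}_n$. For $T\in\operatorname{M}_n(\mathbb{Q})$, we have $T(G_A)\subseteq G_A$ if and only if $T\in\operatorname{M}_n(\mathcal{R})$ and, for every $p\in\mathcal{P}'$ and every prime ideal $\mathfrak p$ of $\mathcal{O}_F$ above $p$, we have $T(\mathcal{X}_{A,\mathfrak p})\subseteq\mathcal{X}_{A,\mathfrak p}$, and every $j$-th column $(\gamma_{1j},\ldots,\gamma_{nj})^t$ of $T$ with $j\in\{t_p+1,\ldots,n\}$ satisfies $$\gamma_{kj}-\sum_{i=1}^{t_p}\gamma_{ij}\alpha_{pik}\in\mathbb{Z}_p\quad\text{for all }k\in\{t_p+1,\ldots,n\}.$$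
   Context: $G_A=\{A^k\mathbf{x}\mid\mathbf{x}\in\mathbb{Z}^n,k\in\mathbb{Z}\}\subseteq\mathbb{Q}^n$; $\mathcal{R}=\mathbb{Z}[1/\det A]$; $h_A$ is the characteristic polynomial of $A$; $\mathcal{P}$ is the set of primes dividing $\det A$; $\mathcal{P}'=\{p\in\mathcal{P}\mid h_A\not\equiv x^n\pmod p\}$; $t_p$ is the multiplicity of $0$ as a root of $h_A$ mod $p$. $\mathcal{X}_{A,\mathfrak p}\subseteq F^n$ is the $F$-span of the generalized eigenvectors of $A$ for those eigenvalues $\lambda$ of $A$ with $\lambda\in\mathfrak p$ (i.e. divisible by $\mathfrak p$ in $\mathcal{O}_F$). For $a=\sum_{i\ge0}a_ip^i\in\mathbb{Z}_p$ with digits $a_i\in\{0,\ldots,p-1\}$ and $k\ge1$, $a^{(k)}=\sum_{i<k}a_ip^i\in\mathbb{Z}$; for $\mathbf{x}\in\mathbb{Z}_p^n$, $\mathbf{x}^{(k)}$ is defined componentwise, and $p^{-\infty}\mathbf{x}=\{p^{-k}\mathbf{x}^{(k)}\mid k\in\mathbb{N}\}\subset\mathbb{Q}^n$. A characteristic of $G_A$ relative to the standard basis is a family $\alpha_{pij}\in\mathbb{Z}_p$ ($p\in\mathcal{P}'$, $1\le i\le t_p<j\le n$) such that $G_A$ is generated as an abelian group by $\mathbf{e}_1,\ldots,\mathbf{e}_n$, the sets $q^{-\infty}\mathbf{e}_j$ for $q\in\mathcal{P}\setminus\mathcal{P}'$, $1\le j\le n$, and the sets $p^{-\infty}\mathbf{x}_{pi}$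 for $p\in\mathcal{P}'$, $1\le i\le t_p$, where $\mathbf{x}_{pi}=\mathbf{e}_i+\sum_{j=t_p+1}^n\alpha_{pij}\mathbf{e}_j$. *)

theory Defs
  imports
    "Jordan_Normal_Form.Char_Poly"
    "Jordan_Normal_Form.VS_Connect"
    "Berlekamp_Zassenhaus.Poly_Mod"
    "HOL-Algebra.Embedded_Algebras"
    "HOL-Algebra.Ideal"
begin

section \<open>The $p$-adic integers and the $p$-adic numbers\<close>

text \<open>
  $\mathbb{Z}_p$ is the inverse limit of the rings $\mathbb{Z}/p^k$: the entry \<open>a k\<close> of a compatible
  sequence is the residue of \<open>a\<close> modulo \<open>p ^ k\<close>, represented in \<open>{0..<p ^ k}\<close>. Since \<open>p\<close> varies
  in the statements below, these are rings with an explicit carrier rather than types.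
\<close>

definition padic_int :: "int \<Rightarrow> (nat \<Rightarrow> int) ring" where
  "padic_int p = \<lparr>
     carrier = {a. \<forall>k. a k \<in> {0..<p ^ k} \<and> a (Suc k) mod p ^ k = a k},
     monoid.mult = (\<lambda>a b k. (a k * b k) mod p ^ k),
     one = (\<lambda>k. 1 mod p ^ k),
     ring.zero = (\<lambda>k. 0),
     add = (\<lambda>a b k. (a k + b k) mod p ^ k)\<rparr>"

definition padic_of_int :: "int \<Rightarrow> int \<Rightarrow> nat \<Rightarrow> int" where
  "padic_of_int p z = (\<lambda>k. z mod p ^ k)"

definition padic_digit :: "int \<Rightarrow> (nat \<Rightarrow> int) \<Rightarrow> nat \<Rightarrow> int" where
  "padic_digit p a i = a (Suc i) div p ^ i"

definition padic_trunc :: "int \<Rightarrow> nat \<Rightarrow> (nat \<Rightarrow> int) \<Rightarrow> int" where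
  "padic_trunc p k a = (\<Sum>i<k. padic_digit p a i * p ^ i)"

lemma padic_digit_range:
  assumes "p > 0" "a \<in> carrier (padic_int p)"
  shows "padic_digit p a i \<in> {0..<p}"
proof -
  have "0 \<le> a (Suc i)" "a (Suc i) < p * p ^ i"
    using assms(2) by (auto simp: padic_int_def dest: spec[of _ "Suc i"])
  moreover from this(2) have "a (Suc i) div p ^ i < p"
    using assms(1) by (smt (verit, best) of_int_less_iff of_int_mult of_int_pos
        pos_le_divide_eq real_of_int_div4 zero_less_power)
  ultimately show ?thesis
    using assms(1) by (simp add: padic_digit_def pos_imp_zdiv_nonneg_iff)
qed

lemma padic_trunc_eq:
  assumes "a \<in> carrier (padic_int p)"
  shows "padic_trunc p k a = a k"
proof (induction k)
  case 0
  have "\<forall>k. a k \<in> {0..<p ^ k}" using assms by (simp add: padic_int_def)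
  from spec[OF this, of 0] have "a 0 = 0" by simp
  then show ?case by (simp add: padic_trunc_def)
next
  case (Suc k)
  have "a (Suc k) mod p ^ k = a k" using assms by (simp add: padic_int_def)
  then have "a k + a (Suc k) div p ^ k * p ^ k = a (Suc k)"
    using div_mult_mod_eq[of "a (Suc k)" "p ^ k"] by simp
  then show ?case using Suc by (simp add: padic_trunc_def padic_digit_def)
qed

definition frac_rel :: "('a, 'b) ring_scheme \<Rightarrow> (('a \<times> 'a) \<times> ('a \<times> 'a)) set" where
  "frac_rel R = {((a, b), (c, d)).
     a \<in> carrier R \<and> b \<in> carrier R - {\<zero>\<^bsub>R\<^esub>} \<and> c \<in> carrier R \<and> d \<in> carrier R - {\<zero>\<^bsub>R\<^esub>} \<and>
     a \<otimes>\<^bsub>R\<^esub> d = c \<otimes>\<^bsub>R\<^esub> b}"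

definition frac_class :: "('a, 'b) ring_scheme \<Rightarrow> 'a \<Rightarrow> 'a \<Rightarrow> ('a \<times> 'a) set" where
  "frac_class R a b = frac_rel R `` {(a, b)}"

definition fraction_field :: "('a, 'b) ring_scheme \<Rightarrow> ('a \<times> 'a) set ring" where
  "fraction_field R = \<lparr>
     carrier = (carrier R \<times> (carrier R - {\<zero>\<^bsub>R\<^esub>})) // frac_rel R,
     monoid.mult = (\<lambda>X Y. \<Union>(a, b)\<in>X. \<Union>(c, d)\<in>Y. frac_class R (a \<otimes>\<^bsub>R\<^esub> c) (b \<otimes>\<^bsub>R\<^esub> d)),
     one = frac_class R \<one>\<^bsub>R\<^esub> \<one>\<^bsub>R\<^esub>,
     ring.zero = frac_class R \<zero>\<^bsub>R\<^esub> \<one>\<^bsub>R\<^esub>,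
     add = (\<lambda>X Y. \<Union>(a, b)\<in>X. \<Union>(c, d)\<in>Y.
              frac_class R (a \<otimes>\<^bsub>R\<^esub> d \<oplus>\<^bsub>R\<^esub> c \<otimes>\<^bsub>R\<^esub> b) (b \<otimes>\<^bsub>R\<^esub> d))\<rparr>"

definition padic_field :: "int \<Rightarrow> ((nat \<Rightarrow> int) \<times> (nat \<Rightarrow> int)) set ring" where
  "padic_field p = fraction_field (padic_int p)"

definition padic_emb :: "int \<Rightarrow> (nat \<Rightarrow> int) \<Rightarrow> ((nat \<Rightarrow> int) \<times> (nat \<Rightarrow> int)) set" where
  "padic_emb p a = frac_class (padic_int p) a \<one>\<^bsub>padic_int p\<^esub>"

definition padic_of_rat :: "int \<Rightarrow> rat \<Rightarrow> ((nat \<Rightarrow> int) \<times> (nat \<Rightarrow> int)) set" where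
  "padic_of_rat p r = frac_class (padic_int p)
     (padic_of_int p (fst (quotient_of r))) (padic_of_int p (snd (quotient_of r)))"


section \<open>The group $G_A$ and its characteristic\<close>

definition mat_zpow :: "'a :: field mat \<Rightarrow> int \<Rightarrow> 'a mat" where
  "mat_zpow A k = (if k \<ge> 0 then A ^\<^sub>m nat k else the (mat_inverse A) ^\<^sub>m nat (- k))"

definition group_of_mat :: "int mat \<Rightarrow> rat vec set" where
  "group_of_mat A = {mat_zpow (map_mat rat_of_int A) k *\<^sub>v map_vec rat_of_int x | x k.
     x \<in> carrier_vec (dim_row A)}"

definition adjoin_inverse :: "int \<Rightarrow> rat set" where
  "adjoin_inverse d = range (\<lambda>f :: int poly. poly (map_poly rat_of_int f) (1 / rat_of_int d))"

definition primes_of_mat :: "int mat \<Rightarrow> int set" where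
  "primes_of_mat A = {p. prime p \<and> p dvd det A}"

definition primes_of_mat' :: "int mat \<Rightarrow> int set" where
  "primes_of_mat' A =
     {p \<in> primes_of_mat A. \<not> poly_mod.eq_m p (char_poly A) ([:0, 1:] ^ dim_row A)}"

text \<open>The analogue, for the reduction of \<open>f\<close> modulo \<open>p\<close>, of \<^const>\<open>Polynomial.order\<close>.\<close>

definition root_order_mod :: "int \<Rightarrow> int \<Rightarrow> int poly \<Rightarrow> nat" where
  "root_order_mod p a f = (LEAST k. \<not> poly_mod.dvdm p ([:- a, 1:] ^ Suc k) f)"

definition zero_mult :: "int mat \<Rightarrow> int \<Rightarrow> nat" where
  "zero_mult A p = root_order_mod p 0 (char_poly A)"

definition p_inf :: "int \<Rightarrow> (nat \<Rightarrow> int) vec \<Rightarrow> rat vec set" where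
  "p_inf p x = {(1 / rat_of_int p ^ k) \<cdot>\<^sub>v map_vec (\<lambda>a. rat_of_int (padic_trunc p k a)) x | k.
     k \<ge> 1}"

definition padic_unit_vec :: "int \<Rightarrow> nat \<Rightarrow> nat \<Rightarrow> (nat \<Rightarrow> int) vec" where
  "padic_unit_vec p n j = vec n (\<lambda>k. if k = j then \<one>\<^bsub>padic_int p\<^esub> else \<zero>\<^bsub>padic_int p\<^esub>)"

text \<open>
  The vector $e_i + \sum_{t \le j < n} \alpha_{pij} e_j$ of $\mathbb{Z}_p^n$, where $i < t$.
  Indices of vectors and matrices start at 0, so the informal ranges $1 \le i \le t_p$ and
  $t_p < j \le n$ become $i < t$ and $t \le j < n$.
\<close>

definition char_vec ::
  "(int \<Rightarrow> nat \<Rightarrow> nat \<Rightarrow> (nat \<Rightarrow> int)) \<Rightarrow> nat \<Rightarrow> nat \<Rightarrow> int \<Rightarrow> nat \<Rightarrow> (nat \<Rightarrow> int) vec" where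
  "char_vec \<alpha> n t p i = vec n (\<lambda>k.
     if k = i then \<one>\<^bsub>padic_int p\<^esub> else if k < t then \<zero>\<^bsub>padic_int p\<^esub> else \<alpha> p i k)"

definition is_characteristic ::
  "int mat \<Rightarrow> (int \<Rightarrow> nat \<Rightarrow> nat \<Rightarrow> (nat \<Rightarrow> int)) \<Rightarrow> bool" where
  "is_characteristic A \<alpha> \<longleftrightarrow> (let n = dim_row A in
     (\<forall>p\<in>primes_of_mat' A. \<forall>i<zero_mult A p. \<forall>j\<in>{zero_mult A p..<n}.
        \<alpha> p i j \<in> carrier (padic_int p)) \<and>
     group_of_mat A = generate (monoid_vec TYPE(rat) n)
       (unit_vec n ` {..<n}
        \<union> (\<Union>q\<in>primes_of_mat A - primes_of_mat' A. \<Union>j<n. p_inf q (padic_unit_vec q n j))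
        \<union> (\<Union>p\<in>primes_of_mat' A. \<Union>i<zero_mult A p.
             p_inf p (char_vec \<alpha> n (zero_mult A p) p i))))"


section \<open>Number fields and generalized eigenvectors\<close>

text \<open>$\overline{\mathbb{Q}}$ is the algebraic closure of the rationals inside the complex numbers.\<close>

definition number_field :: "complex set \<Rightarrow> bool" where
  "number_field F \<longleftrightarrow> subfield F (class_ring :: complex ring) \<and>
     ring.finite_dimension (class_ring :: complex ring) \<rat> F"

definition ring_of_integers :: "complex set \<Rightarrow> complex ring" where
  "ring_of_integers F = class_ring\<lparr>carrier := {x \<in> F. algebraic_int x}\<rparr>"

definition prime_above :: "complex set \<Rightarrow> int \<Rightarrow> complex set \<Rightarrow> bool" where
  "prime_above F p P \<longleftrightarrow> primeideal P (ring_of_integers F) \<and>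
     P \<inter> \<int> = range (\<lambda>k. complex_of_int (p * k))"

definition generalized_eigenvector :: "'a :: field mat \<Rightarrow> 'a vec \<Rightarrow> 'a \<Rightarrow> bool" where
  "generalized_eigenvector A v k \<longleftrightarrow>
     v \<in> carrier_vec (dim_row A) \<and> v \<noteq> 0\<^sub>v (dim_row A) \<and>
     (\<exists>m. char_matrix A k ^\<^sub>m m *\<^sub>v v = 0\<^sub>v (dim_row A))"

definition eigenspace_at :: "complex set \<Rightarrow> int mat \<Rightarrow> complex set \<Rightarrow> complex vec set" where
  "eigenspace_at F A P = LinearCombinations.module.span
     (class_ring\<lparr>carrier := F\<rparr>) (module_vec TYPE(complex) (dim_row A))
     {v. set\<^sub>v v \<subseteq> F \<and>
         (\<exists>l\<in>P. eigenvalue (map_mat of_int A) l \<and> generalized_eigenvector (map_mat of_int A) v l)}"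

end

theory Submission
  imports
    Defs
    "HOL-Number_Theory.Modular_Inverse"
    "HOL-Algebra.Finite_Extensions"
    "Jordan_Normal_Form.Schur_Decomposition"
begin

text \<open>
  A rational vector \<open>v\<close> lies in \<open>G\<^sub>A\<close> iff for every prime \<open>p\<close> some \<open>A\<^sup>l v\<close> is \<open>p\<close>-integral. This is
  \<open>p\<close>-integrality of \<open>v\<close> if \<open>p\<close> does not divide the determinant, no condition if \<open>p\<close> is in \<open>\<P> - \<P>'\<close>, and for
  \<open>p\<close> in \<open>\<P>'\<close> the characteristic turns it into \<open>p\<close>-adic integrality of the linear forms
  \<open>v\<^sub>k - \<Sum>\<^sub>i v\<^sub>i \<alpha>\<^sub>p\<^sub>i\<^sub>k\<close>, whence the condition on the columns of \<open>T\<close>.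

  No completion is needed to bring in the eigenspaces: in the localization of \<open>\<O>\<^sub>F\<close> at a prime above \<open>p\<close>,
  with the powers of \<open>p\<close> as neighbourhoods of 0, the eigenspace consists of the \<open>v\<close> with \<open>A\<^sup>m v \<longrightarrow> 0\<close>,
  while \<open>A\<close> preserves divisibility by powers of \<open>p\<close> in both directions on the sum of the other generalized
  eigenspaces. If \<open>T\<close> maps \<open>G\<^sub>A\<close> to itself, then each \<open>T A\<^sup>-\<^sup>k\<close> becomes integral after multiplication
  by a power of \<open>A\<close>, so \<open>T\<close> preserves the condition \<open>A\<^sup>m v \<longrightarrow> 0\<close>. Conversely, by the pigeonhole principle there
  are \<open>m\<close> for which \<open>A\<^sup>m\<close> is idempotent modulo a high power of \<open>p\<close>; then \<open>A\<^sup>m\<close> is close to the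
  projection with kernel the eigenspace, and stability of the latter makes \<open>A\<^sup>m T (1 - A\<^sup>m)\<close> divisible by a
  high power of \<open>p\<close>, so that \<open>T g\<close> and \<open>T A\<^sup>m g\<close> agree modulo the localization of \<open>G\<^sub>A\<close>, where
  \<open>A\<^sup>m g\<close> is integral for \<open>g \<in> G\<^sub>A\<close>.
\<close>

hide_const (open) Divisibility.prime Polynomials.degree Polynomials.lead_coeff

section \<open>Fractions over a domain\<close>

context domain
begin

abbreviation nonzero :: "'a set" where
  "nonzero \<equiv> carrier R - {\<zero>}"

abbreviation K :: "('a \<times> 'a) set ring" where
  "K \<equiv> fraction_field R"

lemma equiv_frac_rel: "equiv (carrier R \<times> nonzero) (frac_rel R)"
proof (rule equivI)
  show "frac_rel R \<subseteq> (carrier R \<times> nonzero) \<times> (carrier R \<times> nonzero)"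
    by (auto simp: frac_rel_def)
  show "refl_on (carrier R \<times> nonzero) (frac_rel R)"
    by (auto simp: refl_on_def frac_rel_def)
  show "sym (frac_rel R)"
    by (auto simp: sym_def frac_rel_def)
  show "trans (frac_rel R)"
  proof (rule transI)
    fix x y z assume xy: "(x, y) \<in> frac_rel R" and yz: "(y, z) \<in> frac_rel R"
    obtain a b c d e f where xyz: "x = (a, b)" "y = (c, d)" "z = (e, f)" by (metis prod.exhaust)
    have mem: "a \<in> carrier R" "b \<in> nonzero" "c \<in> carrier R" "d \<in> nonzero" "e \<in> carrier R" "f \<in> nonzero"
      and ad: "a \<otimes> d = c \<otimes> b" and cf: "c \<otimes> f = e \<otimes> d"
      using xy yz by (auto simp: xyz frac_rel_def)
    have "(a \<otimes> f) \<otimes> d = (a \<otimes> d) \<otimes> f" using mem by (simp add: m_ac)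
    also have "\<dots> = (c \<otimes> f) \<otimes> b" using mem by (simp add: ad m_ac)
    also have "\<dots> = (e \<otimes> b) \<otimes> d" using mem by (simp add: cf m_ac)
    finally have "a \<otimes> f = e \<otimes> b" using m_rcancel[of d "a \<otimes> f" "e \<otimes> b"] mem by simp
    then show "(x, z) \<in> frac_rel R" using mem by (auto simp: xyz frac_rel_def)
  qed
qed

lemma frac_class_eq_iff:
  assumes "a \<in> carrier R" "b \<in> nonzero" "c \<in> carrier R" "d \<in> nonzero"
  shows "frac_class R a b = frac_class R c d \<longleftrightarrow> a \<otimes> d = c \<otimes> b"
  using eq_equiv_class_iff[OF equiv_frac_rel, of "(a, b)" "(c, d)"] assms
  by (simp add: frac_class_def frac_rel_def)

lemma pair_mem_frac_class_iff: "(c, d) \<in> frac_class R a b \<longleftrightarrow> ((a, b), (c, d)) \<in> frac_rel R"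
  by (simp add: frac_class_def)

lemma frac_class_closed: "a \<in> carrier R \<Longrightarrow> b \<in> nonzero \<Longrightarrow> frac_class R a b \<in> carrier K"
  by (auto simp: fraction_field_def frac_class_def intro: quotientI)

lemma fraction_field_cases:
  assumes "x \<in> carrier K"
  obtains a b where "a \<in> carrier R" "b \<in> nonzero" "x = frac_class R a b"
  using assms by (auto simp: fraction_field_def frac_class_def elim!: quotientE)

lemma UN_frac_class_eq:
  assumes "a \<in> carrier R" "b \<in> nonzero" "c \<in> carrier R" "d \<in> nonzero"
    and "\<And>a' b' c' d'. \<lbrakk>a' \<in> carrier R; b' \<in> nonzero; c' \<in> carrier R; d' \<in> nonzero;
      a \<otimes> b' = a' \<otimes> b; c \<otimes> d' = c' \<otimes> d\<rbrakk> \<Longrightarrow> f a' b' c' d' = f a b c d"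
  shows "(\<Union>(a', b')\<in>frac_class R a b. \<Union>(c', d')\<in>frac_class R c d. f a' b' c' d') = f a b c d"
proof -
  have "f a' b' c' d' = f a b c d"
    if "(a', b') \<in> frac_class R a b" "(c', d') \<in> frac_class R c d" for a' b' c' d'
    using that by (intro assms(5)) (auto simp: pair_mem_frac_class_iff frac_rel_def)
  moreover have "(a, b) \<in> frac_class R a b" "(c, d) \<in> frac_class R c d"
    using assms(1-4) by (auto simp: pair_mem_frac_class_iff frac_rel_def)
  ultimately show ?thesis by blast
qed

lemma frac_class_add:
  assumes "a \<in> carrier R" "b \<in> nonzero" "c \<in> carrier R" "d \<in> nonzero"
  shows "frac_class R a b \<oplus>\<^bsub>K\<^esub> frac_class R c d = frac_class R (a \<otimes> d \<oplus> c \<otimes> b) (b \<otimes> d)"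
  unfolding fraction_field_def ring.simps
proof (rule UN_frac_class_eq[OF assms])
  fix a' b' c' d'
  assume mem: "a' \<in> carrier R" "b' \<in> nonzero" "c' \<in> carrier R" "d' \<in> nonzero"
    and eq: "a \<otimes> b' = a' \<otimes> b" "c \<otimes> d' = c' \<otimes> d"
  have "(a \<otimes> d \<oplus> c \<otimes> b) \<otimes> (b' \<otimes> d') = (a \<otimes> b') \<otimes> (d \<otimes> d') \<oplus> (c \<otimes> d') \<otimes> (b \<otimes> b')"
    using mem assms by (simp add: l_distr r_distr m_ac)
  also have "\<dots> = (a' \<otimes> d' \<oplus> c' \<otimes> b') \<otimes> (b \<otimes> d)"
    unfolding eq using mem assms by (simp add: l_distr r_distr m_ac)
  finally show "frac_class R (a' \<otimes> d' \<oplus> c' \<otimes> b') (b' \<otimes> d') = frac_class R (a \<otimes> d \<oplus> c \<otimes> b) (b \<otimes> d)"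
    using mem assms by (subst frac_class_eq_iff) (auto simp: integral_iff)
qed

lemma frac_class_mult:
  assumes "a \<in> carrier R" "b \<in> nonzero" "c \<in> carrier R" "d \<in> nonzero"
  shows "frac_class R a b \<otimes>\<^bsub>K\<^esub> frac_class R c d = frac_class R (a \<otimes> c) (b \<otimes> d)"
  unfolding fraction_field_def monoid.simps
proof (rule UN_frac_class_eq[OF assms])
  fix a' b' c' d'
  assume mem: "a' \<in> carrier R" "b' \<in> nonzero" "c' \<in> carrier R" "d' \<in> nonzero"
    and eq: "a \<otimes> b' = a' \<otimes> b" "c \<otimes> d' = c' \<otimes> d"
  have "(a \<otimes> c) \<otimes> (b' \<otimes> d') = (a \<otimes> b') \<otimes> (c \<otimes> d')" using mem assms by (simp add: m_ac)
  also have "\<dots> = (a' \<otimes> c') \<otimes> (b \<otimes> d)" unfolding eq using mem assms by (simp add: m_ac)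
  finally show "frac_class R (a' \<otimes> c') (b' \<otimes> d') = frac_class R (a \<otimes> c) (b \<otimes> d)"
    using mem assms by (subst frac_class_eq_iff) (auto simp: integral_iff)
qed

lemma frac_class_add_same_denom:
  assumes "a \<in> carrier R" "c \<in> carrier R" "d \<in> nonzero"
  shows "frac_class R a d \<oplus>\<^bsub>K\<^esub> frac_class R c d = frac_class R (a \<oplus> c) d"
  using assms
  by (subst frac_class_add, simp_all, subst frac_class_eq_iff)
     (auto simp: integral_iff l_distr r_distr m_ac)

lemma zero_fraction_field: "d \<in> nonzero \<Longrightarrow> \<zero>\<^bsub>K\<^esub> = frac_class R \<zero> d"
  by (simp add: fraction_field_def frac_class_eq_iff)

lemma abelian_group_fraction_field: "abelian_group K"
proof (rule abelian_groupI)
  show "\<zero>\<^bsub>K\<^esub> \<in> carrier K"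
    using zero_fraction_field[of \<one>] frac_class_closed[of \<zero> \<one>] by simp
next
  fix x y assume "x \<in> carrier K" "y \<in> carrier K"
  then obtain a b c d where frac: "a \<in> carrier R" "b \<in> nonzero" "x = frac_class R a b"
    "c \<in> carrier R" "d \<in> nonzero" "y = frac_class R c d"
    by (metis fraction_field_cases)
  then show "x \<oplus>\<^bsub>K\<^esub> y \<in> carrier K"
    by (auto simp: frac_class_add integral_iff intro!: frac_class_closed)
  show "x \<oplus>\<^bsub>K\<^esub> y = y \<oplus>\<^bsub>K\<^esub> x"
    using frac by (auto simp: frac_class_add m_comm a_comm)
next
  fix x y z assume "x \<in> carrier K" "y \<in> carrier K" "z \<in> carrier K"
  then obtain a b c d e f where "a \<in> carrier R" "b \<in> nonzero" "x = frac_class R a b"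
    "c \<in> carrier R" "d \<in> nonzero" "y = frac_class R c d"
    "e \<in> carrier R" "f \<in> nonzero" "z = frac_class R e f"
    by (metis fraction_field_cases)
  then show "x \<oplus>\<^bsub>K\<^esub> y \<oplus>\<^bsub>K\<^esub> z = x \<oplus>\<^bsub>K\<^esub> (y \<oplus>\<^bsub>K\<^esub> z)"
    by (simp add: frac_class_add integral_iff l_distr r_distr m_ac a_ac)
next
  fix x assume "x \<in> carrier K"
  then obtain a b where frac: "a \<in> carrier R" "b \<in> nonzero" "x = frac_class R a b"
    by (metis fraction_field_cases)
  then show "\<zero>\<^bsub>K\<^esub> \<oplus>\<^bsub>K\<^esub> x = x"
    by (simp add: zero_fraction_field[of b] frac_class_add_same_denom)
  show "\<exists>y\<in>carrier K. y \<oplus>\<^bsub>K\<^esub> x = \<zero>\<^bsub>K\<^esub>"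
    using frac
    by (intro bexI[of _ "frac_class R (\<ominus> a) b"])
       (simp_all add: frac_class_add_same_denom l_neg zero_fraction_field[of b] frac_class_closed)
qed

lemma frac_class_minus_same_denom:
  assumes "a \<in> carrier R" "c \<in> carrier R" "d \<in> nonzero"
  shows "frac_class R a d \<ominus>\<^bsub>K\<^esub> frac_class R c d = frac_class R (a \<ominus> c) d"
proof -
  interpret K: abelian_group K by (rule abelian_group_fraction_field)
  have "frac_class R (a \<ominus> c) d \<oplus>\<^bsub>K\<^esub> frac_class R c d = frac_class R a d"
    using assms by (simp add: frac_class_add_same_denom a_minus_def a_assoc l_neg)
  moreover have "frac_class R (a \<ominus> c) d \<in> carrier K" "frac_class R c d \<in> carrier K"
    using assms by (auto intro!: frac_class_closed)
  ultimately show ?thesis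
    by (metis K.minus_eq K.add.inv_solve_right K.a_closed)
qed

lemma frac_class_finsum_same_denom:
  assumes "finite I" "\<And>i. i \<in> I \<Longrightarrow> a i \<in> carrier R" "d \<in> nonzero"
  shows "(\<Oplus>\<^bsub>K\<^esub>i\<in>I. frac_class R (a i) d) = frac_class R (\<Oplus>i\<in>I. a i) d"
proof -
  interpret K: abelian_group K by (rule abelian_group_fraction_field)
  show ?thesis
    using assms(1,2)
  proof (induction I)
    case empty
    show ?case using zero_fraction_field[OF assms(3)] by simp
  next
    case (insert x I)
    have "(\<Oplus>\<^bsub>K\<^esub>i\<in>insert x I. frac_class R (a i) d) =
        frac_class R (a x) d \<oplus>\<^bsub>K\<^esub> (\<Oplus>\<^bsub>K\<^esub>i\<in>I. frac_class R (a i) d)"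
      using insert assms(3) by (intro K.finsum_insert) (auto intro!: frac_class_closed)
    also have "\<dots> = frac_class R (a x \<oplus> (\<Oplus>i\<in>I. a i)) d"
      using insert assms(3) finsum_closed[of a I] by (simp add: frac_class_add_same_denom Pi_def)
    also have "a x \<oplus> (\<Oplus>i\<in>I. a i) = (\<Oplus>i\<in>insert x I. a i)"
      using insert by (intro finsum_insert[symmetric]) auto
    finally show ?case .
  qed
qed

end

section \<open>The ring of $p$-adic integers\<close>

lemma padic_int_simps:
  "(x \<oplus>\<^bsub>padic_int p\<^esub> y) k = (x k + y k) mod p ^ k"
  "(x \<otimes>\<^bsub>padic_int p\<^esub> y) k = (x k * y k) mod p ^ k"
  "\<zero>\<^bsub>padic_int p\<^esub> k = 0"
  "\<one>\<^bsub>padic_int p\<^esub> k = 1 mod p ^ k"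
  by (simp_all add: padic_int_def)

lemma padic_int_range:
  assumes "a \<in> carrier (padic_int p)"
  shows "0 \<le> a k" "a k < p ^ k"
  using assms by (auto simp: padic_int_def)

lemma padic_int_mod:
  assumes "a \<in> carrier (padic_int p)" "k \<le> m"
  shows "a m mod p ^ k = a k"
  using assms(2)
proof (induction m rule: dec_induct)
  case base
  show ?case using padic_int_range[OF assms(1), of k] by simp
next
  case (step m)
  have "a (Suc m) mod p ^ k = (a (Suc m) mod p ^ m) mod p ^ k"
    using step(1) by (simp add: le_imp_power_dvd mod_mod_cancel)
  also have "\<dots> = a k" using assms(1) step by (simp add: padic_int_def)
  finally show ?case .
qed

lemma padic_int_cong:
  assumes "a \<in> carrier (padic_int p)" "k \<le> m"
  shows "[a m = a k] (mod p ^ k)"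
  using padic_int_mod[OF assms] padic_int_mod[OF assms(1) order_refl, of k] by (simp add: cong_def)

lemma padic_int_residuesI:
  assumes "p > 0" "\<And>k. [a (Suc k) = a k] (mod p ^ k)"
  shows "(\<lambda>k. a k mod p ^ k) \<in> carrier (padic_int p)"
proof -
  have "a (Suc k) mod p ^ Suc k mod p ^ k = a k mod p ^ k" for k
    using assms(2)[of k] by (simp add: mod_mod_cancel cong_def)
  then show ?thesis using assms(1) by (simp add: padic_int_def)
qed

lemma abelian_group_padic_int:
  assumes "p > 0"
  shows "abelian_group (padic_int p)"
proof (rule abelian_groupI)
  fix x assume x: "x \<in> carrier (padic_int p)"
  have "(\<lambda>k. (- x k) mod p ^ k) \<in> carrier (padic_int p)"
    using padic_int_cong[OF x, of _ "Suc _"]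
    by (intro padic_int_residuesI assms) (simp add: cong_minus_minus_iff)
  moreover have "(\<lambda>k. (- x k) mod p ^ k) \<oplus>\<^bsub>padic_int p\<^esub> x = \<zero>\<^bsub>padic_int p\<^esub>"
    by (simp add: padic_int_simps mod_add_left_eq fun_eq_iff)
  ultimately show "\<exists>y\<in>carrier (padic_int p). y \<oplus>\<^bsub>padic_int p\<^esub> x = \<zero>\<^bsub>padic_int p\<^esub>" by blast
next
  fix x y assume "x \<in> carrier (padic_int p)" "y \<in> carrier (padic_int p)"
  then have "(\<lambda>k. (x k + y k) mod p ^ k) \<in> carrier (padic_int p)"
    using assms by (intro padic_int_residuesI cong_add padic_int_cong) auto
  then show "x \<oplus>\<^bsub>padic_int p\<^esub> y \<in> carrier (padic_int p)" by (simp add: padic_int_def)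
qed (use assms padic_int_mod[OF _ order_refl] in
      \<open>auto simp: fun_eq_iff padic_int_simps mod_add_left_eq mod_add_right_eq ac_simps,
       auto simp: padic_int_def\<close>)

lemma comm_monoid_padic_int:
  assumes "p > 0"
  shows "Group.comm_monoid (padic_int p)"
proof (rule comm_monoidI)
  fix x y assume "x \<in> carrier (padic_int p)" "y \<in> carrier (padic_int p)"
  then have "(\<lambda>k. (x k * y k) mod p ^ k) \<in> carrier (padic_int p)"
    using assms by (intro padic_int_residuesI cong_mult padic_int_cong) auto
  then show "x \<otimes>\<^bsub>padic_int p\<^esub> y \<in> carrier (padic_int p)" by (simp add: padic_int_def)
next
  show "\<one>\<^bsub>padic_int p\<^esub> \<in> carrier (padic_int p)"
    using padic_int_residuesI[OF assms, of "\<lambda>_. 1"] by (simp add: padic_int_def)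
qed (use padic_int_mod[OF _ order_refl] in
      \<open>auto simp: fun_eq_iff padic_int_simps mod_mult_left_eq mod_mult_right_eq ac_simps\<close>)

lemma cring_padic_int: "p > 0 \<Longrightarrow> cring (padic_int p)"
  by (intro cringI abelian_group_padic_int comm_monoid_padic_int)
     (auto simp: fun_eq_iff padic_int_simps mod_mult_left_eq mod_add_eq distrib_right)

lemma padic_int_minus_nth:
  assumes "p > 0" "x \<in> carrier (padic_int p)" "y \<in> carrier (padic_int p)"
  shows "(x \<ominus>\<^bsub>padic_int p\<^esub> y) k = (x k - y k) mod p ^ k"
proof -
  interpret cring "padic_int p" using assms(1) by (rule cring_padic_int)
  define z where "z = x \<ominus>\<^bsub>padic_int p\<^esub> y"
  have z: "z \<in> carrier (padic_int p)" using assms by (simp add: z_def)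
  have "z \<oplus>\<^bsub>padic_int p\<^esub> y = x" using assms by (simp add: z_def a_minus_def a_assoc l_neg)
  then have "(z k + y k) mod p ^ k = x k" by (auto simp: padic_int_simps)
  then have "(x k - y k) mod p ^ k = z k mod p ^ k"
    by (metis add_diff_cancel_right' mod_diff_left_eq)
  then show ?thesis using padic_int_mod[OF z order_refl] by (simp add: z_def)
qed

lemma padic_int_finsum_nth:
  assumes "p > 0" "finite I" "\<And>i. i \<in> I \<Longrightarrow> f i \<in> carrier (padic_int p)"
  shows "(\<Oplus>\<^bsub>padic_int p\<^esub>i\<in>I. f i) k = (\<Sum>i\<in>I. f i k) mod p ^ k"
proof -
  interpret cring "padic_int p" using assms(1) by (rule cring_padic_int)
  show ?thesis using assms(2,3)
  proof (induction I)
    case empty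
    show ?case by (simp add: padic_int_simps)
  next
    case (insert x I)
    then show ?case by (simp add: padic_int_simps mod_add_right_eq)
  qed
qed

lemma padic_of_int_closed: "p > 0 \<Longrightarrow> padic_of_int p z \<in> carrier (padic_int p)"
  unfolding padic_of_int_def by (rule padic_int_residuesI) auto

lemma padic_of_int_one: "padic_of_int p 1 = \<one>\<^bsub>padic_int p\<^esub>"
  by (simp add: padic_of_int_def padic_int_def)

lemma padic_of_int_mult:
  "padic_of_int p (x * y) = padic_of_int p x \<otimes>\<^bsub>padic_int p\<^esub> padic_of_int p y"
  by (simp add: padic_of_int_def padic_int_simps fun_eq_iff mod_mult_eq)

lemma padic_of_int_eq_zero_iff:
  assumes "p > 1"
  shows "padic_of_int p z = \<zero>\<^bsub>padic_int p\<^esub> \<longleftrightarrow> z = 0"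
proof
  assume "padic_of_int p z = \<zero>\<^bsub>padic_int p\<^esub>"
  then have dvd: "p ^ k dvd z" for k
    by (auto simp: padic_of_int_def padic_int_def fun_eq_iff mod_eq_0_iff_dvd)
  show "z = 0"
  proof (rule ccontr)
    assume "z \<noteq> 0"
    have "\<bar>z\<bar> < 2 ^ nat \<bar>z\<bar>"
      by (metis abs_ge_zero int_nat_eq of_nat_less_two_power of_nat_numeral of_nat_power)
    also have "(2::int) ^ nat \<bar>z\<bar> \<le> p ^ nat \<bar>z\<bar>" using assms by (intro power_mono) auto
    finally show False using dvd_imp_le_int[OF \<open>z \<noteq> 0\<close> dvd[of "nat \<bar>z\<bar>"]] assms by simp
  qed
qed (auto simp: padic_of_int_def padic_int_def)

lemma prime_power_dvd_mult_cases:
  fixes p x y :: int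
  assumes "prime p" "p ^ (k + l) dvd x * y" "\<not> p ^ k dvd x"
  shows "p ^ l dvd y"
proof (cases "y = 0")
  case False
  have "x \<noteq> 0" using assms(3) by auto
  have "multiplicity p x < k" using assms \<open>x \<noteq> 0\<close> power_dvd_iff_le_multiplicity[of x p k]
    prime_gt_1_int[OF assms(1)] by (auto simp: not_le)
  moreover have "k + l \<le> multiplicity p (x * y)"
    using assms False \<open>x \<noteq> 0\<close> power_dvd_iff_le_multiplicity[of "x * y" p "k + l"]
      prime_gt_1_int[OF assms(1)] by auto
  moreover have "multiplicity p (x * y) = multiplicity p x + multiplicity p y"
    using assms False \<open>x \<noteq> 0\<close> by (intro prime_elem_multiplicity_mult_distrib prime_imp_prime_elem)
  ultimately show ?thesis by (intro multiplicity_dvd') auto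
qed auto

lemma domain_padic_int:
  assumes "prime p"
  shows "domain (padic_int p)"
proof -
  have p: "p > 1" using assms by (rule prime_gt_1_int)
  interpret cring "padic_int p" using p by (intro cring_padic_int) auto
  show ?thesis
  proof (unfold_locales)
    show "\<one>\<^bsub>padic_int p\<^esub> \<noteq> \<zero>\<^bsub>padic_int p\<^esub>"
      using padic_of_int_eq_zero_iff[OF p, of 1] by (simp add: padic_of_int_one)
  next
    fix a b assume ab: "a \<otimes>\<^bsub>padic_int p\<^esub> b = \<zero>\<^bsub>padic_int p\<^esub>"
      and a: "a \<in> carrier (padic_int p)" and b: "b \<in> carrier (padic_int p)"
    show "a = \<zero>\<^bsub>padic_int p\<^esub> \<or> b = \<zero>\<^bsub>padic_int p\<^esub>"
    proof (rule ccontr)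
      assume "\<not> ?thesis"
      then obtain k l where kl: "a k \<noteq> 0" "b l \<noteq> 0" by (auto simp: padic_int_def fun_eq_iff)
      have "p ^ (k + l) dvd a (k + l) * b (k + l)"
        using fun_cong[OF ab, of "k + l"] by (simp add: padic_int_simps mod_eq_0_iff_dvd)
      moreover have "\<not> p ^ k dvd a (k + l)"
        using kl padic_int_mod[OF a, of k "k + l"] by (auto simp: dvd_eq_mod_eq_0)
      moreover have "\<not> p ^ l dvd b (k + l)"
        using kl padic_int_mod[OF b, of l "k + l"] by (auto simp: dvd_eq_mod_eq_0)
      ultimately show False using prime_power_dvd_mult_cases[OF assms] by blast
    qed
  qed
qed

lemma padic_of_int_unit:
  assumes "prime p" "\<not> p dvd d"
  obtains w where "w \<in> carrier (padic_int p)" "padic_of_int p d \<otimes>\<^bsub>padic_int p\<^esub> w = \<one>\<^bsub>padic_int p\<^esub>"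
proof -
  have p: "p > 1" using assms(1) by (rule prime_gt_1_int)
  have coprime: "Rings.coprime d (p ^ k)" for k
    using prime_imp_coprime[OF assms] by (simp add: ac_simps)
  define w where "w k = modular_inverse (p ^ k) d" for k
  have inverse: "[d * w k = 1] (mod p ^ k)" for k
    unfolding w_def using coprime by (rule cong_modular_inverse1)
  have "[w (Suc k) = w k] (mod p ^ k)" for k
  proof -
    have "[d * w (Suc k) = 1] (mod p ^ k)"
      using inverse[of "Suc k"] by (rule cong_dvd_modulus) simp
    then have "[d * w (Suc k) = d * w k] (mod p ^ k)"
      using inverse[of k] by (meson cong_trans cong_sym)
    then show ?thesis using coprime[of k] by (simp add: cong_mult_lcancel)
  qed
  then have "(\<lambda>k. w k mod p ^ k) \<in> carrier (padic_int p)"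
    using p by (intro padic_int_residuesI) auto
  moreover have "padic_of_int p d \<otimes>\<^bsub>padic_int p\<^esub> (\<lambda>k. w k mod p ^ k) = \<one>\<^bsub>padic_int p\<^esub>"
    using inverse by (simp add: fun_eq_iff padic_int_simps padic_of_int_def mod_mult_eq cong_def)
  ultimately show ?thesis by (rule that)
qed

lemma padic_int_divide_prime_power:
  assumes "p > 0" "y \<in> carrier (padic_int p)" "y e = 0"
  obtains z where "z \<in> carrier (padic_int p)" "y = padic_of_int p (p ^ e) \<otimes>\<^bsub>padic_int p\<^esub> z"
proof -
  have "p ^ e dvd y (k + e)" for k
    using padic_int_mod[OF assms(2), of e "k + e"] assms(3) by (simp add: dvd_eq_mod_eq_0)
  then obtain z where z: "\<And>k. y (k + e) = p ^ e * z k" unfolding dvd_def by metis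
  have "[p ^ e * z (Suc k) = p ^ e * z k] (mod p ^ e * p ^ k)" for k
    using padic_int_cong[OF assms(2), of "k + e" "Suc k + e"] z[of "Suc k"] z[of k]
    by (simp add: power_add mult.commute)
  then have "[z (Suc k) = z k] (mod p ^ k)" for k
    using assms(1) by (simp add: cong_iff_dvd_diff flip: right_diff_distrib)
  then have "(\<lambda>k. z k mod p ^ k) \<in> carrier (padic_int p)" using assms(1) by (intro padic_int_residuesI)
  moreover have "y = padic_of_int p (p ^ e) \<otimes>\<^bsub>padic_int p\<^esub> (\<lambda>k. z k mod p ^ k)"
  proof
    fix k
    have "y k = (p ^ e * z k) mod p ^ k"
      using padic_int_mod[OF assms(2), of k "k + e"] z[of k] by simp
    then show "y k = (padic_of_int p (p ^ e) \<otimes>\<^bsub>padic_int p\<^esub> (\<lambda>k. z k mod p ^ k)) k"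
      by (simp add: padic_int_simps padic_of_int_def mod_mult_eq)
  qed
  ultimately show ?thesis by (rule that)
qed

lemma prime_multiplicity_decompose:
  fixes p d :: int
  assumes "prime p" "d \<noteq> 0"
  obtains d' where "d = p ^ multiplicity p d * d'" "\<not> p dvd d'"
  using multiplicity_decompose'[of d p] assms not_prime_unit by metis

lemma padic_int_dvd_iff:
  assumes "prime p" "d \<noteq> 0" "y \<in> carrier (padic_int p)"
  shows "(\<exists>z\<in>carrier (padic_int p). y = padic_of_int p d \<otimes>\<^bsub>padic_int p\<^esub> z) \<longleftrightarrow>
    y (multiplicity p d) = 0"
proof
  let ?Zp = "padic_int p"
  assume "\<exists>z\<in>carrier ?Zp. y = padic_of_int p d \<otimes>\<^bsub>?Zp\<^esub> z"
  then obtain z where "y = padic_of_int p d \<otimes>\<^bsub>?Zp\<^esub> z" by blast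
  moreover have "d mod p ^ multiplicity p d = 0" using multiplicity_dvd by (rule dvd_imp_mod_0)
  ultimately show "y (multiplicity p d) = 0" by (simp add: padic_int_simps padic_of_int_def)
next
  let ?Zp = "padic_int p"
  have p: "p > 1" using assms(1) by (rule prime_gt_1_int)
  interpret cring ?Zp using p by (intro cring_padic_int) auto
  have of_int: "padic_of_int p x \<in> carrier ?Zp" for x using p by (intro padic_of_int_closed) simp
  obtain d' where d': "d = p ^ multiplicity p d * d'" "\<not> p dvd d'"
    using prime_multiplicity_decompose[OF assms(1,2)] .
  assume "y (multiplicity p d) = 0"
  then obtain z where z: "z \<in> carrier ?Zp" "y = padic_of_int p (p ^ multiplicity p d) \<otimes>\<^bsub>?Zp\<^esub> z"
    using padic_int_divide_prime_power[of p y "multiplicity p d"] p assms(3) by auto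
  obtain w where w: "w \<in> carrier ?Zp" "padic_of_int p d' \<otimes>\<^bsub>?Zp\<^esub> w = \<one>\<^bsub>?Zp\<^esub>"
    using padic_of_int_unit[OF assms(1) d'(2)] .
  have "padic_of_int p d \<otimes>\<^bsub>?Zp\<^esub> (w \<otimes>\<^bsub>?Zp\<^esub> z) =
      padic_of_int p (p ^ multiplicity p d) \<otimes>\<^bsub>?Zp\<^esub> ((padic_of_int p d' \<otimes>\<^bsub>?Zp\<^esub> w) \<otimes>\<^bsub>?Zp\<^esub> z)"
    using z(1) w(1) of_int by (subst d'(1)) (simp add: padic_of_int_mult m_assoc)
  then have "y = padic_of_int p d \<otimes>\<^bsub>?Zp\<^esub> (w \<otimes>\<^bsub>?Zp\<^esub> z)" using z w(2) of_int by simp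
  then show "\<exists>z\<in>carrier ?Zp. y = padic_of_int p d \<otimes>\<^bsub>?Zp\<^esub> z" using z(1) w(1) by blast
qed

section \<open>Subrings, localizations and lattices of vectors\<close>

locale unital_subring =
  fixes R :: "'a :: comm_ring_1 set"
  assumes one_closed: "1 \<in> R"
    and diff_closed: "x \<in> R \<Longrightarrow> y \<in> R \<Longrightarrow> x - y \<in> R"
    and mult_closed: "x \<in> R \<Longrightarrow> y \<in> R \<Longrightarrow> x * y \<in> R"
begin

lemma zero_closed: "0 \<in> R"
  using diff_closed[OF one_closed one_closed] by simp

lemma uminus_closed: "x \<in> R \<Longrightarrow> - x \<in> R"
  using diff_closed[OF zero_closed, of x] by simp

lemma add_closed: "x \<in> R \<Longrightarrow> y \<in> R \<Longrightarrow> x + y \<in> R"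
  using diff_closed[of x "- y"] uminus_closed by simp

lemma sum_closed: "(\<And>i. i \<in> I \<Longrightarrow> f i \<in> R) \<Longrightarrow> sum f I \<in> R"
  by (induction I rule: infinite_finite_induct) (auto intro: zero_closed add_closed)

lemma power_closed: "x \<in> R \<Longrightarrow> x ^ k \<in> R"
  by (induction k) (auto intro: one_closed mult_closed)

lemma of_int_closed: "of_int z \<in> R"
proof -
  have "of_nat k \<in> R" for k
    by (induction k) (auto intro: zero_closed one_closed add_closed)
  then show ?thesis by (cases z rule: int_cases2) (auto intro: uminus_closed)
qed

end

locale division_subring = unital_subring R for R :: "'a :: field set" +
  assumes inverse_closed: "x \<in> R \<Longrightarrow> inverse x \<in> R"

lemma unital_subring_Ints: "unital_subring \<int>"
  by unfold_locales auto

definition localization :: "'a :: field set \<Rightarrow> 'a set \<Rightarrow> 'a set" where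
  "localization R S = {a / b | a b. a \<in> R \<and> b \<in> S}"

lemma unital_subring_localization:
  assumes "unital_subring R" "S \<subseteq> R" "1 \<in> S" "0 \<notin> S" "\<And>b d. b \<in> S \<Longrightarrow> d \<in> S \<Longrightarrow> b * d \<in> S"
  shows "unital_subring (localization R S)"
proof -
  interpret unital_subring R by (rule assms(1))
  show ?thesis
  proof
    show "1 \<in> localization R S"
      unfolding localization_def using one_closed assms(3)
      by (intro CollectI exI[of _ 1]) simp
  next
    fix x y assume "x \<in> localization R S" "y \<in> localization R S"
    then obtain a b c d where frac: "x = a / b" "y = c / d" "a \<in> R" "b \<in> S" "c \<in> R" "d \<in> S"
      unfolding localization_def by blast
    have nz: "b \<noteq> 0" "d \<noteq> 0" using frac(4,6) assms(4) by auto
    have "x - y = (a * d - c * b) / (b * d)" using nz frac(1,2) by (simp add: field_simps)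
    moreover have "a * d - c * b \<in> R"
      using frac assms(2) by (intro diff_closed mult_closed) auto
    ultimately show "x - y \<in> localization R S"
      unfolding localization_def using assms(5)[OF frac(4,6)] by blast
    have "x * y = (a * c) / (b * d)" using frac(1,2) by simp
    then show "x * y \<in> localization R S"
      unfolding localization_def using assms(5)[OF frac(4,6)] mult_closed[OF frac(3,5)] by blast
  qed
qed

definition vecs_over :: "'a set \<Rightarrow> nat \<Rightarrow> 'a vec set" where
  "vecs_over R n = {v \<in> carrier_vec n. \<forall>i<n. v $ i \<in> R}"

definition mats_over :: "'a set \<Rightarrow> nat \<Rightarrow> 'a mat set" where
  "mats_over R n = {M \<in> carrier_mat n n. \<forall>i<n. \<forall>j<n. M $$ (i, j) \<in> R}"

lemma vecs_over_carrier: "v \<in> vecs_over R n \<Longrightarrow> v \<in> carrier_vec n"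
  by (simp add: vecs_over_def)

lemma mats_over_carrier: "M \<in> mats_over R n \<Longrightarrow> M \<in> carrier_mat n n"
  by (simp add: mats_over_def)

lemma vecs_over_mono: "R \<subseteq> S \<Longrightarrow> v \<in> vecs_over R n \<Longrightarrow> v \<in> vecs_over S n"
  by (auto simp: vecs_over_def)

lemma unit_vec_over: "unital_subring R \<Longrightarrow> unit_vec n j \<in> vecs_over R n"
  by (auto simp: vecs_over_def unit_vec_def unital_subring.zero_closed unital_subring.one_closed)

lemma map_vec_of_int_over: "unital_subring R \<Longrightarrow> x \<in> carrier_vec n \<Longrightarrow> map_vec of_int x \<in> vecs_over R n"
  by (auto simp: vecs_over_def unital_subring.of_int_closed)

lemma map_mat_of_int_over: "unital_subring R \<Longrightarrow> M \<in> carrier_mat n n \<Longrightarrow> map_mat of_int M \<in> mats_over R n"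
  by (auto simp: mats_over_def unital_subring.of_int_closed)

lemma vecs_over_Ints_obtain:
  assumes "v \<in> vecs_over \<int> n"
  obtains x :: "int vec" where "x \<in> carrier_vec n" "v = map_vec of_int x"
proof -
  have "\<forall>i<n. \<exists>z. v $ i = of_int z" using assms by (auto simp: vecs_over_def elim: Ints_cases)
  then obtain z where "\<And>i. i < n \<Longrightarrow> v $ i = of_int (z i)" by metis
  then show ?thesis
    using assms by (intro that[of "vec n z"]) (auto simp: vecs_over_def)
qed

lemma mats_over_Ints_obtain:
  assumes "M \<in> mats_over \<int> n"
  obtains N :: "int mat" where "N \<in> carrier_mat n n" "M = map_mat of_int N"
proof -
  have "\<forall>i<n. \<forall>j<n. \<exists>z. M $$ (i, j) = of_int z"
    using assms unfolding mats_over_def by (blast elim: Ints_cases)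
  then obtain z where "\<And>i j. i < n \<Longrightarrow> j < n \<Longrightarrow> M $$ (i, j) = of_int (z i j)" by metis
  then show ?thesis
    using assms by (intro that[of "mat n n (\<lambda>(i, j). z i j)"]) (auto simp: mats_over_def)
qed

lemma mult_mat_smult_vec:
  fixes M :: "'a :: comm_ring_1 mat"
  assumes "M \<in> carrier_mat nr nc" "v \<in> carrier_vec nc"
  shows "M *\<^sub>v (c \<cdot>\<^sub>v v) = c \<cdot>\<^sub>v (M *\<^sub>v v)"
  using assms by (intro eq_vecI) (auto simp: scalar_prod_smult_right)

locale vec_submodule = unital_subring R for R :: "'a :: comm_ring_1 set" +
  fixes n :: nat and H :: "'a vec set"
  assumes vec_carrier: "v \<in> H \<Longrightarrow> v \<in> carrier_vec n"
    and vec_zero: "0\<^sub>v n \<in> H"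
    and vec_add: "v \<in> H \<Longrightarrow> w \<in> H \<Longrightarrow> v + w \<in> H"
    and vec_smult: "c \<in> R \<Longrightarrow> v \<in> H \<Longrightarrow> c \<cdot>\<^sub>v v \<in> H"
begin

lemma vec_uminus: "v \<in> H \<Longrightarrow> - v \<in> H"
proof -
  assume v: "v \<in> H"
  have "- v = (- 1) \<cdot>\<^sub>v v" using vec_carrier[OF v] by (intro eq_vecI) auto
  then show ?thesis using vec_smult[OF uminus_closed[OF one_closed] v] by simp
qed

lemma vec_minus:
  assumes "v \<in> H" "w \<in> H"
  shows "v - w \<in> H"
proof -
  have "v - w = v + - w" using assms vec_carrier by (intro minus_add_uminus_vec)
  then show ?thesis using vec_add[OF assms(1) vec_uminus[OF assms(2)]] by simp
qed

lemma vec_combination: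
  assumes "finite J" "\<And>j. j \<in> J \<Longrightarrow> c j \<in> R" "\<And>j. j \<in> J \<Longrightarrow> f j \<in> H"
  shows "vec n (\<lambda>i. \<Sum>j\<in>J. c j * f j $ i) \<in> H"
  using assms
proof (induction J)
  case empty
  have "vec n (\<lambda>i. \<Sum>j\<in>{}. c j * f j $ i) = 0\<^sub>v n" by (intro eq_vecI) auto
  then show ?case using vec_zero by simp
next
  case (insert x J)
  have "f x \<in> carrier_vec n" using insert.prems vec_carrier by auto
  then have "vec n (\<lambda>i. \<Sum>j\<in>insert x J. c j * f j $ i) =
      c x \<cdot>\<^sub>v f x + vec n (\<lambda>i. \<Sum>j\<in>J. c j * f j $ i)"
    using insert.hyps by (intro eq_vecI) auto
  then show ?case using insert by (simp add: vec_add vec_smult)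
qed

lemma vec_mem_if_unit_vecs_mem:
  assumes "v \<in> vecs_over R n" "\<And>j. j < n \<Longrightarrow> v $ j \<noteq> 0 \<Longrightarrow> unit_vec n j \<in> H"
  shows "v \<in> H"
proof -
  let ?J = "{j. j < n \<and> v $ j \<noteq> 0}"
  have "vec n (\<lambda>i. \<Sum>j\<in>?J. v $ j * unit_vec n j $ i) \<in> H"
    using assms by (intro vec_combination) (auto simp: vecs_over_def)
  moreover have "(\<Sum>j\<in>?J. v $ j * unit_vec n j $ i) = v $ i" if "i < n" for i
  proof -
    have "(\<Sum>j\<in>?J. v $ j * unit_vec n j $ i) = (\<Sum>j\<in>?J. if j = i then v $ i else 0)"
      using that by (intro sum.cong) (auto simp: unit_vec_def)
    then show ?thesis using that by simp
  qed
  then have "vec n (\<lambda>i. \<Sum>j\<in>?J. v $ j * unit_vec n j $ i) = v"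
    using assms(1) by (intro eq_vecI) (auto simp: vecs_over_def)
  ultimately show ?thesis by simp
qed

lemma vec_submodule_vimage:
  assumes "T \<in> carrier_mat n n"
  shows "vec_submodule R n {v \<in> carrier_vec n. T *\<^sub>v v \<in> H}"
proof
  have "T *\<^sub>v 0\<^sub>v n = 0\<^sub>v n" using assms by (intro eq_vecI) auto
  then show "0\<^sub>v n \<in> {v \<in> carrier_vec n. T *\<^sub>v v \<in> H}" using vec_zero by simp
qed (use assms in \<open>auto simp: mult_add_distrib_mat_vec[of _ n n] mult_mat_smult_vec
      intro: vec_add vec_smult\<close>)

lemma generate_subset:
  assumes "B \<subseteq> H"
  shows "generate (monoid_vec TYPE('a) n) B \<subseteq> H"
proof -
  interpret G: comm_group "monoid_vec TYPE('a) n" by (rule comm_group_vec)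
  have inv: "inv\<^bsub>monoid_vec TYPE('a) n\<^esub> v = - v" if "v \<in> carrier_vec n" for v
    using that by (intro G.inv_equality) (auto simp: monoid_vec_simps)
  have "subgroup H (monoid_vec TYPE('a) n)"
    using vec_carrier vec_zero vec_add vec_uminus inv
    by (intro G.subgroupI) (auto simp: monoid_vec_simps)
  then show ?thesis using G.generate_subgroup_incl[OF assms] by blast
qed

end

context unital_subring
begin

sublocale vecs_over: vec_submodule R n "vecs_over R n" for n
  by unfold_locales (auto simp: vecs_over_def intro!: zero_closed add_closed mult_closed)

lemma mult_mat_vec_over:
  assumes "M \<in> mats_over R n" "v \<in> vecs_over R n"
  shows "M *\<^sub>v v \<in> vecs_over R n"
  using assms
  by (auto simp: mats_over_def vecs_over_def scalar_prod_def intro!: sum_closed mult_closed)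

end

definition int_mat_act :: "int mat \<Rightarrow> 'a :: comm_ring_1 vec \<Rightarrow> 'a vec" (infixr "*\<^sub>\<int>" 70) where
  "M *\<^sub>\<int> v = map_mat of_int M *\<^sub>v v"

context
  fixes n :: nat
begin

lemma int_mat_act_carrier: "M \<in> carrier_mat n n \<Longrightarrow> M *\<^sub>\<int> v \<in> carrier_vec n"
  unfolding int_mat_act_def by (rule carrier_vecI) auto

lemma int_mat_act_over:
  assumes "unital_subring R" "M \<in> carrier_mat n n" "v \<in> vecs_over R n"
  shows "M *\<^sub>\<int> v \<in> vecs_over R n"
  unfolding int_mat_act_def
  using assms map_mat_of_int_over unital_subring.mult_mat_vec_over by blast

lemma int_mat_act_add:
  "M \<in> carrier_mat n n \<Longrightarrow> v \<in> carrier_vec n \<Longrightarrow> w \<in> carrier_vec n \<Longrightarrow> M *\<^sub>\<int> (v + w) = M *\<^sub>\<int> v + M *\<^sub>\<int> w"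
  unfolding int_mat_act_def by (rule mult_add_distrib_mat_vec[of _ n n]) auto

lemma int_mat_act_minus:
  "M \<in> carrier_mat n n \<Longrightarrow> v \<in> carrier_vec n \<Longrightarrow> w \<in> carrier_vec n \<Longrightarrow> M *\<^sub>\<int> (v - w) = M *\<^sub>\<int> v - M *\<^sub>\<int> w"
  unfolding int_mat_act_def by (rule mult_minus_distrib_mat_vec[of _ n n]) auto

lemma int_mat_act_smult:
  "M \<in> carrier_mat n n \<Longrightarrow> v \<in> carrier_vec n \<Longrightarrow> M *\<^sub>\<int> (c \<cdot>\<^sub>v v) = c \<cdot>\<^sub>v (M *\<^sub>\<int> v)"
  unfolding int_mat_act_def by (rule mult_mat_smult_vec[of _ n n]) auto

lemma int_mat_act_zero: "M \<in> carrier_mat n n \<Longrightarrow> M *\<^sub>\<int> 0\<^sub>v n = 0\<^sub>v n"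
  unfolding int_mat_act_def by (intro eq_vecI) auto

lemma one_int_mat_act: "v \<in> carrier_vec n \<Longrightarrow> 1\<^sub>m n *\<^sub>\<int> v = v"
  by (simp add: int_mat_act_def of_int_hom.mat_hom_one)

lemma mult_int_mat_act:
  "M \<in> carrier_mat n n \<Longrightarrow> N \<in> carrier_mat n n \<Longrightarrow> v \<in> carrier_vec n \<Longrightarrow> (M * N) *\<^sub>\<int> v = M *\<^sub>\<int> N *\<^sub>\<int> v"
  unfolding int_mat_act_def by (simp add: of_int_hom.mat_hom_mult assoc_mult_mat_vec[of _ n n _ n])

lemma add_smult_int_mat_act:
  assumes "M \<in> carrier_mat n n" "N \<in> carrier_mat n n" "v \<in> carrier_vec n"
  shows "(M + q \<cdot>\<^sub>m N) *\<^sub>\<int> v = M *\<^sub>\<int> v + of_int q \<cdot>\<^sub>v (N *\<^sub>\<int> v)"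
  using assms unfolding int_mat_act_def
  by (intro eq_vecI) (auto simp: scalar_prod_def sum_distrib_left sum.distrib algebra_simps)

lemma smult_one_int_mat_act: "v \<in> carrier_vec n \<Longrightarrow> (q \<cdot>\<^sub>m 1\<^sub>m n) *\<^sub>\<int> v = of_int q \<cdot>\<^sub>v v"
  unfolding int_mat_act_def
  by (intro eq_vecI) (auto simp: scalar_prod_def if_distrib if_distribR cong: if_cong)

lemma of_rat_int_mat_act:
  "M \<in> carrier_mat n n \<Longrightarrow> v \<in> carrier_vec n \<Longrightarrow>
    map_vec (of_rat :: rat \<Rightarrow> 'a :: field_char_0) (M *\<^sub>\<int> v) = M *\<^sub>\<int> map_vec of_rat v"
  unfolding int_mat_act_def
  by (subst of_rat_hom.mult_mat_vec_hom[of _ n n]) (auto intro!: arg_cong2[of _ _ _ _ "(*\<^sub>v)"] eq_matI)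

end

lemma pow_mat_add:
  fixes A :: "'a :: semiring_1 mat"
  assumes "A \<in> carrier_mat n n"
  shows "A ^\<^sub>m (k + m) = A ^\<^sub>m k * A ^\<^sub>m m"
proof -
  interpret semiring "ring_mat TYPE('a) n ()" by (rule semiring_mat)
  show ?thesis
    using assms nat_pow_mult[of A k m]
    by (simp add: pow_mat_ring_pow[OF assms, where b = "()"] ring_mat_simps)
qed

context
  fixes A :: "int mat" and n :: nat
  assumes A: "A \<in> carrier_mat n n"
begin

lemma pow_mat_act_add: "v \<in> carrier_vec n \<Longrightarrow> A ^\<^sub>m (k + m) *\<^sub>\<int> v = A ^\<^sub>m k *\<^sub>\<int> A ^\<^sub>m m *\<^sub>\<int> v"
  using A by (simp add: pow_mat_add[OF A] mult_int_mat_act[of _ n])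

lemma pow_mat_act_zero: "v \<in> carrier_vec n \<Longrightarrow> A ^\<^sub>m 0 *\<^sub>\<int> v = v"
  using A by (simp add: one_int_mat_act)

lemma pow_mat_act_Suc: "v \<in> carrier_vec n \<Longrightarrow> A ^\<^sub>m Suc k *\<^sub>\<int> v = A *\<^sub>\<int> A ^\<^sub>m k *\<^sub>\<int> v"
  using A pow_mat_act_add[of v 1 k] by simp

lemma pow_mat_act_Suc2: "v \<in> carrier_vec n \<Longrightarrow> A ^\<^sub>m Suc k *\<^sub>\<int> v = A ^\<^sub>m k *\<^sub>\<int> A *\<^sub>\<int> v"
  using A pow_mat_act_add[of v k 1] by simp

end

section \<open>$p$-integral rationals\<close>

definition integers_at :: "int \<Rightarrow> rat set" where
  "integers_at p = localization \<int> {of_int b | b. \<not> p dvd b}"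

lemma unital_subring_integers_at:
  assumes "prime p"
  shows "unital_subring (integers_at p)"
  unfolding integers_at_def
proof (intro unital_subring_localization unital_subring_Ints)
  have "\<not> p dvd 1" using assms not_prime_unit by blast
  then show "(1 :: rat) \<in> {of_int b | b. \<not> p dvd b}" by (intro CollectI exI[of _ 1]) simp
  fix b d :: rat assume "b \<in> {of_int b | b. \<not> p dvd b}" "d \<in> {of_int b | b. \<not> p dvd b}"
  then obtain x y where "b = of_int x" "d = of_int y" "\<not> p dvd x" "\<not> p dvd y" by blast
  then have "b * d = of_int (x * y)" "\<not> p dvd x * y"
    using assms by (simp_all add: prime_dvd_mult_iff)
  then show "b * d \<in> {of_int b | b. \<not> p dvd b}" by blast
qed auto

lemma integers_atI: "\<not> p dvd b \<Longrightarrow> of_int a / of_int b \<in> integers_at p"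
  unfolding integers_at_def localization_def
  by (rule CollectI, rule exI[of _ "of_int a"], rule exI[of _ "of_int b"]) auto

lemma integers_atE:
  assumes "r \<in> integers_at p"
  obtains a b where "\<not> p dvd b" "b \<noteq> 0" "r = of_int a / of_int b"
proof -
  obtain a b where "\<not> p dvd b" "r = of_int a / of_int b"
    using assms unfolding integers_at_def localization_def by (auto elim!: Ints_cases)
  then show ?thesis by (intro that[of b a]) auto
qed

lemma Ints_subset_integers_at: "prime p \<Longrightarrow> \<int> \<subseteq> integers_at p"
  using unital_subring.of_int_closed[OF unital_subring_integers_at] by (auto elim: Ints_cases)

lemma integers_at_if_multiple_Ints:
  assumes "\<not> p dvd d" "of_int d * r \<in> \<int>"
  shows "r \<in> integers_at p"
proof -
  obtain a where "of_int d * r = of_int a" using assms(2) by (auto elim: Ints_cases)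
  moreover have "d \<noteq> 0" using assms(1) by auto
  ultimately have "r = of_int a / of_int d" by (simp add: field_simps)
  then show ?thesis using integers_atI[OF assms(1)] by simp
qed

lemma integers_at_iff_denominator:
  assumes "prime p" "quotient_of r = (a, b)"
  shows "r \<in> integers_at p \<longleftrightarrow> \<not> p dvd b"
proof
  have r: "r = of_int a / of_int b" and b: "b > 0"
    using quotient_of_div[OF assms(2)] quotient_of_denom_pos[OF assms(2)] by auto
  assume "r \<in> integers_at p"
  then obtain c d where cd: "\<not> p dvd d" "d \<noteq> 0" "r = of_int c / of_int d" by (rule integers_atE)
  have "(of_int (a * d) :: rat) = of_int (c * b)" using r cd(2,3) b by (simp add: field_simps)
  then have "a * d = c * b" by (simp only: of_int_eq_iff)
  show "\<not> p dvd b"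
  proof
    assume "p dvd b"
    then have "p dvd a" using \<open>a * d = c * b\<close> cd(1) assms(1) by (metis dvd_mult prime_dvd_mult_iff)
    then have "p dvd 1" using \<open>p dvd b\<close> quotient_of_coprime[OF assms(2)] by (meson coprime_common_divisor)
    then show False using assms(1) not_prime_unit by blast
  qed
next
  show "r \<in> integers_at p" if "\<not> p dvd b"
    using integers_atI[OF that] quotient_of_div[OF assms(2)] by simp
qed

lemma of_int_divide_mem_integers_at_iff:
  assumes "prime p" "d \<noteq> 0"
  shows "of_int c / of_int d \<in> integers_at p \<longleftrightarrow> p ^ multiplicity p d dvd c"
proof -
  let ?e = "multiplicity p d"
  have p: "p > 1" using assms(1) by (rule prime_gt_1_int)
  obtain d' where d': "d = p ^ ?e * d'" "\<not> p dvd d'"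
    using prime_multiplicity_decompose[OF assms] .
  show ?thesis
  proof
    assume "p ^ ?e dvd c"
    then obtain c' where "c = p ^ ?e * c'" by auto
    then have "(of_int c / of_int d :: rat) = of_int c' / of_int d'" using p by (subst d'(1)) simp
    then show "(of_int c / of_int d :: rat) \<in> integers_at p" using integers_atI[OF d'(2)] by simp
  next
    assume "(of_int c / of_int d :: rat) \<in> integers_at p"
    then obtain a b where ab: "\<not> p dvd b" "b \<noteq> 0" "of_int c / of_int d = (of_int a / of_int b :: rat)"
      by (rule integers_atE)
    then have "(of_int (c * b) :: rat) = of_int (a * d)" using assms(2) by (simp add: field_simps)
    then have "c * b = a * d" by (simp only: of_int_eq_iff)
    then have "p ^ ?e dvd c * b" by (simp add: multiplicity_dvd)
    moreover have "Rings.coprime (p ^ ?e) b" using assms(1) ab(1) by (simp add: prime_imp_coprime)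
    ultimately show "p ^ ?e dvd c" by (simp add: coprime_dvd_mult_left_iff)
  qed
qed

lemma eventually_power_mult_mem_integers_at:
  assumes "prime p"
  shows "\<forall>\<^sub>F k in sequentially. of_int p ^ k * r \<in> integers_at p"
proof -
  obtain a b where ab: "quotient_of r = (a, b)" by force
  have r: "r = of_int a / of_int b" and b: "b > 0"
    using quotient_of_div[OF ab] quotient_of_denom_pos[OF ab] by auto
  have "of_int p ^ k * r \<in> integers_at p" if "k \<ge> multiplicity p b" for k
  proof -
    have "of_int p ^ k * r = of_int (p ^ k * a) / of_int b" by (simp add: r)
    moreover have "p ^ multiplicity p b dvd p ^ k * a" using that by (simp add: le_imp_power_dvd)
    ultimately show ?thesis using of_int_divide_mem_integers_at_iff[OF assms, of b "p ^ k * a"] b by simp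
  qed
  then show ?thesis by (rule eventually_sequentiallyI)
qed

lemma Ints_if_mem_integers_at:
  assumes "\<And>p. prime p \<Longrightarrow> r \<in> integers_at p"
  shows "r \<in> \<int>"
proof -
  obtain a b where ab: "quotient_of r = (a, b)" by force
  have "\<not> p dvd b" if "prime p" for p
    using integers_at_iff_denominator[OF that ab] assms[OF that] by blast
  then have "is_unit b" using prime_divisor_exists[of b] quotient_of_denom_pos[OF ab] by auto
  then have "b = 1" using quotient_of_denom_pos[OF ab] by (simp add: zdvd1_eq)
  then show ?thesis using quotient_of_div[OF ab] by simp
qed

lemma rat_common_denominator:
  fixes S :: "rat set"
  assumes "finite S"
  obtains d :: int where "d > 0" "\<And>r. r \<in> S \<Longrightarrow> of_int d * r \<in> \<int>"
  using assms
proof (induction S arbitrary: thesis)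
  case empty
  show ?case by (rule empty[of 1]) auto
next
  case (insert x S)
  obtain d where d: "d > 0" "\<And>r. r \<in> S \<Longrightarrow> of_int d * r \<in> \<int>" using insert.IH by blast
  obtain a b where ab: "quotient_of x = (a, b)" by force
  have b: "b > 0" using quotient_of_denom_pos[OF ab] .
  show ?case
  proof (rule insert.prems)
    show "b * d > 0" using b d(1) by simp
    fix r assume "r \<in> insert x S"
    then show "of_int (b * d) * r \<in> \<int>"
    proof
      assume "r = x"
      then have "of_int (b * d) * r = of_int (a * d)"
        using quotient_of_div[OF ab] b by (simp add: field_simps)
      then show ?thesis by (metis Ints_of_int)
    next
      assume "r \<in> S"
      then show ?thesis using Ints_mult[OF Ints_of_int d(2), of r b] by (simp add: mult.assoc)
    qed
  qed
qed

section \<open>Integrality of $p$-adic linear forms\<close>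

lemma padic_of_rat_divide:
  assumes "prime p" "d \<noteq> 0"
  shows "padic_of_rat p (of_int c / of_int d) =
    frac_class (padic_int p) (padic_of_int p c) (padic_of_int p d)"
proof -
  have p: "p > 1" using assms(1) by (rule prime_gt_1_int)
  interpret domain "padic_int p" using assms(1) by (rule domain_padic_int)
  obtain x y where xy: "quotient_of (of_int c / of_int d) = (x, y)" by force
  have y: "y > 0" using quotient_of_denom_pos[OF xy] .
  have "of_int c / of_int d = (of_int x / of_int y :: rat)" using quotient_of_div[OF xy] .
  then have "(of_int (x * d) :: rat) = of_int (c * y)"
    using y assms(2) by (simp add: field_simps)
  then have "x * d = c * y" by (simp only: of_int_eq_iff)
  then show ?thesis
    using p y assms(2) unfolding padic_of_rat_def xy
    by (simp add: frac_class_eq_iff padic_of_int_closed padic_of_int_eq_zero_iff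
        flip: padic_of_int_mult)
qed

lemma frac_class_mem_range_padic_emb_iff:
  assumes "prime p" "d \<noteq> 0" "y \<in> carrier (padic_int p)"
  shows "frac_class (padic_int p) y (padic_of_int p d) \<in> padic_emb p ` carrier (padic_int p) \<longleftrightarrow>
    y (multiplicity p d) = 0"
proof -
  have p: "p > 1" using assms(1) by (rule prime_gt_1_int)
  interpret domain "padic_int p" using assms(1) by (rule domain_padic_int)
  have "padic_of_int p d \<in> nonzero"
    using p assms(2) by (simp add: padic_of_int_closed padic_of_int_eq_zero_iff)
  then have "frac_class (padic_int p) y (padic_of_int p d) \<in> padic_emb p ` carrier (padic_int p) \<longleftrightarrow>
      (\<exists>z\<in>carrier (padic_int p). y = padic_of_int p d \<otimes>\<^bsub>padic_int p\<^esub> z)"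
    using assms(3) by (auto simp: padic_emb_def frac_class_eq_iff image_iff m_comm)
  also have "\<dots> \<longleftrightarrow> y (multiplicity p d) = 0" using assms by (rule padic_int_dvd_iff)
  finally show ?thesis .
qed

definition padic_int_form :: "int \<Rightarrow> int \<Rightarrow> ('i \<Rightarrow> int) \<Rightarrow> ('i \<Rightarrow> nat \<Rightarrow> int) \<Rightarrow> 'i set \<Rightarrow> nat \<Rightarrow> int" where
  "padic_int_form p c m a I = padic_of_int p c \<ominus>\<^bsub>padic_int p\<^esub>
    (\<Oplus>\<^bsub>padic_int p\<^esub>i\<in>I. padic_of_int p (m i) \<otimes>\<^bsub>padic_int p\<^esub> a i)"

context
  fixes p :: int and a :: "'i \<Rightarrow> nat \<Rightarrow> int" and I :: "'i set"
  assumes p: "prime p" and I: "finite I" and a: "\<And>i. i \<in> I \<Longrightarrow> a i \<in> carrier (padic_int p)"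
begin

interpretation domain "padic_int p"
  using p by (rule domain_padic_int)

lemma padic_of_int_mem: "padic_of_int p z \<in> carrier (padic_int p)"
  using prime_gt_0_int[OF p] by (rule padic_of_int_closed)

lemma padic_int_form_closed: "padic_int_form p c m a I \<in> carrier (padic_int p)"
  unfolding padic_int_form_def using a padic_of_int_mem by (intro minus_closed finsum_closed) auto

lemma padic_int_form_nth:
  "padic_int_form p c m a I M = (c - (\<Sum>i\<in>I. m i * a i M)) mod p ^ M"
proof -
  have "(\<Oplus>\<^bsub>padic_int p\<^esub>i\<in>I. padic_of_int p (m i) \<otimes>\<^bsub>padic_int p\<^esub> a i) M =
      (\<Sum>i\<in>I. m i * a i M mod p ^ M) mod p ^ M"
    using prime_gt_0_int[OF p] I a padic_of_int_mem
    by (subst padic_int_finsum_nth) (auto simp: padic_int_simps padic_of_int_def mod_mult_left_eq)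
  also have "\<dots> = (\<Sum>i\<in>I. m i * a i M) mod p ^ M" by (rule mod_sum_eq)
  finally show ?thesis
    unfolding padic_int_form_def using prime_gt_0_int[OF p] a padic_of_int_mem
    by (subst padic_int_minus_nth) (auto simp: padic_of_int_def mod_diff_eq intro!: finsum_closed)
qed

lemma padic_field_form_eq_frac_class:
  assumes "d \<noteq> 0" "\<And>i. i \<in> I \<Longrightarrow> r i = of_int (m i) / of_int d"
  shows "padic_of_rat p (of_int c / of_int d) \<ominus>\<^bsub>padic_field p\<^esub>
      (\<Oplus>\<^bsub>padic_field p\<^esub>i\<in>I. padic_of_rat p (r i) \<otimes>\<^bsub>padic_field p\<^esub> padic_emb p (a i)) =
    frac_class (padic_int p) (padic_int_form p c m a I) (padic_of_int p d)"
proof -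
  interpret K: abelian_group K by (rule abelian_group_fraction_field)
  let ?D = "padic_of_int p d" and ?f = "\<lambda>i. padic_of_int p (m i) \<otimes>\<^bsub>padic_int p\<^esub> a i"
  have D: "?D \<in> nonzero"
    using prime_gt_1_int[OF p] assms(1) by (simp add: padic_of_int_mem padic_of_int_eq_zero_iff)
  have f: "?f i \<in> carrier (padic_int p)" if "i \<in> I" for i using a[OF that] padic_of_int_mem by simp
  have "padic_of_rat p (r i) \<otimes>\<^bsub>K\<^esub> padic_emb p (a i) = frac_class (padic_int p) (?f i) ?D"
    if "i \<in> I" for i
    using a[OF that] D padic_of_int_mem p assms(1)
    by (simp add: assms(2)[OF that] padic_of_rat_divide padic_emb_def frac_class_mult)
  then have "(\<Oplus>\<^bsub>K\<^esub>i\<in>I. padic_of_rat p (r i) \<otimes>\<^bsub>K\<^esub> padic_emb p (a i)) =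
      (\<Oplus>\<^bsub>K\<^esub>i\<in>I. frac_class (padic_int p) (?f i) ?D)"
    using f D by (intro K.finsum_cong') (auto intro!: frac_class_closed)
  also have "\<dots> = frac_class (padic_int p) (\<Oplus>\<^bsub>padic_int p\<^esub>i\<in>I. ?f i) ?D"
    using I f D by (rule frac_class_finsum_same_denom)
  finally show ?thesis
    unfolding padic_field_def padic_int_form_def padic_of_rat_divide[OF p assms(1)]
    using D f padic_of_int_mem by (simp add: frac_class_minus_same_denom finsum_closed Pi_def)
qed

lemma eventually_form_mem_integers_at_iff:
  assumes "d \<noteq> 0"
  shows "(\<forall>\<^sub>F M in sequentially. of_int (c - (\<Sum>i\<in>I. m i * a i M)) / of_int d \<in> integers_at p) \<longleftrightarrow>
    padic_int_form p c m a I (multiplicity p d) = 0"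
proof -
  let ?y = "padic_int_form p c m a I" and ?e = "multiplicity p d"
  have "of_int (c - (\<Sum>i\<in>I. m i * a i M)) / of_int d \<in> integers_at p \<longleftrightarrow> ?y ?e = 0" if "M \<ge> ?e" for M
  proof -
    have "?y ?e = (c - (\<Sum>i\<in>I. m i * a i M)) mod p ^ ?e"
      using padic_int_mod[OF padic_int_form_closed that, of c m]
        mod_mod_cancel[OF le_imp_power_dvd[OF that, of p]]
      by (simp add: padic_int_form_nth)
    then show ?thesis
      using of_int_divide_mem_integers_at_iff[OF p assms, of "c - (\<Sum>i\<in>I. m i * a i M)"]
      by (simp only: dvd_eq_mod_eq_0)
  qed
  then have "\<forall>\<^sub>F M in sequentially.
      of_int (c - (\<Sum>i\<in>I. m i * a i M)) / of_int d \<in> integers_at p \<longleftrightarrow> ?y ?e = 0"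
    by (rule eventually_sequentiallyI)
  then have "(\<forall>\<^sub>F M in sequentially. of_int (c - (\<Sum>i\<in>I. m i * a i M)) / of_int d \<in> integers_at p) \<longleftrightarrow>
      (\<forall>\<^sub>F M in sequentially. ?y ?e = 0)"
    by (rule eventually_subst)
  then show ?thesis by simp
qed

lemma padic_form_integral_iff:
  "padic_of_rat p c \<ominus>\<^bsub>padic_field p\<^esub>
      (\<Oplus>\<^bsub>padic_field p\<^esub>i\<in>I. padic_of_rat p (r i) \<otimes>\<^bsub>padic_field p\<^esub> padic_emb p (a i))
      \<in> padic_emb p ` carrier (padic_int p) \<longleftrightarrow>
    (\<forall>\<^sub>F M in sequentially. c - (\<Sum>i\<in>I. r i * of_int (a i M)) \<in> integers_at p)"
proof -
  obtain d :: int where d: "d > 0" "\<And>x. x \<in> insert c (r ` I) \<Longrightarrow> of_int d * x \<in> \<int>"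
    using rat_common_denominator[of "insert c (r ` I)"] I by auto
  have frac: "\<exists>z. x = of_int z / of_int d" if dx: "of_int d * x \<in> \<int>" for x :: rat
  proof -
    obtain z where "of_int d * x = of_int z" using dx by (auto elim: Ints_cases)
    then have "x = of_int z / of_int d" using d(1) by (simp add: eq_divide_eq mult.commute)
    then show ?thesis ..
  qed
  obtain C where C: "c = of_int C / of_int d" using frac d(2) by blast
  have "\<forall>i\<in>I. \<exists>z. r i = of_int z / of_int d" using frac d(2) by blast
  then obtain m where m: "\<And>i. i \<in> I \<Longrightarrow> r i = of_int (m i) / of_int d" by metis
  have "padic_of_rat p c \<ominus>\<^bsub>padic_field p\<^esub>
      (\<Oplus>\<^bsub>padic_field p\<^esub>i\<in>I. padic_of_rat p (r i) \<otimes>\<^bsub>padic_field p\<^esub> padic_emb p (a i)) =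
      frac_class (padic_int p) (padic_int_form p C m a I) (padic_of_int p d)"
    unfolding C using d(1) m by (intro padic_field_form_eq_frac_class) auto
  moreover have "c - (\<Sum>i\<in>I. r i * of_int (a i M)) = of_int (C - (\<Sum>i\<in>I. m i * a i M)) / of_int d" for M
    by (simp add: C m diff_divide_distrib sum_divide_distrib)
  ultimately show ?thesis
    using d(1) frac_class_mem_range_padic_emb_iff[OF p _ padic_int_form_closed, of d C m]
      eventually_form_mem_integers_at_iff[of d C m] by simp
qed

end

section \<open>The group $G_A$ and its localizations\<close>

definition power_preimage :: "'a :: comm_ring_1 set \<Rightarrow> int mat \<Rightarrow> 'a vec set" where
  "power_preimage R A =
    {v \<in> carrier_vec (dim_row A). \<exists>k. A ^\<^sub>m k *\<^sub>\<int> v \<in> vecs_over R (dim_row A)}"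

lemma mult_pow_mat_eq_one:
  fixes M :: "'a :: semiring_1 mat"
  assumes M: "M \<in> carrier_mat n n" and N: "N \<in> carrier_mat n n" and MN: "M * N = 1\<^sub>m n"
  shows "M ^\<^sub>m k * N ^\<^sub>m k = 1\<^sub>m n"
proof (induction k)
  case 0
  show ?case using M N by simp
next
  case (Suc k)
  have N': "N ^\<^sub>m k \<in> carrier_mat n n" and M': "M ^\<^sub>m k \<in> carrier_mat n n" using M N by auto
  have "N ^\<^sub>m Suc k = N * N ^\<^sub>m k" using pow_mat_add[OF N, of 1 k] N by simp
  then have "M ^\<^sub>m Suc k * N ^\<^sub>m Suc k = M ^\<^sub>m k * (M * (N * N ^\<^sub>m k))"
    using assoc_mult_mat[OF M' M, of "N * N ^\<^sub>m k" n] N N' by simp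
  also have "M * (N * N ^\<^sub>m k) = (M * N) * N ^\<^sub>m k"
    using assoc_mult_mat[OF M N N'] by simp
  finally show ?case unfolding MN left_mult_one_mat[OF N'] Suc .
qed

lemma det_pow_mat:
  fixes A :: "'a :: comm_ring_1 mat"
  assumes "A \<in> carrier_mat n n"
  shows "det (A ^\<^sub>m k) = det A ^ k"
proof (induction k)
  case (Suc k)
  then show ?case using det_mult[OF pow_carrier_mat[OF assms, of k] assms] by (simp add: mult.commute)
qed (use assms in simp)

context
  fixes A :: "int mat" and n :: nat
  assumes A: "A \<in> carrier_mat n n"
begin

lemma power_preimage_iff:
  "v \<in> power_preimage R A \<longleftrightarrow> v \<in> carrier_vec n \<and> (\<exists>k. A ^\<^sub>m k *\<^sub>\<int> v \<in> vecs_over R n)"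
  using A by (simp add: power_preimage_def)

lemma power_preimage_carrier: "v \<in> power_preimage R A \<Longrightarrow> v \<in> carrier_vec n"
  by (simp add: power_preimage_iff)

lemma vecs_over_subset_power_preimage: "vecs_over R n \<subseteq> power_preimage R A"
proof
  fix v assume "v \<in> vecs_over R n"
  then have "v \<in> carrier_vec n" "A ^\<^sub>m 0 *\<^sub>\<int> v \<in> vecs_over R n"
    using pow_mat_act_zero[OF A vecs_over_carrier] vecs_over_carrier by fastforce+
  then show "v \<in> power_preimage R A" unfolding power_preimage_iff by blast
qed

lemma power_preimage_mono: "R \<subseteq> S \<Longrightarrow> power_preimage R A \<subseteq> power_preimage S A"
  using vecs_over_mono unfolding subset_iff power_preimage_iff by blast

lemma power_preimage_eventually:
  assumes "unital_subring R" "v \<in> power_preimage R A"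
  shows "\<forall>\<^sub>F m in sequentially. A ^\<^sub>m m *\<^sub>\<int> v \<in> vecs_over R n"
proof -
  obtain k where v: "v \<in> carrier_vec n" and k: "A ^\<^sub>m k *\<^sub>\<int> v \<in> vecs_over R n"
    using assms(2) power_preimage_iff by blast
  have "A ^\<^sub>m m *\<^sub>\<int> v \<in> vecs_over R n" if "m \<ge> k" for m
    using int_mat_act_over[OF assms(1) pow_carrier_mat[OF A] k, of "m - k"]
      pow_mat_act_add[OF A v, of "m - k" k] that by simp
  then show ?thesis by (rule eventually_sequentiallyI)
qed

lemma vec_submodule_power_preimage:
  assumes "unital_subring R"
  shows "vec_submodule R n (power_preimage R A)"
proof -
  interpret unital_subring R by (rule assms)
  show ?thesis
  proof
    fix v w assume v: "v \<in> power_preimage R A" and w: "w \<in> power_preimage R A"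
    have "\<forall>\<^sub>F m in sequentially. A ^\<^sub>m m *\<^sub>\<int> (v + w) \<in> vecs_over R n"
      using power_preimage_eventually[OF assms v] power_preimage_eventually[OF assms w]
    proof eventually_elim
      case (elim m)
      then show ?case
        using power_preimage_carrier[OF v] power_preimage_carrier[OF w]
        by (simp add: int_mat_act_add[OF pow_carrier_mat[OF A]] vecs_over.vec_add)
    qed
    then have "\<exists>m. A ^\<^sub>m m *\<^sub>\<int> (v + w) \<in> vecs_over R n"
      using eventually_happens' sequentially_bot by blast
    then show "v + w \<in> power_preimage R A"
      using v w power_preimage_carrier unfolding power_preimage_iff by simp
  next
    fix c v assume c: "c \<in> R" and v: "v \<in> power_preimage R A"
    then obtain k where "A ^\<^sub>m k *\<^sub>\<int> v \<in> vecs_over R n" by (auto simp: power_preimage_iff)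
    then have "A ^\<^sub>m k *\<^sub>\<int> (c \<cdot>\<^sub>v v) \<in> vecs_over R n"
      using int_mat_act_smult[OF pow_carrier_mat[OF A] power_preimage_carrier[OF v]] c
      by (simp add: vecs_over.vec_smult)
    then show "c \<cdot>\<^sub>v v \<in> power_preimage R A"
      using power_preimage_carrier[OF v] by (auto simp: power_preimage_iff)
  next
    show "0\<^sub>v n \<in> power_preimage R A" using vecs_over_subset_power_preimage vecs_over.vec_zero by blast
  qed (rule power_preimage_carrier)
qed

lemma rat_inverse_exists:
  assumes "det A \<noteq> 0"
  obtains B where "mat_inverse (map_mat rat_of_int A) = Some B" "B \<in> carrier_mat n n"
    "\<And>k. map_mat rat_of_int (A ^\<^sub>m k) * B ^\<^sub>m k = 1\<^sub>m n"
    "\<And>k. B ^\<^sub>m k * map_mat rat_of_int (A ^\<^sub>m k) = 1\<^sub>m n"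
proof -
  let ?A = "map_mat rat_of_int A"
  have A': "?A \<in> carrier_mat n n" using A by simp
  have "det ?A \<noteq> 0" using assms by (simp add: of_int_hom.hom_det)
  then obtain B where B: "mat_inverse ?A = Some B"
    using mat_inverse(1)[OF A'] det_non_zero_imp_unit[OF A', where b = "()"] by fastforce
  have inv: "?A * B = 1\<^sub>m n" "B * ?A = 1\<^sub>m n" "B \<in> carrier_mat n n"
    using mat_inverse(2)[OF A' B] by auto
  show ?thesis
    using that[OF B inv(3)] mult_pow_mat_eq_one[OF A' inv(3,1)] mult_pow_mat_eq_one[OF inv(3) A' inv(2)]
    by (simp add: of_int_hom.mat_hom_pow[OF A])
qed

lemma mat_zpow_int_act: "mat_zpow (map_mat rat_of_int A) (int k) *\<^sub>v v = A ^\<^sub>m k *\<^sub>\<int> v"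
  by (simp add: mat_zpow_def int_mat_act_def of_int_hom.mat_hom_pow[OF A])

lemma mat_zpow_minus_int_act:
  assumes "det A \<noteq> 0" "v \<in> carrier_vec n"
  shows "mat_zpow (map_mat rat_of_int A) (- int k) *\<^sub>v v \<in> carrier_vec n"
    and "A ^\<^sub>m k *\<^sub>\<int> (mat_zpow (map_mat rat_of_int A) (- int k) *\<^sub>v v) = v"
    and "mat_zpow (map_mat rat_of_int A) (- int k) *\<^sub>v (A ^\<^sub>m k *\<^sub>\<int> v) = v"
proof -
  obtain B where B: "mat_inverse (map_mat rat_of_int A) = Some B" "B \<in> carrier_mat n n"
    "\<And>k. map_mat rat_of_int (A ^\<^sub>m k) * B ^\<^sub>m k = 1\<^sub>m n"
    "\<And>k. B ^\<^sub>m k * map_mat rat_of_int (A ^\<^sub>m k) = 1\<^sub>m n"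
    using rat_inverse_exists[OF assms(1)] by blast
  have zpow: "mat_zpow (map_mat rat_of_int A) (- int k) = B ^\<^sub>m k"
    using A B(1,2) by (cases "k = 0") (auto simp: mat_zpow_def)
  have pow: "map_mat rat_of_int (A ^\<^sub>m k) \<in> carrier_mat n n" "B ^\<^sub>m k \<in> carrier_mat n n"
    using A B(2) by simp_all
  show "mat_zpow (map_mat rat_of_int A) (- int k) *\<^sub>v v \<in> carrier_vec n"
    unfolding zpow using pow(2) assms(2) by (rule mult_mat_vec_carrier)
  show "A ^\<^sub>m k *\<^sub>\<int> (mat_zpow (map_mat rat_of_int A) (- int k) *\<^sub>v v) = v"
    "mat_zpow (map_mat rat_of_int A) (- int k) *\<^sub>v (A ^\<^sub>m k *\<^sub>\<int> v) = v"
    unfolding zpow int_mat_act_def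
    using assoc_mult_mat_vec[OF pow assms(2)] assoc_mult_mat_vec[OF pow(2,1) assms(2)] assms(2)
    by (simp_all only: B(3,4) one_mult_mat_vec)
qed

lemma group_of_mat_eq_power_preimage:
  assumes "det A \<noteq> 0"
  shows "group_of_mat A = power_preimage \<int> A"
proof (intro equalityI subsetI)
  fix v assume "v \<in> group_of_mat A"
  then obtain x z where x: "x \<in> carrier_vec n"
    and v: "v = mat_zpow (map_mat rat_of_int A) z *\<^sub>v map_vec rat_of_int x"
    using A by (auto simp: group_of_mat_def)
  have x_carrier: "map_vec rat_of_int x \<in> carrier_vec n" using x by simp
  have x_over: "map_vec rat_of_int x \<in> vecs_over \<int> n"
    using unital_subring_Ints x by (rule map_vec_of_int_over)
  consider (nonneg) k where "z = int k" | (neg) k where "z = - int k" by (cases z rule: int_cases2)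
  then show "v \<in> power_preimage \<int> A"
  proof cases
    case nonneg
    then have "v = A ^\<^sub>m k *\<^sub>\<int> map_vec rat_of_int x" unfolding v by (simp only: mat_zpow_int_act)
    then have "v \<in> vecs_over \<int> n"
      using int_mat_act_over[OF unital_subring_Ints pow_carrier_mat[OF A] x_over] by simp
    then show ?thesis using vecs_over_subset_power_preimage by blast
  next
    case neg
    then have "v \<in> carrier_vec n" "A ^\<^sub>m k *\<^sub>\<int> v = map_vec rat_of_int x"
      unfolding v using mat_zpow_minus_int_act[OF assms x_carrier] by simp_all
    then show ?thesis using x_over unfolding power_preimage_iff by metis
  qed
next
  fix v :: "rat vec" assume "v \<in> power_preimage \<int> A"
  then obtain k where v: "v \<in> carrier_vec n" and k: "A ^\<^sub>m k *\<^sub>\<int> v \<in> vecs_over \<int> n"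
    by (auto simp: power_preimage_iff)
  obtain x where x: "x \<in> carrier_vec n" "A ^\<^sub>m k *\<^sub>\<int> v = map_vec rat_of_int x"
    using vecs_over_Ints_obtain[OF k] .
  then have "v = mat_zpow (map_mat rat_of_int A) (- int k) *\<^sub>v map_vec rat_of_int x"
    using mat_zpow_minus_int_act(3)[OF assms v, of k] by simp
  then show "v \<in> group_of_mat A" using x(1) A unfolding group_of_mat_def by blast
qed

lemma power_preimage_Ints_local:
  assumes v: "v \<in> carrier_vec n" and local: "\<And>p. prime p \<Longrightarrow> v \<in> power_preimage (integers_at p) A"
  shows "v \<in> power_preimage \<int> A"
proof -
  obtain d :: int where d: "d > 0" "\<And>r. r \<in> (\<lambda>i. v $ i) ` {..<n} \<Longrightarrow> of_int d * r \<in> \<int>"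
    using rat_common_denominator[of "(\<lambda>i. v $ i) ` {..<n}"] by auto
  let ?S = "{p. prime p \<and> p dvd d}"
  have "?S \<subseteq> {0..d}" using d(1) zdvd_imp_le by (auto dest: prime_ge_0_int)
  then have "finite ?S" by (rule finite_subset) simp
  then have "\<forall>\<^sub>F k in sequentially. \<forall>p\<in>?S. A ^\<^sub>m k *\<^sub>\<int> v \<in> vecs_over (integers_at p) n"
    using local unital_subring_integers_at
    by (intro eventually_ball_finite) (auto intro: power_preimage_eventually)
  then obtain k where k: "\<forall>p\<in>?S. A ^\<^sub>m k *\<^sub>\<int> v \<in> vecs_over (integers_at p) n"
    using eventually_happens' sequentially_bot by blast
  have "A ^\<^sub>m k *\<^sub>\<int> v \<in> vecs_over (integers_at p) n" if p: "prime p" for p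
  proof (cases "p dvd d")
    case True
    then show ?thesis using k p by blast
  next
    case False
    then have "v \<in> vecs_over (integers_at p) n"
      using d(2) v by (auto simp: vecs_over_def intro!: integers_at_if_multiple_Ints)
    then show ?thesis by (rule int_mat_act_over[OF unital_subring_integers_at[OF p] pow_carrier_mat[OF A]])
  qed
  then have "A ^\<^sub>m k *\<^sub>\<int> v \<in> vecs_over \<int> n"
    using int_mat_act_carrier[OF pow_carrier_mat[OF A], of k v]
    by (auto simp: vecs_over_def intro!: Ints_if_mem_integers_at)
  then show ?thesis using v by (auto simp: power_preimage_iff)
qed

lemma det_power_smult_power_preimage_Ints:
  fixes v :: "'a :: comm_ring_1 vec"
  assumes "v \<in> power_preimage \<int> A"
  obtains k where "of_int (det A ^ k) \<cdot>\<^sub>v v \<in> vecs_over \<int> n"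
proof -
  obtain k where v: "v \<in> carrier_vec n" and k: "A ^\<^sub>m k *\<^sub>\<int> v \<in> vecs_over \<int> n"
    using assms power_preimage_iff by blast
  note adj = adj_mat[OF pow_carrier_mat[OF A, of k]]
  have "of_int (det A ^ k) \<cdot>\<^sub>v v = adj_mat (A ^\<^sub>m k) *\<^sub>\<int> A ^\<^sub>m k *\<^sub>\<int> v"
    using mult_int_mat_act[OF adj(1) pow_carrier_mat[OF A] v, of k] adj(3) smult_one_int_mat_act[OF v]
    by (simp add: det_pow_mat[OF A])
  also have "\<dots> \<in> vecs_over \<int> n" using int_mat_act_over[OF unital_subring_Ints adj(1) k] .
  finally show ?thesis by (rule that)
qed

lemma power_preimage_Ints_away_from_det:
  assumes "prime p" "\<not> p dvd det A" "v \<in> power_preimage \<int> A"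
  shows "v \<in> vecs_over (integers_at p) n"
proof -
  obtain k where k: "of_int (det A ^ k) \<cdot>\<^sub>v v \<in> vecs_over \<int> n"
    using det_power_smult_power_preimage_Ints[OF assms(3)] .
  have "\<not> p dvd det A ^ k" using assms(1,2) by (meson prime_dvd_power)
  then show ?thesis
    using k power_preimage_carrier[OF assms(3)]
    by (auto simp: vecs_over_def intro!: integers_at_if_multiple_Ints[of p "det A ^ k"])
qed

end

lemma mem_adjoin_inverse_iff:
  assumes "d \<noteq> 0"
  shows "r \<in> adjoin_inverse d \<longleftrightarrow> (\<exists>k. of_int (d ^ k) * r \<in> \<int>)"
proof
  assume "r \<in> adjoin_inverse d"
  then obtain f :: "int poly" where r: "r = poly (map_poly of_int f) (1 / of_int d)"
    by (auto simp: adjoin_inverse_def)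
  have "of_int (d ^ degree f) * r = (\<Sum>i\<le>degree f. of_int (poly.coeff f i) * of_int d ^ (degree f - i))"
    unfolding r poly_altdef sum_distrib_left using assms
    by (auto simp: power_divide power_diff coeff_map_poly intro!: sum.cong)
  also have "\<dots> \<in> \<int>" by auto
  finally show "\<exists>k. of_int (d ^ k) * r \<in> \<int>" by blast
next
  assume "\<exists>k. of_int (d ^ k) * r \<in> \<int>"
  then obtain k z where "of_int d ^ k * r = of_int z" by (auto elim: Ints_cases)
  then have "r = of_int z * (1 / of_int d) ^ k" using assms by (simp add: field_simps)
  also have "\<dots> = poly (map_poly of_int (Polynomial.monom z k)) (1 / of_int d)"
    by (simp add: poly_monom of_int_hom.map_poly_hom_monom)
  finally show "r \<in> adjoin_inverse d" unfolding adjoin_inverse_def by (rule range_eqI)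
qed

lemma adjoin_inverse_subset_integers_at:
  assumes "prime p" "\<not> p dvd d"
  shows "adjoin_inverse d \<subseteq> integers_at p"
proof
  fix r assume "r \<in> adjoin_inverse d"
  moreover have "d \<noteq> 0" using assms(2) by auto
  ultimately obtain k where "of_int (d ^ k) * r \<in> \<int>" using mem_adjoin_inverse_iff by blast
  moreover have "\<not> p dvd d ^ k" using assms by (meson prime_dvd_power)
  ultimately show "r \<in> integers_at p" by (rule integers_at_if_multiple_Ints[rotated])
qed

section \<open>Algebraic integers\<close>

lemma int_mat_eigenvalue_algebraic_int:
  fixes M :: "int mat" and z :: "'a :: field_char_0"
  assumes "M \<in> carrier_mat k k" "eigenvalue (map_mat of_int M) z"
  shows "algebraic_int z"
proof -
  have "poly (char_poly (map_mat of_int M)) z = 0"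
    using assms eigenvalue_root_char_poly[of "map_mat of_int M" k z] by simp
  also have "char_poly (map_mat of_int M) = map_poly of_int (char_poly M)"
    using assms(1) by (rule of_int_hom.char_poly_hom)
  finally show ?thesis
    unfolding algebraic_int_altdef_ipoly using degree_monic_char_poly[OF assms(1)] by auto
qed

interpretation int_module: Modules.module "\<lambda>(k :: int) (x :: 'a :: comm_ring_1). of_int k * x"
  by unfold_locales (simp_all add: algebra_simps)

lemma int_span_mult_stable:
  assumes "\<And>b. b \<in> B \<Longrightarrow> z * b \<in> int_module.span B" "w \<in> int_module.span B"
  shows "z * w \<in> int_module.span B"
proof -
  have "int_module.subspace {w. z * w \<in> int_module.span B}"
    unfolding int_module.subspace_def
    by (auto simp: distrib_left mult.left_commute[of z]
        intro: int_module.span_zero int_module.span_add int_module.span_scale)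
  then have "int_module.span B \<subseteq> {w. z * w \<in> int_module.span B}"
    using assms(1) by (intro int_module.span_minimal) auto
  then show ?thesis using assms(2) by blast
qed

lemma algebraic_int_if_stabilizes_int_span:
  fixes z :: "'a :: field_char_0"
  assumes "finite B" "b \<in> B" "b \<noteq> 0" "\<And>x. x \<in> B \<Longrightarrow> z * x \<in> int_module.span B"
  shows "algebraic_int z"
proof -
  obtain h where h: "bij_betw h {..<card B} B"
    using ex_bij_betw_nat_finite[OF assms(1)] by (auto simp: atLeast0LessThan)
  have "\<forall>x\<in>B. \<exists>c. z * x = (\<Sum>y\<in>B. of_int (c y) * y)"
    using assms(4) unfolding int_module.span_finite[OF assms(1)] by blast
  then obtain c where c: "\<And>x. x \<in> B \<Longrightarrow> z * x = (\<Sum>y\<in>B. of_int (c x y) * y)" by metis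
  define M where "M = mat (card B) (card B) (\<lambda>(i, j). c (h i) (h j))"
  define u where "u = vec (card B) h"
  have M: "M \<in> carrier_mat (card B) (card B)" by (simp add: M_def)
  have "map_mat of_int M *\<^sub>v u = z \<cdot>\<^sub>v u"
  proof (rule eq_vecI)
    fix i assume "i < dim_vec (z \<cdot>\<^sub>v u)"
    then have i: "i < card B" by (simp add: u_def)
    then have hi: "h i \<in> B" using h by (auto simp: bij_betw_def)
    have "(map_mat of_int M *\<^sub>v u) $ i = (\<Sum>j<card B. of_int (c (h i) (h j)) * h j)"
      using i by (simp add: M_def u_def scalar_prod_def atLeast0LessThan)
    also have "\<dots> = (\<Sum>y\<in>B. of_int (c (h i) y) * y)" by (rule sum.reindex_bij_betw[OF h])
    also have "\<dots> = z * h i" using c[OF hi] by simp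
    finally show "(map_mat of_int M *\<^sub>v u) $ i = (z \<cdot>\<^sub>v u) $ i" using i by (simp add: u_def)
  qed (simp_all add: M_def u_def)
  moreover have "u \<noteq> 0\<^sub>v (card B)"
  proof
    obtain i where i: "i < card B" "h i = b"
      using bij_betw_imp_surj_on[OF h] assms(2) by (metis imageE lessThan_iff)
    assume "u = 0\<^sub>v (card B)"
    then have "u $ i = 0" using i by simp
    then show False using i assms(3) by (simp add: u_def)
  qed
  ultimately have "eigenvalue (map_mat of_int M) z"
    unfolding eigenvalue_def eigenvector_def by (intro exI[of _ u]) (simp add: M_def u_def)
  then show ?thesis using int_mat_eigenvalue_algebraic_int[OF M] by blast
qed

lemma algebraic_int_power_reduction:
  fixes x :: "'a :: field_char_0"
  assumes "algebraic_int x"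
  obtains m c where "m > 0" "x ^ m = (\<Sum>i<m. of_int (c i) * x ^ i)"
proof -
  obtain f where f: "poly (map_poly of_int f) x = 0" "lead_coeff f = 1"
    using assms unfolding algebraic_int_altdef_ipoly by blast
  let ?m = "degree f"
  have "0 = (\<Sum>i\<le>?m. of_int (poly.coeff f i) * x ^ i)"
    using f(1) by (simp add: poly_altdef coeff_map_poly)
  also have "\<dots> = x ^ ?m + (\<Sum>i<?m. of_int (poly.coeff f i) * x ^ i)"
    using f(2) by (simp flip: lessThan_Suc_atMost)
  finally have "x ^ ?m = (\<Sum>i<?m. of_int (- poly.coeff f i) * x ^ i)"
    by (simp add: sum_negf eq_neg_iff_add_eq_0)
  moreover have "?m > 0"
  proof (rule ccontr)
    assume "\<not> ?m > 0"
    then obtain a where "f = [:a:]" by (metis degree_eq_zeroE gr0I)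
    then show False using f by simp
  qed
  ultimately show ?thesis by (intro that)
qed

definition power_products :: "'a :: comm_ring_1 \<Rightarrow> nat \<Rightarrow> 'a \<Rightarrow> nat \<Rightarrow> 'a set" where
  "power_products x m y n = (\<lambda>(i, j). x ^ i * y ^ j) ` ({..<m} \<times> {..<n})"

lemma power_products_commute: "power_products x m y n = power_products y n x m"
  unfolding power_products_def by (force simp: mult.commute)

lemma finite_power_products: "finite (power_products x m y n)"
  by (simp add: power_products_def)

lemma one_mem_power_products: "m > 0 \<Longrightarrow> n > 0 \<Longrightarrow> 1 \<in> power_products x m y n"
  unfolding power_products_def by (rule image_eqI[of _ _ "(0, 0)"]) auto

lemma mult_power_products_mem_span:
  assumes "x ^ m = (\<Sum>i<m. of_int (c i) * x ^ i)" "b \<in> power_products x m y n"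
  shows "x * b \<in> int_module.span (power_products x m y n)"
proof -
  have mem: "x ^ i * y ^ j \<in> int_module.span (power_products x m y n)" if "i < m" "j < n" for i j
    using that by (intro int_module.span_base) (auto simp: power_products_def)
  obtain i j where ij: "b = x ^ i * y ^ j" "i < m" "j < n" using assms(2) by (auto simp: power_products_def)
  consider (inner) "Suc i < m" | (top) "m = Suc i" using ij(2) by linarith
  then show ?thesis
  proof cases
    case inner
    then show ?thesis using mem[of "Suc i" j] ij by (simp add: mult.assoc)
  next
    case top
    then have "x * b = x ^ m * y ^ j" using ij(1) by (simp add: mult.assoc)
    also have "\<dots> = (\<Sum>i<m. of_int (c i) * (x ^ i * y ^ j))"
      unfolding assms(1) by (simp add: sum_distrib_right mult.assoc)
    finally show ?thesis
      using mem ij(3) by (auto intro!: int_module.span_sum int_module.span_scale)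
  qed
qed

lemma algebraic_int_pair_stabilizes_int_span:
  fixes x y :: "'a :: field_char_0"
  assumes "algebraic_int x" "algebraic_int y"
  obtains B where "finite B" "1 \<in> B" "\<And>b. b \<in> B \<Longrightarrow> x * b \<in> int_module.span B"
    "\<And>b. b \<in> B \<Longrightarrow> y * b \<in> int_module.span B"
proof -
  obtain m c where m: "m > 0" "x ^ m = (\<Sum>i<m. of_int (c i) * x ^ i)"
    using algebraic_int_power_reduction[OF assms(1)] .
  obtain n d where n: "n > 0" "y ^ n = (\<Sum>i<n. of_int (d i) * y ^ i)"
    using algebraic_int_power_reduction[OF assms(2)] .
  show ?thesis
  proof (rule that[OF finite_power_products one_mem_power_products[OF m(1) n(1)]])
    fix b assume b: "b \<in> power_products x m y n"
    show "x * b \<in> int_module.span (power_products x m y n)"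
      using m(2) b by (rule mult_power_products_mem_span)
    show "y * b \<in> int_module.span (power_products x m y n)"
      using mult_power_products_mem_span[OF n(2)] b by (simp only: power_products_commute[of x m])
  qed
qed

lemma algebraic_int_add:
  fixes x y :: "'a :: field_char_0"
  assumes "algebraic_int x" "algebraic_int y"
  shows "algebraic_int (x + y)"
proof (rule algebraic_int_pair_stabilizes_int_span[OF assms])
  fix B assume "finite B" "1 \<in> B" "\<And>b. b \<in> B \<Longrightarrow> x * b \<in> int_module.span B"
    "\<And>b. b \<in> B \<Longrightarrow> y * b \<in> int_module.span B"
  then show ?thesis
    by (intro algebraic_int_if_stabilizes_int_span[of B 1])
       (auto simp: distrib_right int_module.span_add)
qed

lemma algebraic_int_mult:
  fixes x y :: "'a :: field_char_0"
  assumes "algebraic_int x" "algebraic_int y"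
  shows "algebraic_int (x * y)"
proof (rule algebraic_int_pair_stabilizes_int_span[OF assms])
  fix B assume "finite B" "1 \<in> B" "\<And>b. b \<in> B \<Longrightarrow> x * b \<in> int_module.span B"
    "\<And>b. b \<in> B \<Longrightarrow> y * b \<in> int_module.span B"
  then show ?thesis
    by (intro algebraic_int_if_stabilizes_int_span[of B 1])
       (auto simp: mult.assoc int_span_mult_stable)
qed

text \<open>If \<open>c\<close> is the leading coefficient of a polynomial of degree \<open>n\<close> with root \<open>x\<close>, multiplying the
  equation by \<open>c\<^sup>n\<^sup>-\<^sup>1\<close> makes it monic in \<open>c x\<close>.\<close>

lemma algebraic_imp_multiple_algebraic_int:
  fixes x :: "'a :: field_char_0"
  assumes "algebraic x"
  obtains c :: int where "c \<noteq> 0" "algebraic_int (of_int c * x)"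
proof -
  obtain f where f: "f \<noteq> 0" "poly (map_poly of_int f) x = 0" using algebraicE'[OF assms] .
  let ?c = "lead_coeff f"
  have "degree f \<noteq> 0"
  proof
    assume "degree f = 0"
    then obtain a where "f = [:a:]" by (metis degree_eq_zeroE)
    then show False using f by (simp add: map_poly_pCons)
  qed
  then obtain m where m: "degree f = Suc m" by (auto simp: gr0_conv_Suc)
  let ?y = "of_int ?c * x" and ?B = "(\<lambda>i. (of_int ?c * x) ^ i) ` {..m}"
  have "0 = (\<Sum>i\<le>Suc m. of_int (poly.coeff f i) * x ^ i)"
    using f(2) m by (simp add: poly_altdef coeff_map_poly)
  then have top: "of_int ?c * x ^ Suc m = - (\<Sum>i\<le>m. of_int (poly.coeff f i) * x ^ i)"
    using m by (simp add: eq_neg_iff_add_eq_0 add.commute)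
  have "?y ^ Suc m = of_int ?c ^ m * (of_int ?c * x ^ Suc m)" by (simp add: power_mult_distrib)
  also have "\<dots> = (\<Sum>i\<le>m. of_int (- poly.coeff f i * ?c ^ (m - i)) * ?y ^ i)"
    unfolding top sum_distrib_left sum_negf[symmetric]
    by (intro sum.cong) (auto simp: power_mult_distrib simp flip: power_add mult.assoc)
  also have "\<dots> \<in> int_module.span ?B"
    by (intro int_module.span_sum int_module.span_scale int_module.span_base) auto
  finally have "?y ^ Suc m \<in> int_module.span ?B" .
  then have "?y * ?y ^ i \<in> int_module.span ?B" if "i \<le> m" for i
    using that by (cases "i = m") (auto intro!: int_module.span_base image_eqI[of _ _ "Suc i"])
  then have "algebraic_int ?y"
    by (intro algebraic_int_if_stabilizes_int_span[of ?B 1]) (auto intro: image_eqI[of _ _ 0])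
  then show ?thesis using that[of ?c] f(1) by simp
qed

section \<open>Rings of integers of number fields\<close>

lemma cring_class_ring_restrict:
  fixes R :: "'a :: comm_ring_1 set"
  assumes "unital_subring R"
  shows "cring ((class_ring :: 'a ring)\<lparr>carrier := R\<rparr>)"
proof -
  interpret R: unital_subring R by (rule assms)
  let ?R = "(class_ring :: 'a ring)\<lparr>carrier := R\<rparr>"
  show ?thesis
  proof (rule cringI)
    show "abelian_group ?R"
    proof (rule abelian_groupI)
      fix x assume "x \<in> carrier ?R"
      then show "\<exists>y\<in>carrier ?R. y \<oplus>\<^bsub>?R\<^esub> x = \<zero>\<^bsub>?R\<^esub>"
        by (intro bexI[of _ "- x"]) (auto simp: R.uminus_closed)
    qed (auto simp: algebra_simps intro: R.zero_closed R.add_closed)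
    show "Group.comm_monoid ?R"
      by (rule comm_monoidI) (auto simp: algebra_simps intro: R.one_closed R.mult_closed)
  qed (auto simp: algebra_simps)
qed

lemma division_subring_if_subfield:
  fixes F :: "'a :: field set"
  assumes "subfield F (class_ring :: 'a ring)"
  shows "division_subring F"
proof -
  note subring = subringE[OF subfieldE(1)[OF assms]]
  show ?thesis
  proof
    show "1 \<in> F" using subring(3) by (simp add: class_ring_simps)
    show "x * y \<in> F" if "x \<in> F" "y \<in> F" for x y
      using subring(6)[of x y] that by (simp add: class_ring_simps)
    show "x - y \<in> F" if "x \<in> F" "y \<in> F" for x y
      using subring(5)[of y] subring(7)[of x "- y"] that by (simp add: class_ring_simps)
    show "inverse x \<in> F" if "x \<in> F" for x
    proof (cases "x = 0")
      case False
      then have "x \<in> Units ((class_ring :: 'a ring)\<lparr>carrier := F\<rparr>)"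
        using subfield.subfield_Units[OF assms] that by (auto simp: class_ring_simps)
      then obtain y where "y \<in> F" "x * y = 1" by (auto simp: Units_def class_ring_simps)
      then show ?thesis using inverse_unique by metis
    qed (use that in simp)
  qed
qed

lemma number_field_imp_division_subring: "number_field F \<Longrightarrow> division_subring F"
  by (simp add: number_field_def division_subring_if_subfield)

lemma division_subring_of_rat_closed:
  fixes F :: "'a :: field_char_0 set"
  assumes "division_subring F"
  shows "of_rat r \<in> F"
proof -
  interpret division_subring F by (rule assms)
  obtain a b where "quotient_of r = (a, b)" by force
  then have "r = of_int a / of_int b" by (rule quotient_of_div)
  then have "(of_rat r :: 'a) = of_int a * inverse (of_int b)"
    by (simp add: of_rat_divide flip: divide_inverse)
  then show ?thesis using mult_closed[OF of_int_closed inverse_closed[OF of_int_closed]] by simp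
qed

lemma subfield_Rats: "subfield \<rat> (class_ring :: complex ring)"
proof -
  note R = class_ring.ring_axioms
  have "\<exists>y\<in>\<rat>. y * x = 1 \<and> x * y = 1" if "x \<in> \<rat>" "x \<noteq> 0" for x :: complex
    using that by (intro bexI[of _ "inverse x"]) auto
  then have "Units ((class_ring :: complex ring)\<lparr>carrier := \<rat>\<rparr>) = \<rat> - {\<zero>\<^bsub>class_ring\<^esub>}"
    by (auto simp: Units_def)
  moreover have "subcring \<rat> (class_ring :: complex ring)"
    by (intro ring.subcringI[OF R] ring.subringI[OF R]) (auto simp: class_ring_simps)
  ultimately show ?thesis by (intro ring.subfieldI[OF R])
qed

lemma class_ring_eval_eq_poly:
  "ring.eval (class_ring :: complex ring) q x = poly (Poly (rev q)) x"
proof -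
  note R = class_ring.ring_axioms
  have pow: "x [^]\<^bsub>class_ring\<^esub> k = x ^ k" for k :: nat
    by (induction k) (simp_all add: class_ring_simps nat_pow_def)
  show ?thesis
    by (induction q) (simp_all add: ring.eval.simps[OF R] pow Poly_snoc poly_monom add.commute)
qed

lemma number_field_imp_algebraic:
  assumes "number_field F" "x \<in> F"
  shows "algebraic x"
proof -
  have dom: "domain (class_ring :: complex ring)" by (intro field.axioms(1) class_field)
  note R = class_ring.ring_axioms
  have F: "subring F (class_ring :: complex ring)"
    and fin: "ring.finite_dimension (class_ring :: complex ring) \<rat> F"
    using assms(1) subfieldE(1) by (auto simp: number_field_def)
  obtain q where q: "q \<in> carrier (\<rat> [X]\<^bsub>class_ring\<^esub>)" "q \<noteq> []" "ring.eval class_ring q x = 0"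
    using domain.algebraicE[OF dom subfieldE(1)[OF subfield_Rats] _
        ring.finite_dimension_imp_algebraic[OF R subfield_Rats F fin assms(2)]]
    by (auto simp: class_ring_simps)
  let ?f = "Poly (rev q)"
  have "set q \<subseteq> \<rat>" "hd q \<noteq> 0"
    using q(1,2) by (auto simp: univ_poly_carrier[symmetric] polynomial_def)
  have "poly ?f x = 0" using q(3) by (simp add: class_ring_eval_eq_poly)
  moreover have "poly.coeff ?f i \<in> \<rat>" for i
    using \<open>set q \<subseteq> \<rat>\<close> by (auto simp: coeff_Poly_eq nth_default_def rev_nth)
  moreover have "poly.coeff ?f (length q - 1) = hd q"
    using q(2) by (simp add: coeff_Poly_eq nth_default_def rev_nth hd_conv_nth)
  then have "?f \<noteq> 0" using \<open>hd q \<noteq> 0\<close> by (metis coeff_0)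
  ultimately show ?thesis by (intro algebraicI') auto
qed

section \<open>Primes above $p$ and the localized ring of integers\<close>

lemma (in cring) exists_maximalideal_superset:
  assumes "ideal I R" "\<one> \<notin> I"
  obtains M where "maximalideal M R" "I \<subseteq> M"
proof -
  let ?\<A> = "{J. ideal J R \<and> I \<subseteq> J \<and> \<one> \<notin> J}"
  have "\<exists>M\<in>?\<A>. \<forall>J\<in>?\<A>. M \<subseteq> J \<longrightarrow> J = M"
  proof (rule subset_Zorn_nonempty)
    show "?\<A> \<noteq> {}" using assms by blast
    fix C assume C: "C \<noteq> {}" "subset.chain ?\<A> C"
    have "subset.chain {J. ideal J R} C" using C(2) by (auto simp: subset_chain_def)
    then have "ideal (\<Union>C) R" using chain_Union_is_ideal[of C] C(1) by simp
    then show "\<Union>C \<in> ?\<A>" using C by (auto simp: subset_chain_def)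
  qed
  then obtain M where M: "M \<in> ?\<A>" and maximal: "\<forall>J\<in>?\<A>. M \<subseteq> J \<longrightarrow> J = M" by (rule bexE)
  have "maximalideal M R"
  proof (rule maximalidealI)
    show "ideal M R" "carrier R \<noteq> M" using M by auto
    fix J assume J: "ideal J R" "M \<subseteq> J" "J \<subseteq> carrier R"
    show "J = M \<or> J = carrier R"
    proof (cases "\<one> \<in> J")
      case True
      then show ?thesis using ideal.one_imp_carrier[OF J(1)] by simp
    next
      case False
      then have "J \<in> ?\<A>" using M J(1,2) by auto
      then show ?thesis using maximal J(2) by blast
    qed
  qed
  then show ?thesis using that M by blast
qed

lemma carrier_ring_of_integers: "carrier (ring_of_integers F) = {x \<in> F. algebraic_int x}"
  by (simp add: ring_of_integers_def)

lemma ring_of_integers_simps: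
  "x \<oplus>\<^bsub>ring_of_integers F\<^esub> y = x + y" "x \<otimes>\<^bsub>ring_of_integers F\<^esub> y = x * y"
  "\<one>\<^bsub>ring_of_integers F\<^esub> = 1" "\<zero>\<^bsub>ring_of_integers F\<^esub> = 0"
  by (simp_all add: ring_of_integers_def class_ring_simps)

lemma unital_subring_algebraic_ints:
  fixes F :: "'a :: field_char_0 set"
  assumes "unital_subring F"
  shows "unital_subring {x \<in> F. algebraic_int x}"
proof -
  interpret unital_subring F by (rule assms)
  have "algebraic_int (x - y)" if "algebraic_int x" "algebraic_int y" for x y :: 'a
    using algebraic_int_add[OF that(1) algebraic_int_minus[OF that(2)]] by simp
  then show ?thesis
    by unfold_locales (auto intro: one_closed diff_closed mult_closed algebraic_int_mult)
qed

lemma cring_ring_of_integers: "unital_subring F \<Longrightarrow> cring (ring_of_integers F)"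
  unfolding ring_of_integers_def by (intro cring_class_ring_restrict unital_subring_algebraic_ints)

lemma one_notin_cgenideal_prime:
  assumes "prime p"
  shows "1 \<notin> PIdl\<^bsub>ring_of_integers F\<^esub> (of_int p)"
proof
  have p: "p > 1" using assms by (rule prime_gt_1_int)
  assume "1 \<in> PIdl\<^bsub>ring_of_integers F\<^esub> (of_int p)"
  then obtain x :: complex where x: "algebraic_int x" "1 = x * of_int p"
    by (auto simp: cgenideal_def carrier_ring_of_integers ring_of_integers_simps)
  then have "x = of_rat (1 / of_int p)" using p by (simp add: of_rat_divide field_simps)
  then have "x \<in> \<int>" using x(1) rational_algebraic_int_is_int[of x] by simp
  then obtain z where "x = of_int z" by (auto elim: Ints_cases)
  then have "(of_int (z * p) :: complex) = of_int 1" using x(2) by simp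
  then have "z * p = 1" by (simp only: of_int_eq_iff)
  then show False using p by (simp add: zmult_eq_1_iff)
qed

lemma proper_ideal_Int_Ints:
  assumes "unital_subring F" "ideal P (ring_of_integers F)" "1 \<notin> P" "prime p" "of_int p \<in> P"
  shows "P \<inter> \<int> = range (\<lambda>k. complex_of_int (p * k))"
proof -
  interpret P: ideal P "ring_of_integers F" by (rule assms(2))
  interpret O: unital_subring "{x \<in> F. algebraic_int x}"
    using assms(1) by (rule unital_subring_algebraic_ints)
  have mult: "x * of_int k \<in> P" if "x \<in> P" for x k
    using P.I_r_closed[of x "of_int k"] that O.of_int_closed[of k]
    by (simp add: ring_of_integers_simps carrier_ring_of_integers)
  have dvd: "p dvd z" if z: "of_int z \<in> P" for z
  proof (rule ccontr)
    assume "\<not> p dvd z"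
    then have "Rings.coprime z p" using assms(4) prime_imp_coprime[of p z] by (simp add: ac_simps)
    then obtain u v where "u * z + v * p = 1"
      using bezout_int[of z p] by (auto simp: coprime_iff_gcd_eq_1)
    then have "(1 :: complex) = of_int (u * z + v * p)" by simp
    also have "\<dots> = of_int z * of_int u + of_int p * of_int v" by simp
    also have "\<dots> \<in> P"
      using additive_subgroup.a_closed[OF ideal.axioms(1)[OF assms(2)] mult[OF z, of u]
        mult[OF assms(5), of v]] by (simp add: ring_of_integers_simps)
    finally show False using assms(3) by simp
  qed
  have "x \<in> range (\<lambda>k. complex_of_int (p * k))" if x: "x \<in> P" "x \<in> \<int>" for x
  proof -
    obtain z where z: "x = of_int z" using x(2) by (auto elim: Ints_cases)
    then obtain k where "z = p * k" using dvd[of z] x(1) by (auto elim: dvdE)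
    then show ?thesis using z by blast
  qed
  then show ?thesis using mult[OF assms(5)] by auto
qed

lemma prime_above_exists:
  assumes "unital_subring F" "prime p"
  obtains P where "prime_above F p P"
proof -
  interpret cring "ring_of_integers F" using assms(1) by (rule cring_ring_of_integers)
  have p: "of_int p \<in> carrier (ring_of_integers F)"
    using unital_subring.of_int_closed[OF unital_subring_algebraic_ints[OF assms(1)]]
    by (simp add: carrier_ring_of_integers)
  obtain P where P: "maximalideal P (ring_of_integers F)" "PIdl\<^bsub>ring_of_integers F\<^esub> (of_int p) \<subseteq> P"
    using exists_maximalideal_superset[OF cgenideal_ideal[OF p]] one_notin_cgenideal_prime[OF assms(2)]
    by (auto simp: ring_of_integers_simps)
  have ideal: "ideal P (ring_of_integers F)" using P(1) by (rule maximalideal.axioms)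
  have "1 \<notin> P"
    using ideal.one_imp_carrier[OF ideal] maximalideal.I_notcarr[OF P(1)]
    by (auto simp: ring_of_integers_simps)
  moreover have "of_int p \<in> P" using cgenideal_self[OF p] P(2) by blast
  ultimately have "P \<inter> \<int> = range (\<lambda>k. complex_of_int (p * k))"
    using assms ideal by (intro proper_ideal_Int_Ints)
  then have "prime_above F p P" using maximalideal_prime[OF P(1)] by (simp add: prime_above_def)
  then show ?thesis by (rule that)
qed

locale prime_above_field =
  fixes F P :: "complex set" and p :: int
  assumes number_field: "number_field F" and prime_p: "prime p" and above: "prime_above F p P"
begin

sublocale F: division_subring F
  using number_field by (rule number_field_imp_division_subring)

abbreviation \<O> :: "complex set" where
  "\<O> \<equiv> {x \<in> F. algebraic_int x}"

sublocale \<O>: unital_subring \<O>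
  by (intro unital_subring_algebraic_ints F.unital_subring_axioms)

lemma p_gt_1: "p > 1" using prime_p by (rule prime_gt_1_int)

sublocale P: primeideal P "ring_of_integers F"
  using above by (simp add: prime_above_def)

lemma P_subset_\<O>: "P \<subseteq> \<O>"
  using P.Icarr by (auto simp: carrier_ring_of_integers)

lemma P_mult: "x \<in> P \<Longrightarrow> y \<in> \<O> \<Longrightarrow> x * y \<in> P"
  using P.I_r_closed[of x y] by (simp add: carrier_ring_of_integers ring_of_integers_simps)

lemma P_add: "x \<in> P \<Longrightarrow> y \<in> P \<Longrightarrow> x + y \<in> P"
  using additive_subgroup.a_closed[OF ideal.axioms(1)[OF P.ideal_axioms], of x y]
  by (simp add: ring_of_integers_simps)

lemma P_prime: "x * y \<in> P \<Longrightarrow> x \<in> \<O> \<Longrightarrow> y \<in> \<O> \<Longrightarrow> x \<in> P \<or> y \<in> P"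
  using P.I_prime[of x y] by (simp add: carrier_ring_of_integers ring_of_integers_simps)

lemma of_int_mem_P_iff: "of_int z \<in> P \<longleftrightarrow> p dvd z"
proof -
  have "of_int z \<in> P \<longleftrightarrow> of_int z \<in> P \<inter> \<int>" by simp
  also have "\<dots> \<longleftrightarrow> (of_int z :: complex) \<in> range (\<lambda>k. complex_of_int (p * k))"
    using above by (simp add: prime_above_def)
  also have "\<dots> \<longleftrightarrow> p dvd z" by (auto simp: image_iff dvd_def simp flip: of_int_mult)
  finally show ?thesis .
qed

lemma one_notin_P: "1 \<notin> P"
  using of_int_mem_P_iff[of 1] p_gt_1 by (simp add: zdvd1_eq)

definition local_ring :: "complex set" ("\<O>\<^sub>P") where
  "\<O>\<^sub>P = localization \<O> (\<O> - P)"

sublocale local_ring: unital_subring \<O>\<^sub>P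
  unfolding local_ring_def
proof (rule unital_subring_localization[OF \<O>.unital_subring_axioms])
  show "0 \<notin> \<O> - P" using of_int_mem_P_iff[of 0] by simp
  show "1 \<in> \<O> - P" using one_notin_P \<O>.one_closed by blast
  show "b * d \<in> \<O> - P" if "b \<in> \<O> - P" "d \<in> \<O> - P" for b d
    using that P_prime[of b d] \<O>.mult_closed[of b d] by blast
qed blast

lemma divide_mem_local_ring: "a \<in> \<O> \<Longrightarrow> b \<in> \<O> \<Longrightarrow> b \<notin> P \<Longrightarrow> a / b \<in> \<O>\<^sub>P"
  unfolding local_ring_def localization_def by blast

lemma local_ring_cases:
  assumes "x \<in> \<O>\<^sub>P"
  obtains a b where "a \<in> \<O>" "b \<in> \<O>" "b \<notin> P" "b \<noteq> 0" "x = a / b"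
proof -
  obtain a b where "a \<in> \<O>" "b \<in> \<O> - P" "x = a / b"
    using assms unfolding local_ring_def localization_def by blast
  moreover have "0 \<in> P" using of_int_mem_P_iff[of 0] by simp
  ultimately show ?thesis by (intro that[of a b]) auto
qed

lemma algebraic_ints_subset_local_ring: "\<O> \<subseteq> \<O>\<^sub>P"
  using divide_mem_local_ring[OF _ \<O>.one_closed one_notin_P] by auto

lemma local_ring_subset_F: "\<O>\<^sub>P \<subseteq> F"
  by (auto elim!: local_ring_cases simp: divide_inverse intro!: F.mult_closed F.inverse_closed)

lemma of_rat_mem_local_ring_iff: "of_rat r \<in> \<O>\<^sub>P \<longleftrightarrow> r \<in> integers_at p"
proof
  assume "r \<in> integers_at p"
  then obtain a b where ab: "\<not> p dvd b" "r = of_int a / of_int b" by (rule integers_atE)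
  then have "of_rat r = of_int a / (of_int b :: complex)" by (simp add: of_rat_divide)
  then show "of_rat r \<in> \<O>\<^sub>P"
    using ab(1) \<O>.of_int_closed by (auto simp: of_int_mem_P_iff intro!: divide_mem_local_ring)
next
  assume "of_rat r \<in> \<O>\<^sub>P"
  then obtain a b where ab: "a \<in> \<O>" "b \<in> \<O>" "b \<notin> P" "b \<noteq> 0" "of_rat r = a / b"
    by (rule local_ring_cases)
  obtain c d where cd: "quotient_of r = (c, d)" by force
  have d: "d > 0" using quotient_of_denom_pos[OF cd] .
  have "a / b = of_int c / of_int d"
    using quotient_of_div[OF cd] ab(5) by (simp add: of_rat_divide)
  then have "of_int c * b = of_int d * a" using ab(4) d by (simp add: field_simps)
  moreover have "of_int d * a \<in> P" if "p dvd d"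
    using that ab(1) by (intro P_mult) (simp_all add: of_int_mem_P_iff)
  ultimately have "p dvd c" if "p dvd d"
    using that P_prime[of "of_int c" b] ab(2,3) \<O>.of_int_closed[of c] by (simp add: of_int_mem_P_iff)
  then have "\<not> p dvd d"
    using quotient_of_coprime[OF cd] prime_p not_prime_unit coprime_common_divisor by blast
  then show "r \<in> integers_at p" using integers_at_iff_denominator[OF prime_p cd] by simp
qed

lemma eventually_p_power_mult_mem_local_ring:
  assumes "x \<in> F"
  shows "\<forall>\<^sub>F k in sequentially. of_int p ^ k * x \<in> \<O>\<^sub>P"
proof -
  obtain m :: int where m: "m \<noteq> 0" "algebraic_int (of_int m * x)"
    using algebraic_imp_multiple_algebraic_int[OF number_field_imp_algebraic[OF number_field assms]] .
  let ?e = "multiplicity p m"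
  obtain m' where m': "m = p ^ ?e * m'" "\<not> p dvd m'"
    using prime_multiplicity_decompose[OF prime_p m(1)] .
  have "m' \<noteq> 0" using m' by auto
  then have "of_int p ^ ?e * x = of_int m * x / of_int m'" by (subst (2) m'(1)) simp
  also have "\<dots> \<in> \<O>\<^sub>P"
    using m(2) m'(2) assms \<O>.of_int_closed[of m'] F.of_int_closed
    by (intro divide_mem_local_ring) (auto simp: of_int_mem_P_iff intro: F.mult_closed)
  finally have base: "of_int p ^ ?e * x \<in> \<O>\<^sub>P" .
  have "of_int p ^ k * x \<in> \<O>\<^sub>P" if "k \<ge> ?e" for k
  proof -
    have "of_int (p ^ (k - ?e)) * (of_int p ^ ?e * x) = of_int p ^ k * x"
      using that by (simp flip: power_add mult.assoc)
    then show ?thesis using local_ring.mult_closed[OF local_ring.of_int_closed base] by metis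
  qed
  then show ?thesis by (rule eventually_sequentiallyI)
qed

lemma zero_if_divisible_by_p_powers:
  assumes "\<And>k. x / of_int p ^ k \<in> \<O>\<^sub>P"
  shows "x = 0"
proof (rule ccontr)
  assume "x \<noteq> 0"
  have "x \<in> F" using assms[of 0] local_ring_subset_F by auto
  then obtain k where "of_int p ^ k * inverse x \<in> \<O>\<^sub>P"
    using eventually_happens'[OF sequentially_bot eventually_p_power_mult_mem_local_ring] F.inverse_closed
    by blast
  then have "(of_int p ^ k * inverse x) * (x / of_int p ^ Suc k) \<in> \<O>\<^sub>P"
    using assms by (rule local_ring.mult_closed)
  also have "(of_int p ^ k * inverse x) * (x / of_int p ^ Suc k) = of_rat (of_int 1 / of_int p)"
    using \<open>x \<noteq> 0\<close> p_gt_1 by (simp add: of_rat_divide)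
  finally have "of_int 1 / of_int p \<in> integers_at p" by (simp only: of_rat_mem_local_ring_iff)
  then have "p ^ multiplicity p p dvd 1"
    using of_int_divide_mem_integers_at_iff[OF prime_p, of p 1] p_gt_1 by simp
  moreover have "multiplicity p p = 1" using p_gt_1 by (intro multiplicity_self) auto
  ultimately show False using p_gt_1 by simp
qed

end

section \<open>Root spaces of a matrix\<close>

text \<open>\<open>root_space A L\<close> is the kernel of the product of the matrices \<open>A - l\<close> for \<open>l\<close> in the list \<open>L\<close>.\<close>

primrec root_space :: "'a :: field mat \<Rightarrow> 'a list \<Rightarrow> 'a vec set" where
  "root_space A [] = {0\<^sub>v (dim_row A)}"
| "root_space A (l # L) = {v \<in> carrier_vec (dim_row A). char_matrix A l *\<^sub>v v \<in> root_space A L}"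

lemma char_matrix_mult_vec:
  assumes "A \<in> carrier_mat n n" "v \<in> carrier_vec n"
  shows "char_matrix A l *\<^sub>v v = A *\<^sub>v v - l \<cdot>\<^sub>v v"
  using assms
  by (intro eq_vecI) (auto simp: char_matrix_def add_scalar_prod_distrib[of _ n] algebra_simps)

context
  fixes A :: "'a :: field mat" and n :: nat
  assumes A: "A \<in> carrier_mat n n"
begin

lemma root_space_Cons_iff:
  "v \<in> root_space A (l # L) \<longleftrightarrow> v \<in> carrier_vec n \<and> char_matrix A l *\<^sub>v v \<in> root_space A L"
  using A by simp

lemma vec_submodule_root_space: "vec_submodule UNIV n (root_space A L)"
proof (induction L)
  case Nil
  show ?case using A by unfold_locales auto
next
  case (Cons l L)
  then show ?case
    using vec_submodule.vec_submodule_vimage[OF Cons char_matrix_closed[OF A, of l]] A by simp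
qed

lemmas root_space_carrier = vec_submodule.vec_carrier[OF vec_submodule_root_space]
  and root_space_zero = vec_submodule.vec_zero[OF vec_submodule_root_space]
  and root_space_minus = vec_submodule.vec_minus[OF vec_submodule_root_space]
  and root_space_smult = vec_submodule.vec_smult[OF vec_submodule_root_space UNIV_I]

lemma root_space_commuting_closed:
  assumes M: "M \<in> carrier_mat n n" "M * A = A * M" and v: "v \<in> root_space A L"
  shows "M *\<^sub>v v \<in> root_space A L"
  using v
proof (induction L arbitrary: v)
  case Nil
  then show ?case using A M(1) by (auto intro!: eq_vecI)
next
  case (Cons l L)
  have v: "v \<in> carrier_vec n" using Cons.prems root_space_Cons_iff by blast
  have "A *\<^sub>v (M *\<^sub>v v) = M *\<^sub>v (A *\<^sub>v v)"
    using assoc_mult_mat_vec[OF A M(1) v] assoc_mult_mat_vec[OF M(1) A v] M(2) by metis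
  then have "char_matrix A l *\<^sub>v (M *\<^sub>v v) = M *\<^sub>v (char_matrix A l *\<^sub>v v)"
    using A M(1) v
    by (simp add: char_matrix_mult_vec[of _ n] mult_minus_distrib_mat_vec[of _ n n] mult_mat_vec[of _ n n])
  then show ?case using Cons.IH Cons.prems M(1) v unfolding root_space_Cons_iff by simp
qed

lemma root_space_char_matrix_closed:
  assumes "v \<in> root_space A L"
  shows "char_matrix A l *\<^sub>v v \<in> root_space A L"
  using root_space_minus[OF root_space_commuting_closed[OF A refl assms] root_space_smult[OF assms]]
    char_matrix_mult_vec[OF A root_space_carrier[OF assms]] by simp

lemma root_space_append_left: "v \<in> root_space A L \<Longrightarrow> v \<in> root_space A (L @ M)"
  by (induction L arbitrary: v) (use A root_space_zero in auto)

lemma root_space_append_right: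
  assumes "v \<in> root_space A M"
  shows "v \<in> root_space A (L @ M)"
  using assms
  by (induction L arbitrary: v)
     (use A root_space_char_matrix_closed root_space_carrier in auto)

lemma root_space_replicate_iff:
  "v \<in> root_space A (replicate m l) \<longleftrightarrow> v \<in> carrier_vec n \<and> char_matrix A l ^\<^sub>m m *\<^sub>v v = 0\<^sub>v n"
proof (induction m arbitrary: v)
  case 0
  show ?case using A carrier_matD(1)[OF char_matrix_closed[OF A, of l]] by auto
next
  case (Suc m)
  have C: "char_matrix A l \<in> carrier_mat n n" using A by simp
  have "char_matrix A l ^\<^sub>m Suc m *\<^sub>v v = char_matrix A l ^\<^sub>m m *\<^sub>v (char_matrix A l *\<^sub>v v)"
    if "v \<in> carrier_vec n"
    using C that by (simp add: assoc_mult_mat_vec[of _ n n _ n])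
  then show ?case
    using Suc.IH[of "char_matrix A l *\<^sub>v v"] C unfolding replicate_Suc root_space_Cons_iff by auto
qed

end

lemma root_space_similar:
  assumes "P \<in> carrier_mat n n" "Q \<in> carrier_mat n n" "B \<in> carrier_mat n n" "Q * P = 1\<^sub>m n"
    and A: "A = P * B * Q" and v: "v \<in> root_space B L"
  shows "P *\<^sub>v v \<in> root_space A L"
  using v
proof (induction L arbitrary: v)
  case Nil
  then show ?case using assms(1-3) by (auto simp: A intro!: eq_vecI)
next
  case (Cons l L)
  have A': "A \<in> carrier_mat n n" using assms(1-3) by (simp add: A)
  have v: "v \<in> carrier_vec n" using Cons.prems assms(3) by simp
  have "Q *\<^sub>v (P *\<^sub>v v) = v" using assoc_mult_mat_vec[OF assms(2,1) v] assms(4) v by simp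
  then have "A *\<^sub>v (P *\<^sub>v v) = P *\<^sub>v (B *\<^sub>v v)"
    using assms(1-3) v by (simp add: A assoc_mult_mat_vec[of _ n n _ n])
  then have "char_matrix A l *\<^sub>v (P *\<^sub>v v) = P *\<^sub>v (char_matrix B l *\<^sub>v v)"
    using assms(1,3) A' v
    by (simp add: char_matrix_mult_vec[of _ n] mult_minus_distrib_mat_vec[of _ n n] mult_mat_vec[of _ n n])
  then show ?case using Cons.IH Cons.prems assms(1,3) A' v root_space_Cons_iff[of _ n] by simp
qed

lemma upper_triangular_mem_root_space:
  assumes B: "B \<in> carrier_mat n n" "upper_triangular B" and "k \<le> n"
    and "v \<in> carrier_vec n" "\<And>i. k \<le> i \<Longrightarrow> i < n \<Longrightarrow> v $ i = 0"
  shows "v \<in> root_space B (rev (map (\<lambda>i. B $$ (i, i)) [0..<k]))"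
  using assms(3-5)
proof (induction k arbitrary: v)
  case 0
  then show ?case using B(1) by (auto intro!: eq_vecI)
next
  case (Suc k)
  let ?w = "char_matrix B (B $$ (k, k)) *\<^sub>v v"
  have "?w $ i = 0" if i: "k \<le> i" "i < n" for i
  proof -
    have "B $$ (i, j) * v $ j = (if j = i then B $$ (k, k) * v $ i else 0)" if "j < n" for j
    proof (cases "j < i")
      case True
      then show ?thesis using B i by (auto simp: upper_triangular_def)
    next
      case False
      then show ?thesis using Suc.prems(3)[of j] Suc.prems(3)[of i] i that by (cases "j = k") auto
    qed
    then have "(B *\<^sub>v v) $ i = (\<Sum>j\<in>{0..<n}. if j = i then B $$ (k, k) * v $ i else 0)"
      using i B(1) Suc.prems(2) by (auto simp: scalar_prod_def intro!: sum.cong)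
    then show ?thesis using i B(1) Suc.prems(2) by (simp add: char_matrix_mult_vec[of _ n])
  qed
  moreover have "?w \<in> carrier_vec n"
    using char_matrix_closed[OF B(1)] Suc.prems(2) by (rule mult_mat_vec_carrier)
  ultimately have "?w \<in> root_space B (rev (map (\<lambda>i. B $$ (i, i)) [0..<k]))"
    using Suc.prems(1) by (intro Suc.IH) auto
  then show ?case using Suc.prems(2) B(1) by simp
qed

lemma complex_mat_root_space_eigenvalues:
  fixes A :: "complex mat"
  assumes A: "A \<in> carrier_mat n n"
  obtains L where "set L \<subseteq> {l. eigenvalue A l}" "carrier_vec n \<subseteq> root_space A L"
proof -
  obtain as where "char_poly A = (\<Prod>a\<leftarrow>as. [:- a, 1:])"
    using char_poly_factorized[OF A] by blast
  then obtain B where B: "B \<in> carrier_mat n n" "upper_triangular B" "similar_mat A B"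
    using schur_decomposition_exists[OF A] by blast
  obtain P Q where "similar_mat_wit A B P Q" using B(3) by (auto simp: similar_mat_def)
  then have PQ: "P \<in> carrier_mat n n" "Q \<in> carrier_mat n n" "P * Q = 1\<^sub>m n" "Q * P = 1\<^sub>m n"
    "A = P * B * Q"
    using A by (auto simp: similar_mat_wit_def Let_def)
  let ?L = "rev (map (\<lambda>i. B $$ (i, i)) [0..<n])"
  have "v \<in> root_space A ?L" if v: "v \<in> carrier_vec n" for v
  proof -
    have "Q *\<^sub>v v \<in> root_space B ?L"
      using PQ(2) v by (intro upper_triangular_mem_root_space[OF B(1,2)]) auto
    then have "P *\<^sub>v (Q *\<^sub>v v) \<in> root_space A ?L" by (rule root_space_similar[OF PQ(1,2) B(1) PQ(4,5)])
    also have "P *\<^sub>v (Q *\<^sub>v v) = v" using assoc_mult_mat_vec[OF PQ(1,2) v] PQ(3) v by simp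
    finally show ?thesis .
  qed
  moreover have "eigenvalue A l" if "l \<in> set ?L" for l
  proof -
    have "l \<in> set (diag_mat B)" using that B(1) by (auto simp: diag_mat_def)
    then have "poly (char_poly B) l = 0"
      unfolding char_poly_upper_triangular[OF B(1,2)] by (auto simp: poly_prod_list_zero_iff)
    then show ?thesis using eigenvalue_root_char_poly[OF A] char_poly_similar[OF B(3)] by simp
  qed
  ultimately show ?thesis by (intro that) auto
qed

lemma root_space_unit_eigenvalues_over:
  fixes A :: "'a :: field mat"
  assumes R: "unital_subring R" and A: "A \<in> mats_over R n"
    and "\<And>l. l \<in> set L \<Longrightarrow> l \<noteq> 0 \<and> l \<in> R \<and> inverse l \<in> R"
    and "y \<in> root_space A L" "A *\<^sub>v y \<in> vecs_over R n"
  shows "y \<in> vecs_over R n"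
  using assms(3-)
proof (induction L arbitrary: y)
  case Nil
  then show ?case
    using mats_over_carrier[OF A] unital_subring.zero_closed[OF R] by (simp add: vecs_over_def)
next
  case (Cons l L)
  interpret unital_subring R by (rule R)
  note A' = mats_over_carrier[OF A]
  let ?u = "char_matrix A l *\<^sub>v y"
  have l: "l \<noteq> 0" "l \<in> R" "inverse l \<in> R" using Cons.prems(1)[of l] by auto
  have y: "y \<in> carrier_vec n" using Cons.prems(2) A' by simp
  have u: "?u = A *\<^sub>v y - l \<cdot>\<^sub>v y" using A' y by (rule char_matrix_mult_vec)
  then have "A *\<^sub>v ?u = A *\<^sub>v (A *\<^sub>v y) - l \<cdot>\<^sub>v (A *\<^sub>v y)"
    using A' y by (simp add: mult_minus_distrib_mat_vec[of _ n n] mult_mat_vec[of _ n n])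
  also have "\<dots> \<in> vecs_over R n"
    using mult_mat_vec_over[OF A Cons.prems(3)] l(2) Cons.prems(3)
    by (intro vecs_over.vec_minus vecs_over.vec_smult)
  finally have "?u \<in> vecs_over R n" using Cons.IH[of ?u] Cons.prems(1,2) A' by simp
  then have "inverse l \<cdot>\<^sub>v (A *\<^sub>v y - ?u) \<in> vecs_over R n"
    using l(3) Cons.prems(3) by (intro vecs_over.vec_minus vecs_over.vec_smult)
  also have "inverse l \<cdot>\<^sub>v (A *\<^sub>v y - ?u) = y"
    unfolding u using A' y l(1) by (intro eq_vecI) (auto simp: algebra_simps)
  finally show ?case .
qed

context division_subring
begin

lemma char_matrix_mult_vec_over:
  assumes "A \<in> mats_over R n" "l \<in> R" "v \<in> vecs_over R n"
  shows "char_matrix A l *\<^sub>v v \<in> vecs_over R n"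
  using assms mult_mat_vec_over[OF assms(1,3)]
  by (simp add: char_matrix_mult_vec[of _ n] mats_over_carrier vecs_over_carrier vecs_over.vec_minus
      vecs_over.vec_smult)

lemma root_space_char_matrix_solvable:
  assumes A: "A \<in> mats_over R n" and "set L \<subseteq> R" "l \<in> R" "l \<notin> set L"
    and "y \<in> root_space A L" "y \<in> vecs_over R n"
  shows "\<exists>z\<in>root_space A L \<inter> vecs_over R n. char_matrix A l *\<^sub>v z = y"
  using assms(2-)
proof (induction L arbitrary: y)
  case Nil
  have "char_matrix A l *\<^sub>v 0\<^sub>v n = 0\<^sub>v n"
    using A by (intro eq_vecI) (auto simp: mats_over_def char_matrix_def)
  then show ?case
    using Nil.prems(4) A vecs_over.vec_zero[of n] by (auto simp: mats_over_def)
next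
  case (Cons m L)
  note A' = mats_over_carrier[OF A]
  let ?u = "char_matrix A m *\<^sub>v y"
  have y: "y \<in> carrier_vec n" using Cons.prems(5) by (rule vecs_over_carrier)
  have "?u \<in> vecs_over R n" using Cons.prems by (intro char_matrix_mult_vec_over A) auto
  then obtain z where z: "z \<in> root_space A L" "z \<in> vecs_over R n" "char_matrix A l *\<^sub>v z = ?u"
    using Cons.IH[of ?u] Cons.prems root_space_Cons_iff[OF A'] by auto
  have z': "z \<in> carrier_vec n" using z(2) by (rule vecs_over_carrier)
  let ?w = "inverse (m - l) \<cdot>\<^sub>v (y - z)"
  have "char_matrix A l *\<^sub>v ?w = inverse (m - l) \<cdot>\<^sub>v (char_matrix A l *\<^sub>v y - ?u)"
    using A' y z' z(3) char_matrix_closed[OF A', of l]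
    by (simp add: mult_mat_vec[of _ n n] mult_minus_distrib_mat_vec[of _ n n])
  also have "char_matrix A l *\<^sub>v y - ?u = (m - l) \<cdot>\<^sub>v y"
    using A' y by (simp add: char_matrix_mult_vec[of _ n]) (intro eq_vecI; auto simp: algebra_simps)
  also have "inverse (m - l) \<cdot>\<^sub>v ((m - l) \<cdot>\<^sub>v y) = y"
    using Cons.prems(3) by (auto simp: smult_smult_assoc)
  finally have "char_matrix A l *\<^sub>v ?w = y" .
  moreover have "?w \<in> root_space A (m # L)"
    using root_space_append_right[OF A' z(1), of "[m]"] Cons.prems(4)
    by (intro root_space_smult[OF A'] root_space_minus[OF A']) simp_all
  moreover have "?w \<in> vecs_over R n"
    using Cons.prems z(2)
    by (intro vecs_over.vec_smult vecs_over.vec_minus inverse_closed diff_closed) auto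
  ultimately show ?case by blast
qed

lemma root_space_Cons_split:
  assumes A: "A \<in> mats_over R n" and Ly: "set Ly \<subseteq> R" "l \<in> R" "l \<notin> set Ly"
    and w: "w \<in> vecs_over R n" "char_matrix A l *\<^sub>v w = x + y"
    and x: "x \<in> root_space A Lx" and y: "y \<in> root_space A Ly \<inter> vecs_over R n"
  obtains z where "z \<in> root_space A Ly \<inter> vecs_over R n" "w - z \<in> root_space A (l # Lx) \<inter> vecs_over R n"
proof -
  note A' = mats_over_carrier[OF A]
  obtain z where z: "z \<in> root_space A Ly \<inter> vecs_over R n" "char_matrix A l *\<^sub>v z = y"
    using root_space_char_matrix_solvable[OF A Ly] y by blast
  have carrier: "x \<in> carrier_vec n" "y \<in> carrier_vec n" "z \<in> carrier_vec n" "w \<in> carrier_vec n"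
    using x y z w(1) root_space_carrier[OF A'] vecs_over_carrier by auto
  then have "char_matrix A l *\<^sub>v (w - z) = x + y - y"
    using w(2) z(2) char_matrix_closed[OF A', of l] by (simp add: mult_minus_distrib_mat_vec[of _ n n])
  also have "\<dots> = x" using carrier by (intro eq_vecI) auto
  finally have "w - z \<in> root_space A (l # Lx) \<inter> vecs_over R n"
    using x carrier w(1) z(1) root_space_Cons_iff[OF A'] by (auto intro: vecs_over.vec_minus)
  then show ?thesis using z(1) by (intro that)
qed

lemma primary_decomposition:
  assumes A: "A \<in> mats_over R n" and "set L \<subseteq> R" "w \<in> root_space A L \<inter> vecs_over R n"
  shows "\<exists>x \<in> root_space A (filter (\<lambda>l. l \<in> S) L) \<inter> vecs_over R n.
    \<exists>y \<in> root_space A (filter (\<lambda>l. l \<notin> S) L) \<inter> vecs_over R n. w = x + y"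
  using assms(2,3)
proof (induction L arbitrary: w)
  case Nil
  then show ?case using mats_over_carrier[OF A] by auto
next
  case (Cons l L)
  let ?Lx = "filter (\<lambda>l. l \<in> S) L" and ?Ly = "filter (\<lambda>l. l \<notin> S) L"
  have w: "w \<in> vecs_over R n" "w \<in> carrier_vec n" using Cons.prems vecs_over_carrier by auto
  have "char_matrix A l *\<^sub>v w \<in> root_space A L \<inter> vecs_over R n"
    using Cons.prems char_matrix_mult_vec_over[OF A _ w(1)] by auto
  then obtain x y where x: "x \<in> root_space A ?Lx \<inter> vecs_over R n"
    and y: "y \<in> root_space A ?Ly \<inter> vecs_over R n" and xy: "char_matrix A l *\<^sub>v w = x + y"
    using Cons.IH[of "char_matrix A l *\<^sub>v w"] Cons.prems(1) by auto
  show ?case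
  proof (cases "l \<in> S")
    case True
    obtain z where z: "z \<in> root_space A ?Ly \<inter> vecs_over R n"
      "w - z \<in> root_space A (l # ?Lx) \<inter> vecs_over R n"
      using root_space_Cons_split[OF A _ _ _ w(1) xy, of ?Ly ?Lx] x y Cons.prems(1) True by auto
    moreover have "w = (w - z) + z" using w(2) vecs_over_carrier[of z R n] z(1) by (intro eq_vecI) auto
    ultimately show ?thesis using True by force
  next
    case False
    have yx: "char_matrix A l *\<^sub>v w = y + x"
      using xy comm_add_vec[of x n y] x y vecs_over_carrier[of x R n] vecs_over_carrier[of y R n] by simp
    obtain z where z: "z \<in> root_space A ?Lx \<inter> vecs_over R n"
      "w - z \<in> root_space A (l # ?Ly) \<inter> vecs_over R n"
      using root_space_Cons_split[OF A _ _ _ w(1) yx, of ?Lx ?Ly] x y Cons.prems(1) False by auto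
    moreover have "w = z + (w - z)" using w(2) vecs_over_carrier[of z R n] z(1) by (intro eq_vecI) auto
    ultimately show ?thesis using False by force
  qed
qed

lemma root_space_mem_if_generalized_eigenvectors_mem:
  assumes A: "A \<in> mats_over R n" and H: "vec_submodule R n H" and "set L \<subseteq> R"
    and "\<And>l m v. l \<in> set L \<Longrightarrow> v \<in> root_space A (replicate m l) \<inter> vecs_over R n \<Longrightarrow> v \<in> H"
    and "v \<in> root_space A L \<inter> vecs_over R n"
  shows "v \<in> H"
  using assms(3-)
proof (induction "length L" arbitrary: L v rule: less_induct)
  case less
  show ?case
  proof (cases L)
    case Nil
    then show ?thesis using less.prems(3) vec_submodule.vec_zero[OF H] mats_over_carrier[OF A] by simp
  next
    case (Cons l M)
    let ?Lx = "filter (\<lambda>k. k \<in> {l}) L" and ?Ly = "filter (\<lambda>k. k \<notin> {l}) L"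
    obtain x y where x: "x \<in> root_space A ?Lx \<inter> vecs_over R n"
      and y: "y \<in> root_space A ?Ly \<inter> vecs_over R n" and v: "v = x + y"
      using primary_decomposition[OF A less.prems(1,3), of "{l}"] by blast
    have "?Lx = replicate (length ?Lx) l" by (rule replicate_eqI) auto
    then have "x \<in> H" using x less.prems(2)[of l x "length ?Lx"] Cons by simp
    moreover have "length ?Ly < length L" using Cons by (simp add: le_imp_less_Suc)
    then have "y \<in> H" using less.hyps[of ?Ly y] less.prems(1,2) y by auto
    ultimately show ?thesis using v vec_submodule.vec_add[OF H] by simp
  qed
qed

end

section \<open>Idempotent powers of integer matrices modulo $q$\<close>

lemma recurrent_sequence_eventually_periodic:
  fixes f :: "nat \<Rightarrow> 'b"
  assumes "finite (range f)" and rec: "\<And>m. f (Suc m) = g (f m)"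
  obtains a c where "c > 0" "\<And>m k. m \<ge> a \<Longrightarrow> f (m + c * k) = f m"
proof -
  have "\<not> inj f" using finite_imageD[of f UNIV] assms(1) infinite_UNIV_nat by blast
  then obtain a b where ab: "a < b" "f a = f b" unfolding inj_def by (metis linorder_neqE_nat)
  have shift: "f (a + j) = f (b + j)" for j by (induction j) (simp_all add: rec ab(2))
  have "f (m + (b - a)) = f m" if "m \<ge> a" for m
    using shift[of "m - a"] that ab(1) by (simp add: add.commute)
  then have "f (m + (b - a) * k) = f m" if "m \<ge> a" for m k
    using that by (induction k arbitrary: m) (simp_all flip: add.assoc)
  then show ?thesis using ab(1) by (intro that[of "b - a" a]) auto
qed

lemma finite_bounded_int_mats: "finite {M \<in> carrier_mat n n. \<forall>i<n. \<forall>j<n. M $$ (i, j) \<in> {0..<q::int}}"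
proof (rule finite_subset)
  let ?I = "{..<n} \<times> {..<n}"
  show "finite (mat n n ` (?I \<rightarrow>\<^sub>E {0..<q}))" by (intro finite_imageI finite_PiE) auto
  show "{M \<in> carrier_mat n n. \<forall>i<n. \<forall>j<n. M $$ (i, j) \<in> {0..<q}} \<subseteq> mat n n ` (?I \<rightarrow>\<^sub>E {0..<q})"
  proof
    fix M assume M: "M \<in> {M \<in> carrier_mat n n. \<forall>i<n. \<forall>j<n. M $$ (i, j) \<in> {0..<q}}"
    let ?f = "restrict (\<lambda>ij. M $$ ij) ?I"
    have "M = mat n n ?f" using M by (intro eq_matI) auto
    moreover have "?f \<in> ?I \<rightarrow>\<^sub>E {0..<q}" using M by auto
    ultimately show "M \<in> mat n n ` (?I \<rightarrow>\<^sub>E {0..<q})" by blast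
  qed
qed

definition mod_mat :: "int \<Rightarrow> int mat \<Rightarrow> int mat" where
  "mod_mat q = map_mat (\<lambda>x. x mod q)"

lemma mod_mat_mult_left:
  assumes "M \<in> carrier_mat n n" "N \<in> carrier_mat n n"
  shows "mod_mat q (mod_mat q M * N) = mod_mat q (M * N)"
proof (rule eq_matI)
  fix i j assume "i < dim_row (mod_mat q (M * N))" "j < dim_col (mod_mat q (M * N))"
  then have ij: "i < n" "j < n" using assms by (auto simp: mod_mat_def)
  have "[\<Sum>k\<in>{0..<n}. M $$ (i, k) mod q * N $$ (k, j) = \<Sum>k\<in>{0..<n}. M $$ (i, k) * N $$ (k, j)] (mod q)"
    by (intro cong_sum cong_mult) (simp_all add: cong_def)
  then show "mod_mat q (mod_mat q M * N) $$ (i, j) = mod_mat q (M * N) $$ (i, j)"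
    using ij assms by (simp add: mod_mat_def scalar_prod_def cong_def)
qed (auto simp: mod_mat_def)

lemma mod_mat_eq_imp_diff_multiple:
  assumes M: "M \<in> carrier_mat n n" and N: "N \<in> carrier_mat n n" and eq: "mod_mat q M = mod_mat q N"
  obtains B where "B \<in> carrier_mat n n" "M = N + q \<cdot>\<^sub>m B"
proof (rule that)
  define B where "B = mat n n (\<lambda>ij. (M $$ ij - N $$ ij) div q)"
  show "B \<in> carrier_mat n n" by (simp add: B_def)
  show "M = N + q \<cdot>\<^sub>m B"
  proof (rule eq_matI)
    fix i j assume "i < dim_row (N + q \<cdot>\<^sub>m B)" "j < dim_col (N + q \<cdot>\<^sub>m B)"
    then have ij: "i < n" "j < n" by (auto simp: B_def)
    have "mod_mat q M $$ (i, j) = mod_mat q N $$ (i, j)" using eq by simp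
    then have "q dvd M $$ (i, j) - N $$ (i, j)"
      using ij M N by (simp add: mod_mat_def mod_eq_dvd_iff)
    then show "M $$ (i, j) = (N + q \<cdot>\<^sub>m B) $$ (i, j)" using ij N by (simp add: B_def)
  qed (use M in \<open>auto simp: B_def\<close>)
qed

lemma int_mat_idempotent_power_mod:
  fixes A :: "int mat"
  assumes A: "A \<in> carrier_mat n n" and q: "q > 0"
  obtains m B where "m \<ge> s" "B \<in> carrier_mat n n" "A ^\<^sub>m m = A ^\<^sub>m (m + m) + q \<cdot>\<^sub>m B"
proof -
  note pow = pow_carrier_mat[OF A]
  let ?r = "\<lambda>m. mod_mat q (A ^\<^sub>m m)"
  have "range ?r \<subseteq> {M \<in> carrier_mat n n. \<forall>i<n. \<forall>j<n. M $$ (i, j) \<in> {0..<q}}"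
    using q carrier_matD[OF pow] by (auto simp: mod_mat_def)
  then have "finite (range ?r)" using finite_bounded_int_mats finite_subset by blast
  moreover have "?r (Suc m) = mod_mat q (?r m * A)" for m
    using mod_mat_mult_left[OF pow A] by simp
  ultimately obtain a c where c: "c > 0" and periodic: "\<And>m k. m \<ge> a \<Longrightarrow> ?r (m + c * k) = ?r m"
    by (rule recurrent_sequence_eventually_periodic[of ?r "\<lambda>M. mod_mat q (M * A)"]) (rule that)
  define m where "m = c * (a + s)"
  have m: "a + s \<le> m" using c by (simp add: m_def)
  then have "?r m = ?r (m + m)" using periodic[of m "a + s"] by (simp add: m_def[symmetric])
  then obtain B where "B \<in> carrier_mat n n" "A ^\<^sub>m m = A ^\<^sub>m (m + m) + q \<cdot>\<^sub>m B"
    using mod_mat_eq_imp_diff_multiple[OF pow pow] by blast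
  then show ?thesis using m by (intro that[of m B]) auto
qed

lemma int_mat_pow_act_eigenvector:
  fixes v :: "'a :: comm_ring_1 vec"
  assumes A: "A \<in> carrier_mat n n" and v: "v \<in> carrier_vec n" "A *\<^sub>\<int> v = l \<cdot>\<^sub>v v"
  shows "A ^\<^sub>m m *\<^sub>\<int> v = l ^ m \<cdot>\<^sub>v v"
proof (induction m)
  case 0
  show ?case unfolding pow_mat_act_zero[OF A v(1)] by simp
next
  case (Suc m)
  then show ?case
    unfolding pow_mat_act_Suc[OF A v(1)]
    using v by (simp add: int_mat_act_smult[OF A] smult_smult_assoc mult.commute)
qed

text \<open>The quotient is an eigenvalue of \<open>B\<close>.\<close>

lemma eigenvalue_idempotent_power_algebraic_int:
  fixes l :: "'a :: field_char_0"
  assumes A: "A \<in> carrier_mat n n" and l: "eigenvalue (map_mat of_int A) l"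
    and B: "B \<in> carrier_mat n n" "A ^\<^sub>m m = A ^\<^sub>m (m + m) + q \<cdot>\<^sub>m B" and q: "q \<noteq> 0"
  shows "algebraic_int ((l ^ m - l ^ (m + m)) / of_int q)"
proof -
  let ?z = "(l ^ m - l ^ (m + m)) / of_int q"
  obtain v where v: "v \<in> carrier_vec n" "v \<noteq> 0\<^sub>v n" "A *\<^sub>\<int> v = l \<cdot>\<^sub>v v"
    using l A by (auto simp: eigenvalue_def eigenvector_def int_mat_act_def)
  have qB: "l ^ m \<cdot>\<^sub>v v = l ^ (m + m) \<cdot>\<^sub>v v + of_int q \<cdot>\<^sub>v (B *\<^sub>\<int> v)"
    using add_smult_int_mat_act[OF pow_carrier_mat[OF A] B(1) v(1), of "m + m" q]
    by (simp only: B(2)[symmetric] int_mat_pow_act_eigenvector[OF A v(1,3)])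
  have "B *\<^sub>\<int> v = ?z \<cdot>\<^sub>v v"
  proof (rule eq_vecI)
    fix i assume "i < dim_vec (?z \<cdot>\<^sub>v v)"
    then have i: "i < n" using v(1) by simp
    have "(l ^ m \<cdot>\<^sub>v v) $ i = (l ^ (m + m) \<cdot>\<^sub>v v + of_int q \<cdot>\<^sub>v (B *\<^sub>\<int> v)) $ i" using qB by simp
    then have "l ^ m * v $ i = l ^ (m + m) * v $ i + of_int q * (B *\<^sub>\<int> v) $ i"
      using i v(1) int_mat_act_carrier[OF B(1), of v] by simp
    then have "(B *\<^sub>\<int> v) $ i = ?z * v $ i" using q by (simp add: field_simps)
    then show "(B *\<^sub>\<int> v) $ i = (?z \<cdot>\<^sub>v v) $ i" using i v(1) by simp
  qed (use int_mat_act_carrier[OF B(1), of v] v(1) in auto)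
  then have "eigenvalue (map_mat of_int B) ?z"
    using B(1) v(1,2) unfolding eigenvalue_def eigenvector_def int_mat_act_def
    by (intro exI[of _ v]) auto
  then show ?thesis by (rule int_mat_eigenvalue_algebraic_int[OF B(1)])
qed

section \<open>The eigenspace at a prime\<close>

context prime_above_field
begin

text \<open>\<open>zero_nbhd n N\<close> is the lattice $p^N \mathcal{O}_P^n$; these lattices are the neighbourhoods of 0
  in the $P$-adic topology.\<close>

definition zero_nbhd :: "nat \<Rightarrow> int \<Rightarrow> complex vec set" where
  "zero_nbhd n N = {v \<in> carrier_vec n. of_int p powi (- N) \<cdot>\<^sub>v v \<in> vecs_over \<O>\<^sub>P n}"

lemma p_powi_add: "(of_int p :: complex) powi (a + b) = of_int p powi a * of_int p powi b"
  using p_gt_1 by (simp add: power_int_add)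

lemma p_powi_nonneg_mem_local_ring: "N \<ge> 0 \<Longrightarrow> of_int p powi N \<in> \<O>\<^sub>P"
  by (simp add: power_int_def local_ring.power_closed local_ring.of_int_closed)

lemma zero_nbhd_carrier: "v \<in> zero_nbhd n N \<Longrightarrow> v \<in> carrier_vec n"
  by (simp add: zero_nbhd_def)

lemma zero_nbhd_0: "zero_nbhd n 0 = vecs_over \<O>\<^sub>P n"
  by (auto simp: zero_nbhd_def vecs_over_carrier)

lemma vec_submodule_zero_nbhd: "vec_submodule \<O>\<^sub>P n (zero_nbhd n N)"
proof
  show "v + w \<in> zero_nbhd n N" if "v \<in> zero_nbhd n N" "w \<in> zero_nbhd n N" for v w
    using that by (auto simp: zero_nbhd_def smult_add_distrib_vec[of _ n] intro: local_ring.vecs_over.vec_add)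
  show "c \<cdot>\<^sub>v v \<in> zero_nbhd n N" if "c \<in> \<O>\<^sub>P" "v \<in> zero_nbhd n N" for c v
    using that local_ring.vecs_over.vec_smult[OF that(1), of "of_int p powi (- N) \<cdot>\<^sub>v v" n]
    by (simp add: zero_nbhd_def smult_smult_assoc mult.commute)
qed (auto simp: zero_nbhd_def vecs_over_def local_ring.zero_closed)

lemmas zero_nbhd_add = vec_submodule.vec_add[OF vec_submodule_zero_nbhd]
  and zero_nbhd_minus = vec_submodule.vec_minus[OF vec_submodule_zero_nbhd]

lemma smult_mem_zero_nbhd:
  assumes "of_int p powi (- M) * c \<in> \<O>\<^sub>P" "v \<in> zero_nbhd n N"
  shows "c \<cdot>\<^sub>v v \<in> zero_nbhd n (M + N)"
proof -
  have "of_int p powi (- (M + N)) \<cdot>\<^sub>v (c \<cdot>\<^sub>v v) = (of_int p powi (- M) * c) \<cdot>\<^sub>v (of_int p powi (- N) \<cdot>\<^sub>v v)"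
    using p_powi_add[of "- M" "- N"] by (simp add: smult_smult_assoc mult_ac)
  also have "\<dots> \<in> vecs_over \<O>\<^sub>P n"
    using local_ring.vecs_over.vec_smult[OF assms(1)] assms(2) by (simp add: zero_nbhd_def)
  finally show ?thesis using assms(2) by (simp add: zero_nbhd_def)
qed

lemma p_powi_smult_mem_zero_nbhd: "v \<in> zero_nbhd n N \<Longrightarrow> of_int p powi M \<cdot>\<^sub>v v \<in> zero_nbhd n (M + N)"
  using p_gt_1 local_ring.one_closed by (intro smult_mem_zero_nbhd) (simp_all flip: p_powi_add)

lemma zero_nbhd_antimono:
  assumes "M \<le> N" "v \<in> zero_nbhd n N"
  shows "v \<in> zero_nbhd n M"
  using smult_mem_zero_nbhd[of "M - N" 1 v n N] p_powi_nonneg_mem_local_ring[of "N - M"] assms by simp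

lemma int_mat_act_zero_nbhd:
  assumes "M \<in> carrier_mat n n" "v \<in> zero_nbhd n N"
  shows "M *\<^sub>\<int> v \<in> zero_nbhd n N"
proof -
  have "of_int p powi (- N) \<cdot>\<^sub>v (M *\<^sub>\<int> v) = M *\<^sub>\<int> (of_int p powi (- N) \<cdot>\<^sub>v v)"
    by (rule int_mat_act_smult[OF assms(1) zero_nbhd_carrier[OF assms(2)], symmetric])
  also have "\<dots> \<in> vecs_over \<O>\<^sub>P n"
    using assms(2)
    by (intro int_mat_act_over[OF local_ring.unital_subring_axioms assms(1)]) (simp add: zero_nbhd_def)
  finally show ?thesis using int_mat_act_carrier[OF assms(1)] by (simp add: zero_nbhd_def)
qed

lemma vecs_over_F_mem_zero_nbhd:
  assumes "v \<in> vecs_over F n"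
  obtains N where "v \<in> zero_nbhd n N"
proof -
  have "\<forall>\<^sub>F k in sequentially. \<forall>i\<in>{..<n}. of_int p ^ k * v $ i \<in> \<O>\<^sub>P"
    using assms by (intro eventually_ball_finite ballI eventually_p_power_mult_mem_local_ring)
      (auto simp: vecs_over_def)
  then obtain k where "\<forall>i\<in>{..<n}. of_int p ^ k * v $ i \<in> \<O>\<^sub>P"
    using eventually_happens' sequentially_bot by blast
  then have "v \<in> zero_nbhd n (- int k)" using assms by (auto simp: zero_nbhd_def vecs_over_def)
  then show ?thesis by (rule that)
qed

lemma mats_over_F_continuous:
  assumes "T \<in> mats_over F n"
  obtains d where "\<And>N v. v \<in> zero_nbhd n (N + d) \<Longrightarrow> T *\<^sub>v v \<in> zero_nbhd n N"
proof -
  have "\<forall>\<^sub>F k in sequentially. \<forall>i\<in>{..<n}. \<forall>j\<in>{..<n}. of_int p ^ k * T $$ (i, j) \<in> \<O>\<^sub>P"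
    using assms by (intro eventually_ball_finite ballI eventually_p_power_mult_mem_local_ring)
      (auto simp: mats_over_def)
  then obtain k where "\<forall>i\<in>{..<n}. \<forall>j\<in>{..<n}. of_int p ^ k * T $$ (i, j) \<in> \<O>\<^sub>P"
    using eventually_happens' sequentially_bot by blast
  then have T: "of_int p ^ k \<cdot>\<^sub>m T \<in> mats_over \<O>\<^sub>P n" using assms by (auto simp: mats_over_def)
  have "T *\<^sub>v v \<in> zero_nbhd n N" if v: "v \<in> zero_nbhd n (N + int k)" for N v
  proof -
    have T': "T \<in> carrier_mat n n" and v': "v \<in> carrier_vec n"
      using assms v by (auto simp: mats_over_carrier zero_nbhd_carrier)
    let ?w = "of_int p powi (- (N + int k)) \<cdot>\<^sub>v v"
    have "of_int p powi (- N) \<cdot>\<^sub>v (T *\<^sub>v v) = (of_int p ^ k \<cdot>\<^sub>m T) *\<^sub>v ?w"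
      using T' v' p_powi_add[of "int k" "- (N + int k)"]
      by (intro eq_vecI) (auto simp: scalar_prod_def sum_distrib_left mult_ac)
    also have "\<dots> \<in> vecs_over \<O>\<^sub>P n"
      using v by (intro local_ring.mult_mat_vec_over[OF T]) (simp add: zero_nbhd_def)
    finally show ?thesis using T' v' by (simp add: zero_nbhd_def)
  qed
  then show ?thesis by (rule that)
qed

lemma zero_if_mem_all_zero_nbhds:
  assumes "\<And>N. v \<in> zero_nbhd n N"
  shows "v = 0\<^sub>v n"
proof (rule eq_vecI)
  fix i assume "i < dim_vec (0\<^sub>v n :: complex vec)"
  then have i: "i < n" by simp
  have "v $ i / of_int p ^ k \<in> \<O>\<^sub>P" for k
    using assms[of "int k"] i
    by (auto simp: zero_nbhd_def vecs_over_def power_int_minus divide_inverse mult.commute)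
  then have "v $ i = 0" by (rule zero_if_divisible_by_p_powers)
  then show "v $ i = 0\<^sub>v n $ i" using i by simp
qed (use assms[of 0] zero_nbhd_carrier in auto)

end

locale eigenspace_above = prime_above_field +
  fixes A :: "int mat" and n :: nat
  assumes A: "A \<in> carrier_mat n n"
    and eigenvalues_F: "{l. eigenvalue (map_mat complex_of_int A) l} \<subseteq> F"
begin

abbreviation A\<^sub>C :: "complex mat" where
  "A\<^sub>C \<equiv> map_mat of_int A"

lemma A\<^sub>C: "A\<^sub>C \<in> carrier_mat n n"
  using A by simp

lemma A\<^sub>C_over_F: "A\<^sub>C \<in> mats_over F n"
  by (rule map_mat_of_int_over[OF F.unital_subring_axioms A])

lemma pow_A: "A ^\<^sub>m m \<in> carrier_mat n n"
  using A by simp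

lemma A\<^sub>C_mult_vec: "A\<^sub>C *\<^sub>v v = A *\<^sub>\<int> v"
  by (simp add: int_mat_act_def)

lemma root_space_pow_A_closed:
  assumes "v \<in> root_space A\<^sub>C L"
  shows "A ^\<^sub>m m *\<^sub>\<int> v \<in> root_space A\<^sub>C L"
proof (induction m)
  case 0
  show ?case using assms pow_mat_act_zero[OF A root_space_carrier[OF A\<^sub>C assms]] by (simp only:)
next
  case (Suc m)
  then show ?case
    using root_space_commuting_closed[OF A\<^sub>C A\<^sub>C refl Suc]
      pow_mat_act_Suc[OF A root_space_carrier[OF A\<^sub>C assms], of m]
    by (simp only: A\<^sub>C_mult_vec)
qed

lemma eigenvalue_mem_algebraic_ints: "eigenvalue A\<^sub>C l \<Longrightarrow> l \<in> \<O>"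
  using eigenvalues_F int_mat_eigenvalue_algebraic_int[OF A] by auto

definition P_eigenspace :: "complex vec set" where
  "P_eigenspace = {v \<in> vecs_over F n. \<exists>L. set L \<subseteq> {l \<in> P. eigenvalue A\<^sub>C l} \<and> v \<in> root_space A\<^sub>C L}"

lemma P_eigenspace_over_F: "v \<in> P_eigenspace \<Longrightarrow> v \<in> vecs_over F n"
  by (simp add: P_eigenspace_def)

lemma vec_submodule_P_eigenspace: "vec_submodule F n P_eigenspace"
proof
  show "0\<^sub>v n \<in> P_eigenspace"
    unfolding P_eigenspace_def
    using F.vecs_over.vec_zero A by (intro CollectI conjI exI[of _ "[]"]) auto
  show "v \<in> carrier_vec n" if "v \<in> P_eigenspace" for v
    using that P_eigenspace_over_F vecs_over_carrier by blast
  show "c \<cdot>\<^sub>v v \<in> P_eigenspace" if "c \<in> F" "v \<in> P_eigenspace" for c v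
    using that F.vecs_over.vec_smult root_space_smult[OF A\<^sub>C] unfolding P_eigenspace_def by blast
  fix v w assume "v \<in> P_eigenspace" "w \<in> P_eigenspace"
  then obtain L M where vw: "v \<in> vecs_over F n" "w \<in> vecs_over F n"
    "v \<in> root_space A\<^sub>C L" "w \<in> root_space A\<^sub>C M"
    and LM: "set (L @ M) \<subseteq> {l \<in> P. eigenvalue A\<^sub>C l}"
    unfolding P_eigenspace_def by auto
  have "v + w \<in> root_space A\<^sub>C (L @ M)"
    using root_space_append_left[OF A\<^sub>C vw(3)] root_space_append_right[OF A\<^sub>C vw(4)]
    by (rule vec_submodule.vec_add[OF vec_submodule_root_space[OF A\<^sub>C]])
  then show "v + w \<in> P_eigenspace"
    unfolding P_eigenspace_def using LM F.vecs_over.vec_add[OF vw(1,2)] by blast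
qed

lemma module_vec_over_F:
  "module ((class_ring :: complex ring)\<lparr>carrier := F\<rparr>) (module_vec TYPE(complex) n)"
proof -
  have "cring ((class_ring :: complex ring)\<lparr>carrier := F\<rparr>)"
    by (rule cring_class_ring_restrict[OF F.unital_subring_axioms])
  moreover have "abelian_group (module_vec TYPE(complex) n)"
    by (rule module.axioms(2)[OF vec_module])
  ultimately show ?thesis
    by (intro module.intro module_axioms.intro)
       (auto simp: module_vec_simps add_smult_distrib_vec smult_add_distrib_vec smult_smult_assoc)
qed

lemma submodule_if_vec_submodule:
  "vec_submodule F n H \<Longrightarrow>
    submodule ((class_ring :: complex ring)\<lparr>carrier := F\<rparr>) H (module_vec TYPE(complex) n)"
  using module_vec_over_F vec_submodule.vec_carrier vec_submodule.vec_zero vec_submodule.vec_add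
    vec_submodule.vec_smult
  by (intro submodule.intro) (auto simp: module_vec_simps)

lemma vec_submodule_if_submodule:
  assumes "submodule ((class_ring :: complex ring)\<lparr>carrier := F\<rparr>) H (module_vec TYPE(complex) n)"
  shows "vec_submodule F n H"
  using submodule.subset[OF assms] submodule.zero_closed[OF assms] submodule.m_closed[OF assms]
    submodule.smult_closed[OF assms]
  by unfold_locales (auto simp: module_vec_simps)

lemma generalized_eigenvector_iff:
  "generalized_eigenvector A\<^sub>C v l \<longleftrightarrow> v \<noteq> 0\<^sub>v n \<and> (\<exists>m. v \<in> root_space A\<^sub>C (replicate m l))"
  using A root_space_replicate_iff[OF A\<^sub>C] by (auto simp: generalized_eigenvector_def)

definition P_eigenvectors :: "complex vec set" where
  "P_eigenvectors = {v. set\<^sub>v v \<subseteq> F \<and> (\<exists>l\<in>P. eigenvalue A\<^sub>C l \<and> generalized_eigenvector A\<^sub>C v l)}"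

lemma vecs_over_F_iff: "v \<in> vecs_over F n \<longleftrightarrow> v \<in> carrier_vec n \<and> set\<^sub>v v \<subseteq> F"
  by (auto simp: vecs_over_def vec_set_def)

lemma P_eigenvectors_subset_P_eigenspace: "P_eigenvectors \<subseteq> P_eigenspace"
proof
  fix v assume "v \<in> P_eigenvectors"
  then obtain l m where lm: "l \<in> P" "eigenvalue A\<^sub>C l" "v \<in> root_space A\<^sub>C (replicate m l)" "set\<^sub>v v \<subseteq> F"
    by (auto simp: P_eigenvectors_def generalized_eigenvector_iff)
  then show "v \<in> P_eigenspace"
    unfolding P_eigenspace_def vecs_over_F_iff using root_space_carrier[OF A\<^sub>C lm(3)]
    by (intro CollectI conjI exI[of _ "replicate m l"]) auto
qed

lemma P_eigenspace_subset_if_P_eigenvectors_subset: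
  assumes H: "vec_submodule F n H" and "P_eigenvectors \<subseteq> H"
  shows "P_eigenspace \<subseteq> H"
proof
  fix v assume "v \<in> P_eigenspace"
  then obtain L where L: "set L \<subseteq> {l \<in> P. eigenvalue A\<^sub>C l}" "v \<in> root_space A\<^sub>C L \<inter> vecs_over F n"
    unfolding P_eigenspace_def by auto
  have "v \<in> H" if "l \<in> set L" "v \<in> root_space A\<^sub>C (replicate m l) \<inter> vecs_over F n" for l m v
  proof (cases "v = 0\<^sub>v n")
    case True
    then show ?thesis using vec_submodule.vec_zero[OF H] by simp
  next
    case False
    then have "v \<in> P_eigenvectors"
      using that L(1) vecs_over_F_iff generalized_eigenvector_iff by (auto simp: P_eigenvectors_def)
    then show ?thesis using assms(2) by blast
  qed
  then show "v \<in> H"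
    using L eigenvalues_F
    by (intro F.root_space_mem_if_generalized_eigenvectors_mem[OF A\<^sub>C_over_F H _ _ L(2)]) auto
qed

lemma eigenspace_at_eq_P_eigenspace: "eigenspace_at F A P = P_eigenspace"
proof -
  interpret M: module "(class_ring :: complex ring)\<lparr>carrier := F\<rparr>" "module_vec TYPE(complex) n"
    by (rule module_vec_over_F)
  have carrier: "P_eigenvectors \<subseteq> carrier (module_vec TYPE(complex) n)"
    using P_eigenvectors_subset_P_eigenspace P_eigenspace_over_F vecs_over_carrier
    by (fastforce simp: module_vec_simps)
  have "M.span P_eigenvectors \<subseteq> P_eigenspace"
    using submodule_if_vec_submodule[OF vec_submodule_P_eigenspace] P_eigenvectors_subset_P_eigenspace
    by (intro M.span_is_subset)
  moreover have "vec_submodule F n (M.span P_eigenvectors)"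
    by (intro vec_submodule_if_submodule M.span_is_submodule carrier)
  then have "P_eigenspace \<subseteq> M.span P_eigenvectors"
    using M.in_own_span[OF carrier] by (rule P_eigenspace_subset_if_P_eigenvectors_subset)
  ultimately show ?thesis using A by (simp add: eigenspace_at_def P_eigenvectors_def)
qed

lemma unit_root_space_pow_A_zero_nbhd:
  assumes y: "y \<in> root_space A\<^sub>C L" and L: "set L \<subseteq> \<O> - P" and m: "A ^\<^sub>m m *\<^sub>\<int> y \<in> zero_nbhd n N"
  shows "y \<in> zero_nbhd n N"
proof -
  let ?w = "of_int p powi (- N) \<cdot>\<^sub>v y"
  have y': "y \<in> carrier_vec n" using root_space_carrier[OF A\<^sub>C y] .
  have w: "?w \<in> root_space A\<^sub>C L" using y by (rule root_space_smult[OF A\<^sub>C])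
  have units: "l \<noteq> 0 \<and> l \<in> \<O>\<^sub>P \<and> inverse l \<in> \<O>\<^sub>P" if "l \<in> set L" for l
    using that L of_int_mem_P_iff[of 0] algebraic_ints_subset_local_ring
      divide_mem_local_ring[OF \<O>.one_closed, of l]
    by (auto simp: inverse_eq_divide)
  have "A ^\<^sub>m m *\<^sub>\<int> ?w \<in> vecs_over \<O>\<^sub>P n"
    using m int_mat_act_smult[OF pow_A y'] by (simp add: zero_nbhd_def)
  then have "?w \<in> vecs_over \<O>\<^sub>P n"
  proof (induction m)
    case 0
    then show ?case using y' by (simp only: pow_mat_act_zero[OF A] smult_carrier_vec)
  next
    case (Suc m)
    have "A\<^sub>C *\<^sub>v (A ^\<^sub>m m *\<^sub>\<int> ?w) \<in> vecs_over \<O>\<^sub>P n"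
      using Suc.prems pow_mat_act_Suc[OF A, of ?w m] y' by (simp only: A\<^sub>C_mult_vec smult_carrier_vec)
    then have "A ^\<^sub>m m *\<^sub>\<int> ?w \<in> vecs_over \<O>\<^sub>P n"
      using root_space_unit_eigenvalues_over[OF local_ring.unital_subring_axioms
          map_mat_of_int_over[OF local_ring.unital_subring_axioms A] units root_space_pow_A_closed[OF w]]
      by blast
    then show ?case by (rule Suc.IH)
  qed
  then show ?thesis using y' by (simp add: zero_nbhd_def)
qed

text \<open>If \<open>A\<^sup>m\<close> is idempotent modulo \<open>p\<close>, then $l^m (1 - l^m) / p$ is an algebraic integer, and
  $1 - l^m$ is a unit at \<open>P\<close>.\<close>

lemma eigenvalue_power_divisible_by_p:
  assumes "l \<in> P" "eigenvalue A\<^sub>C l"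
  obtains m where "l ^ m / of_int p \<in> \<O>\<^sub>P"
proof -
  obtain m B where m: "m \<ge> 1" and B: "B \<in> carrier_mat n n" "A ^\<^sub>m m = A ^\<^sub>m (m + m) + p \<cdot>\<^sub>m B"
    using int_mat_idempotent_power_mod[OF A, of p 1] p_gt_1 by auto
  have l: "l \<in> \<O>" using P_subset_\<O> assms(1) by blast
  define z where "z = (l ^ m - l ^ (m + m)) / of_int p"
  have "algebraic_int z"
    unfolding z_def using p_gt_1 by (intro eigenvalue_idempotent_power_algebraic_int[OF A assms(2) B]) simp
  moreover have "z \<in> F"
    unfolding z_def divide_inverse using l
    by (intro F.mult_closed F.inverse_closed F.diff_closed F.power_closed F.of_int_closed) auto
  ultimately have z: "z \<in> \<O>" by simp
  have lm: "l ^ m \<in> P" using m P_mult[OF assms(1) \<O>.power_closed[OF l, of "m - 1"]]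
    by (simp add: power_eq_if)
  have unit: "1 - l ^ m \<in> \<O>" "1 - l ^ m \<notin> P"
    using \<O>.diff_closed[OF \<O>.one_closed \<O>.power_closed[OF l]] P_add[of "1 - l ^ m" "l ^ m"] lm one_notin_P
    by auto
  moreover have "1 - l ^ m \<noteq> 0" using lm one_notin_P by auto
  then have "l ^ m / of_int p = z / (1 - l ^ m)"
    using p_gt_1 by (simp add: z_def field_simps power_add)
  ultimately show ?thesis using divide_mem_local_ring[OF z unit] that[of m] by simp
qed

lemma pow_A_eigen_recursion:
  assumes H: "vec_submodule \<O>\<^sub>P n H" and l: "l \<in> \<O>\<^sub>P" and v: "v \<in> carrier_vec n"
    and u: "\<And>j. A ^\<^sub>m (m + j) *\<^sub>\<int> (char_matrix A\<^sub>C l *\<^sub>v v) \<in> H"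
  shows "A ^\<^sub>m (m + i) *\<^sub>\<int> v - l ^ i \<cdot>\<^sub>v (A ^\<^sub>m m *\<^sub>\<int> v) \<in> H"
proof (induction i)
  case 0
  have "A ^\<^sub>m (m + 0) *\<^sub>\<int> v - l ^ 0 \<cdot>\<^sub>v (A ^\<^sub>m m *\<^sub>\<int> v) = 0\<^sub>v n"
    using int_mat_act_carrier[OF pow_A, of m v] by auto
  then show ?case using vec_submodule.vec_zero[OF H] by simp
next
  case (Suc i)
  let ?u = "char_matrix A\<^sub>C l *\<^sub>v v"
  note carrier = int_mat_act_carrier[OF pow_A, of _ v]
  have "A ^\<^sub>m (m + i) *\<^sub>\<int> ?u = A ^\<^sub>m (m + i) *\<^sub>\<int> (A *\<^sub>\<int> v) - l \<cdot>\<^sub>v (A ^\<^sub>m (m + i) *\<^sub>\<int> v)"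
    using char_matrix_mult_vec[OF A\<^sub>C v, of l] v int_mat_act_smult[OF pow_A v]
      int_mat_act_minus[OF pow_A int_mat_act_carrier[OF A, of v], of "l \<cdot>\<^sub>v v"]
    by (simp add: A\<^sub>C_mult_vec)
  then have "A ^\<^sub>m Suc (m + i) *\<^sub>\<int> v = l \<cdot>\<^sub>v (A ^\<^sub>m (m + i) *\<^sub>\<int> v) + A ^\<^sub>m (m + i) *\<^sub>\<int> ?u"
    unfolding pow_mat_act_Suc2[OF A v]
    using carrier[of "m + i"] int_mat_act_carrier[OF pow_A, of "m + i" "A *\<^sub>\<int> v"]
    by (intro eq_vecI) auto
  then have "A ^\<^sub>m (m + Suc i) *\<^sub>\<int> v - l ^ Suc i \<cdot>\<^sub>v (A ^\<^sub>m m *\<^sub>\<int> v) =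
      l \<cdot>\<^sub>v (A ^\<^sub>m (m + i) *\<^sub>\<int> v - l ^ i \<cdot>\<^sub>v (A ^\<^sub>m m *\<^sub>\<int> v)) + A ^\<^sub>m (m + i) *\<^sub>\<int> ?u"
    using carrier[of m] carrier[of "m + i"] int_mat_act_carrier[OF pow_A, of "m + i" ?u]
    by (intro eq_vecI) (auto simp: algebra_simps)
  then show ?case
    using vec_submodule.vec_add[OF H vec_submodule.vec_smult[OF H l Suc.IH] u[of i]] by simp
qed

lemma root_space_Cons_contracting:
  assumes l: "l \<in> P" "eigenvalue A\<^sub>C l" and v: "v \<in> vecs_over F n"
    and u: "\<And>N. \<forall>\<^sub>F m in sequentially. A ^\<^sub>m m *\<^sub>\<int> (char_matrix A\<^sub>C l *\<^sub>v v) \<in> zero_nbhd n N"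
  shows "\<forall>\<^sub>F m in sequentially. A ^\<^sub>m m *\<^sub>\<int> v \<in> zero_nbhd n N"
proof -
  obtain a where a: "l ^ a / of_int p \<in> \<O>\<^sub>P" using eigenvalue_power_divisible_by_p[OF l] .
  have lO: "l \<in> \<O>\<^sub>P" using l(1) P_subset_\<O> algebraic_ints_subset_local_ring by blast
  obtain N0 where N0: "v \<in> zero_nbhd n N0" using vecs_over_F_mem_zero_nbhd[OF v] .
  have "\<forall>\<^sub>F m in sequentially. A ^\<^sub>m m *\<^sub>\<int> v \<in> zero_nbhd n (N0 + int k)" for k
  proof (induction k)
    case 0
    show ?case using int_mat_act_zero_nbhd[OF pow_A N0] by simp
  next
    case (Suc k)
    let ?N = "N0 + int k"
    obtain m0 where m0: "A ^\<^sub>m m *\<^sub>\<int> v \<in> zero_nbhd n ?N"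
      "A ^\<^sub>m m *\<^sub>\<int> (char_matrix A\<^sub>C l *\<^sub>v v) \<in> zero_nbhd n (1 + ?N)" if "m \<ge> m0" for m
      using eventually_conj[OF Suc u[of "1 + ?N"]] unfolding eventually_sequentially by blast
    have shifted: "A ^\<^sub>m (m + a) *\<^sub>\<int> v \<in> zero_nbhd n (1 + ?N)" if m: "m \<ge> m0" for m
    proof -
      have "l ^ a \<cdot>\<^sub>v (A ^\<^sub>m m *\<^sub>\<int> v) \<in> zero_nbhd n (1 + ?N)"
        using a m0(1)[OF m] by (intro smult_mem_zero_nbhd)
          (simp_all add: power_int_minus divide_inverse mult.commute)
      moreover have "A ^\<^sub>m (m + a) *\<^sub>\<int> v - l ^ a \<cdot>\<^sub>v (A ^\<^sub>m m *\<^sub>\<int> v) \<in> zero_nbhd n (1 + ?N)"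
        using m m0(2) vecs_over_carrier[OF v]
        by (intro pow_A_eigen_recursion[OF vec_submodule_zero_nbhd lO]) auto
      ultimately have "l ^ a \<cdot>\<^sub>v (A ^\<^sub>m m *\<^sub>\<int> v) + (A ^\<^sub>m (m + a) *\<^sub>\<int> v - l ^ a \<cdot>\<^sub>v (A ^\<^sub>m m *\<^sub>\<int> v))
          \<in> zero_nbhd n (1 + ?N)"
        by (rule zero_nbhd_add)
      moreover have "l ^ a \<cdot>\<^sub>v (A ^\<^sub>m m *\<^sub>\<int> v) + (A ^\<^sub>m (m + a) *\<^sub>\<int> v - l ^ a \<cdot>\<^sub>v (A ^\<^sub>m m *\<^sub>\<int> v)) =
          A ^\<^sub>m (m + a) *\<^sub>\<int> v"
        using int_mat_act_carrier[OF pow_A, of m v] int_mat_act_carrier[OF pow_A, of "m + a" v] by auto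
      ultimately show ?thesis by simp
    qed
    have "A ^\<^sub>m m *\<^sub>\<int> v \<in> zero_nbhd n (N0 + int (Suc k))" if "m \<ge> m0 + a" for m
      using shifted[of "m - a"] that by (simp add: add_ac)
    then show ?case by (rule eventually_sequentiallyI)
  qed
  from this[of "nat (N - N0)"] show ?thesis
    by (rule eventually_mono) (auto elim!: zero_nbhd_antimono[rotated])
qed

lemma root_space_contracting:
  assumes "set L \<subseteq> {l \<in> P. eigenvalue A\<^sub>C l}" "v \<in> root_space A\<^sub>C L \<inter> vecs_over F n"
  shows "\<forall>\<^sub>F m in sequentially. A ^\<^sub>m m *\<^sub>\<int> v \<in> zero_nbhd n N"
  using assms
proof (induction L arbitrary: v N)
  case Nil
  then have "v = 0\<^sub>v n" using A by simp
  then show ?case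
    by (simp add: int_mat_act_zero[OF pow_A] vec_submodule.vec_zero[OF vec_submodule_zero_nbhd])
next
  case (Cons l L)
  have "l \<in> F" using Cons.prems(1) eigenvalues_F by auto
  then have "char_matrix A\<^sub>C l *\<^sub>v v \<in> root_space A\<^sub>C L \<inter> vecs_over F n"
    using Cons.prems(2) F.char_matrix_mult_vec_over[OF A\<^sub>C_over_F] by auto
  then have "\<forall>\<^sub>F m in sequentially. A ^\<^sub>m m *\<^sub>\<int> (char_matrix A\<^sub>C l *\<^sub>v v) \<in> zero_nbhd n M" for M
    using Cons.IH Cons.prems(1) by simp
  then show ?case using Cons.prems by (intro root_space_Cons_contracting) auto
qed

lemma vecs_over_F_decomposition:
  assumes "w \<in> vecs_over F n"
  obtains x y L where "x \<in> P_eigenspace"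
    "y \<in> vecs_over F n" "y \<in> root_space A\<^sub>C L" "set L \<subseteq> \<O> - P" "w = x + y"
proof -
  obtain L where L: "set L \<subseteq> {l. eigenvalue A\<^sub>C l}" "carrier_vec n \<subseteq> root_space A\<^sub>C L"
    using complex_mat_root_space_eigenvalues[OF A\<^sub>C] .
  obtain x y where "x \<in> root_space A\<^sub>C (filter (\<lambda>l. l \<in> P) L) \<inter> vecs_over F n"
    "y \<in> root_space A\<^sub>C (filter (\<lambda>l. l \<notin> P) L) \<inter> vecs_over F n" "w = x + y"
    using F.primary_decomposition[OF A\<^sub>C_over_F, of L w P] L eigenvalues_F assms vecs_over_carrier[OF assms]
    by blast
  moreover from this have "x \<in> P_eigenspace"
    unfolding P_eigenspace_def using L(1)
    by (intro CollectI conjI exI[of _ "filter (\<lambda>l. l \<in> P) L"]) auto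
  moreover have "set (filter (\<lambda>l. l \<notin> P) L) \<subseteq> \<O> - P"
    using L(1) eigenvalue_mem_algebraic_ints by auto
  ultimately show ?thesis by (intro that) auto
qed

lemma P_eigenspace_iff_contracting:
  "v \<in> P_eigenspace \<longleftrightarrow> v \<in> vecs_over F n \<and> (\<forall>N. \<forall>\<^sub>F m in sequentially. A ^\<^sub>m m *\<^sub>\<int> v \<in> zero_nbhd n N)"
proof
  show "v \<in> vecs_over F n \<and> (\<forall>N. \<forall>\<^sub>F m in sequentially. A ^\<^sub>m m *\<^sub>\<int> v \<in> zero_nbhd n N)"
    if "v \<in> P_eigenspace"
    using that root_space_contracting unfolding P_eigenspace_def by blast
next
  assume v: "v \<in> vecs_over F n \<and> (\<forall>N. \<forall>\<^sub>F m in sequentially. A ^\<^sub>m m *\<^sub>\<int> v \<in> zero_nbhd n N)"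
  then obtain x y L where x: "x \<in> P_eigenspace"
    and y: "y \<in> vecs_over F n" "y \<in> root_space A\<^sub>C L" "set L \<subseteq> \<O> - P" and sum: "v = x + y"
    using vecs_over_F_decomposition by blast
  have carrier: "x \<in> carrier_vec n" "y \<in> carrier_vec n"
    using P_eigenspace_over_F[OF x] y(1) vecs_over_carrier by auto
  have "y \<in> zero_nbhd n N" for N
  proof -
    have "\<forall>\<^sub>F m in sequentially. A ^\<^sub>m m *\<^sub>\<int> x \<in> zero_nbhd n N"
      using x root_space_contracting unfolding P_eigenspace_def by blast
    moreover have "\<forall>\<^sub>F m in sequentially. A ^\<^sub>m m *\<^sub>\<int> v \<in> zero_nbhd n N" using v by blast
    ultimately have "\<forall>\<^sub>F m in sequentially. A ^\<^sub>m m *\<^sub>\<int> y \<in> zero_nbhd n N"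
    proof eventually_elim
      case (elim m)
      have "A ^\<^sub>m m *\<^sub>\<int> v - A ^\<^sub>m m *\<^sub>\<int> x = A ^\<^sub>m m *\<^sub>\<int> y"
        unfolding sum int_mat_act_add[OF pow_A carrier]
        using int_mat_act_carrier[OF pow_A, of m x] int_mat_act_carrier[OF pow_A, of m y] by auto
      then show ?case using zero_nbhd_minus[OF elim(2,1)] by simp
    qed
    then obtain m where "A ^\<^sub>m m *\<^sub>\<int> y \<in> zero_nbhd n N"
      using eventually_happens' sequentially_bot by blast
    then show ?thesis by (rule unit_root_space_pow_A_zero_nbhd[OF y(2,3)])
  qed
  then have "y = 0\<^sub>v n" by (rule zero_if_mem_all_zero_nbhds)
  then show "v \<in> P_eigenspace" using x sum carrier(1) by simp
qed

lemma P_eigenspace_stable: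
  assumes T: "T \<in> mats_over F n"
    and intertwining: "\<And>k. \<exists>l. \<exists>M\<in>carrier_mat n n.
      map_mat of_int (A ^\<^sub>m l) * T = map_mat of_int M * map_mat of_int (A ^\<^sub>m k)"
    and v: "v \<in> P_eigenspace"
  shows "T *\<^sub>v v \<in> P_eigenspace"
  unfolding P_eigenspace_iff_contracting
proof (intro conjI allI)
  have vF: "v \<in> vecs_over F n" using v by (rule P_eigenspace_over_F)
  note v' = vecs_over_carrier[OF vF] and T' = mats_over_carrier[OF T]
  show "T *\<^sub>v v \<in> vecs_over F n" using T vF by (rule F.mult_mat_vec_over)
  fix N
  obtain k where k: "A ^\<^sub>m k *\<^sub>\<int> v \<in> zero_nbhd n N"
    using v eventually_happens'[OF sequentially_bot] unfolding P_eigenspace_iff_contracting by blast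
  obtain l M where M: "M \<in> carrier_mat n n"
    "map_mat of_int (A ^\<^sub>m l) * T = map_mat of_int M * map_mat of_int (A ^\<^sub>m k)"
    using intertwining by blast
  have "A ^\<^sub>m l *\<^sub>\<int> (T *\<^sub>v v) = M *\<^sub>\<int> A ^\<^sub>m k *\<^sub>\<int> v"
    using M(1) pow_A T' v' assoc_mult_mat_vec[of "map_mat of_int (A ^\<^sub>m l)" n n T n v]
      assoc_mult_mat_vec[of "map_mat of_int M" n n "map_mat of_int (A ^\<^sub>m k)" n v] M(2)
    by (simp add: int_mat_act_def)
  then have l: "A ^\<^sub>m l *\<^sub>\<int> (T *\<^sub>v v) \<in> zero_nbhd n N" using int_mat_act_zero_nbhd[OF M(1) k] by simp
  have "A ^\<^sub>m m *\<^sub>\<int> (T *\<^sub>v v) \<in> zero_nbhd n N" if "m \<ge> l" for m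
    using int_mat_act_zero_nbhd[OF pow_A l, of "m - l"] that
      pow_mat_act_add[OF A mult_mat_vec_carrier[OF T' v'], of "m - l" l] by simp
  then show "\<forall>\<^sub>F m in sequentially. A ^\<^sub>m m *\<^sub>\<int> (T *\<^sub>v v) \<in> zero_nbhd n N"
    by (rule eventually_sequentiallyI)
qed

lemma unit_root_space_idempotent_power_close:
  assumes y: "y \<in> root_space A\<^sub>C L" "set L \<subseteq> \<O> - P" "y \<in> zero_nbhd n N"
    and B: "B \<in> carrier_mat n n" "A ^\<^sub>m m = A ^\<^sub>m (m + m) + p ^ K \<cdot>\<^sub>m B"
  shows "y - A ^\<^sub>m m *\<^sub>\<int> y \<in> zero_nbhd n (int K + N)"
proof (rule unit_root_space_pow_A_zero_nbhd[OF _ y(2)])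
  have y': "y \<in> carrier_vec n" using root_space_carrier[OF A\<^sub>C y(1)] .
  show "y - A ^\<^sub>m m *\<^sub>\<int> y \<in> root_space A\<^sub>C L"
    using y(1) root_space_pow_A_closed[OF y(1)] by (rule root_space_minus[OF A\<^sub>C])
  have "A ^\<^sub>m m *\<^sub>\<int> y = A ^\<^sub>m (m + m) *\<^sub>\<int> y + of_int (p ^ K) \<cdot>\<^sub>v (B *\<^sub>\<int> y)"
    using add_smult_int_mat_act[OF pow_A B(1) y', of "m + m" "p ^ K"] by (simp only: B(2)[symmetric])
  then have "A ^\<^sub>m m *\<^sub>\<int> (y - A ^\<^sub>m m *\<^sub>\<int> y) = of_int p powi int K \<cdot>\<^sub>v (B *\<^sub>\<int> y)"
    unfolding int_mat_act_minus[OF pow_A y' int_mat_act_carrier[OF pow_A]] pow_mat_act_add[OF A y', symmetric]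
    using int_mat_act_carrier[OF pow_A, of "m + m" y] int_mat_act_carrier[OF B(1), of y]
    by auto
  then show "A ^\<^sub>m m *\<^sub>\<int> (y - A ^\<^sub>m m *\<^sub>\<int> y) \<in> zero_nbhd n (int K + N)"
    using p_powi_smult_mem_zero_nbhd[OF int_mat_act_zero_nbhd[OF B(1) y(3)], of "int K"] by simp
qed

text \<open>Modulo a high power of \<open>p\<close>, an idempotent power \<open>A\<^sup>m\<close> is the projection with kernel the eigenspace
  at \<open>P\<close>; so stability of the latter under \<open>T\<close> makes \<open>A\<^sup>m T (1 - A\<^sup>m)\<close> small.\<close>

lemma P_eigenspace_stable_imp_close:
  assumes T: "T \<in> mats_over F n" and stable: "\<And>v. v \<in> P_eigenspace \<Longrightarrow> T *\<^sub>v v \<in> P_eigenspace"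
    and g: "g \<in> vecs_over F n"
  obtains m where "m \<ge> s" "A ^\<^sub>m m *\<^sub>\<int> (T *\<^sub>v (g - A ^\<^sub>m m *\<^sub>\<int> g)) \<in> vecs_over \<O>\<^sub>P n"
proof -
  obtain x y L where x: "x \<in> P_eigenspace"
    and y: "y \<in> vecs_over F n" "y \<in> root_space A\<^sub>C L" "set L \<subseteq> \<O> - P" and sum: "g = x + y"
    using vecs_over_F_decomposition[OF g] .
  obtain N where N: "y \<in> zero_nbhd n N" using vecs_over_F_mem_zero_nbhd[OF y(1)] .
  obtain d where d: "\<And>N v. v \<in> zero_nbhd n (N + d) \<Longrightarrow> T *\<^sub>v v \<in> zero_nbhd n N"
    using mats_over_F_continuous[OF T] by blast
  define K where "K = nat (d - N)"
  have "\<forall>\<^sub>F m in sequentially. A ^\<^sub>m m *\<^sub>\<int> (T *\<^sub>v x) \<in> zero_nbhd n 0 \<and> A ^\<^sub>m m *\<^sub>\<int> x \<in> zero_nbhd n (0 + d)"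
    using x stable[OF x] unfolding P_eigenspace_iff_contracting by (simp add: eventually_conj_iff)
  then obtain m0 where m0: "A ^\<^sub>m m *\<^sub>\<int> (T *\<^sub>v x) \<in> zero_nbhd n 0" "A ^\<^sub>m m *\<^sub>\<int> x \<in> zero_nbhd n (0 + d)"
    if "m \<ge> m0" for m
    unfolding eventually_sequentially by blast
  obtain m B where m: "m \<ge> max s m0" and B: "B \<in> carrier_mat n n" "A ^\<^sub>m m = A ^\<^sub>m (m + m) + p ^ K \<cdot>\<^sub>m B"
    using int_mat_idempotent_power_mod[OF A, of "p ^ K" "max s m0"] p_gt_1 by auto
  let ?u = "y - A ^\<^sub>m m *\<^sub>\<int> y"
  have "?u \<in> zero_nbhd n (int K + N)" using y(2,3) N B by (rule unit_root_space_idempotent_power_close)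
  then have u: "?u \<in> zero_nbhd n (0 + d)" by (rule zero_nbhd_antimono[rotated]) (simp add: K_def)
  have xy: "x \<in> carrier_vec n" "y \<in> carrier_vec n"
    using P_eigenspace_over_F[OF x] y(1) vecs_over_carrier by auto
  note carrier = xy mult_mat_vec_carrier[OF mats_over_carrier[OF T] xy(1)]
    int_mat_act_carrier[OF pow_A, of m x] int_mat_act_carrier[OF pow_A, of m y]
  have "T *\<^sub>v ?u - T *\<^sub>v (A ^\<^sub>m m *\<^sub>\<int> x) \<in> zero_nbhd n 0"
    using m by (intro zero_nbhd_minus d u m0(2)) simp
  then have "A ^\<^sub>m m *\<^sub>\<int> (T *\<^sub>v x) + A ^\<^sub>m m *\<^sub>\<int> (T *\<^sub>v ?u - T *\<^sub>v (A ^\<^sub>m m *\<^sub>\<int> x)) \<in> zero_nbhd n 0"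
    using m by (intro zero_nbhd_add m0(1) int_mat_act_zero_nbhd[OF pow_A]) simp_all
  also have "A ^\<^sub>m m *\<^sub>\<int> (T *\<^sub>v x) + A ^\<^sub>m m *\<^sub>\<int> (T *\<^sub>v ?u - T *\<^sub>v (A ^\<^sub>m m *\<^sub>\<int> x)) =
      A ^\<^sub>m m *\<^sub>\<int> (T *\<^sub>v (x + (?u - A ^\<^sub>m m *\<^sub>\<int> x)))"
    using carrier mats_over_carrier[OF T]
    by (simp add: int_mat_act_add[OF pow_A] mult_add_distrib_mat_vec[of _ n n]
        mult_minus_distrib_mat_vec[of _ n n])
  also have "x + (?u - A ^\<^sub>m m *\<^sub>\<int> x) = g - A ^\<^sub>m m *\<^sub>\<int> g"
    unfolding sum int_mat_act_add[OF pow_A carrier(1,2)] using carrier by (intro eq_vecI) auto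
  finally show ?thesis using m by (intro that[of m]) (simp_all add: zero_nbhd_0)
qed

end

section \<open>Lattices defined by a characteristic\<close>

lemma padic_trunc_one:
  assumes "p > 1" "k \<ge> 1"
  shows "padic_trunc p k \<one>\<^bsub>padic_int p\<^esub> = 1"
proof -
  have "padic_trunc p k \<one>\<^bsub>padic_int p\<^esub> = 1 mod p ^ k"
    using padic_trunc_eq[of "\<one>\<^bsub>padic_int p\<^esub>" p k] padic_of_int_closed[of p 1] assms(1)
    by (simp add: padic_of_int_one padic_int_simps)
  moreover have "p ^ k > 1" using assms by simp
  ultimately show ?thesis by simp
qed

lemma padic_trunc_zero: "padic_trunc p k \<zero>\<^bsub>padic_int p\<^esub> = 0"
  by (simp add: padic_trunc_def padic_digit_def padic_int_simps)

lemma p_inf_other_prime_over_integers_at: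
  assumes "prime p" "prime q" "p \<noteq> q" "x \<in> carrier_vec n"
  shows "p_inf q x \<subseteq> vecs_over (integers_at p) n"
proof
  fix v assume "v \<in> p_inf q x"
  then obtain k where v: "v = (1 / rat_of_int q ^ k) \<cdot>\<^sub>v map_vec (\<lambda>a. rat_of_int (padic_trunc q k a)) x"
    by (auto simp: p_inf_def)
  have "\<not> p dvd q ^ k" using assms(1-3) primes_dvd_imp_eq prime_dvd_power by blast
  then have "of_int (padic_trunc q k (x $ i)) / of_int (q ^ k) \<in> integers_at p" for i
    by (rule integers_atI)
  then show "v \<in> vecs_over (integers_at p) n" using assms(4) by (auto simp: v vecs_over_def)
qed

lemma p_inf_padic_unit_vec:
  assumes "q > 1" "k \<ge> 1"
  shows "(1 / of_int q ^ k) \<cdot>\<^sub>v unit_vec n j \<in> p_inf q (padic_unit_vec q n j)"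
proof -
  have "unit_vec n j = map_vec (\<lambda>a. rat_of_int (padic_trunc q k a)) (padic_unit_vec q n j)"
    using assms padic_trunc_one padic_trunc_zero
    by (intro eq_vecI) (auto simp: padic_unit_vec_def unit_vec_def)
  then show ?thesis using assms(2) unfolding p_inf_def by auto
qed

locale characteristic_mat =
  fixes A :: "int mat" and n :: nat and \<alpha> :: "int \<Rightarrow> nat \<Rightarrow> nat \<Rightarrow> nat \<Rightarrow> int"
  assumes A: "A \<in> carrier_mat n n" and det: "det A \<noteq> 0" and characteristic: "is_characteristic A \<alpha>"
begin

definition generators :: "rat vec set" where
  "generators = unit_vec n ` {..<n}
     \<union> (\<Union>q\<in>primes_of_mat A - primes_of_mat' A. \<Union>j<n. p_inf q (padic_unit_vec q n j))
     \<union> (\<Union>p\<in>primes_of_mat' A. \<Union>i<zero_mult A p. p_inf p (char_vec \<alpha> n (zero_mult A p) p i))"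

lemma group_of_mat_eq_generate: "group_of_mat A = generate (monoid_vec TYPE(rat) n) generators"
  using characteristic A by (simp add: is_characteristic_def Let_def generators_def)

lemma generators_subset_group: "generators \<subseteq> group_of_mat A"
  unfolding group_of_mat_eq_generate by (auto intro: generate.incl)

lemma group_of_mat_eq: "group_of_mat A = power_preimage \<int> A"
  using A det by (rule group_of_mat_eq_power_preimage)

lemma group_of_mat_carrier: "v \<in> group_of_mat A \<Longrightarrow> v \<in> carrier_vec n"
  unfolding group_of_mat_eq by (rule power_preimage_carrier[OF A])

lemma group_of_mat_subset_local: "prime p \<Longrightarrow> group_of_mat A \<subseteq> power_preimage (integers_at p) A"
  unfolding group_of_mat_eq by (intro power_preimage_mono[OF A] Ints_subset_integers_at)

lemma unit_vec_mem_group: "unit_vec n j \<in> group_of_mat A"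
  unfolding group_of_mat_eq
  using vecs_over_subset_power_preimage[OF A] unit_vec_over[OF unital_subring_Ints] by blast

lemma nilpotent_prime_local_eq_carrier:
  assumes q: "q \<in> primes_of_mat A - primes_of_mat' A"
  shows "power_preimage (integers_at q) A = carrier_vec n"
proof (intro equalityI subsetI power_preimage_carrier[OF A])
  have prime: "prime q" and q1: "q > 1" using q prime_gt_1_int by (auto simp: primes_of_mat_def)
  interpret vec_submodule "integers_at q" n "power_preimage (integers_at q) A"
    by (rule vec_submodule_power_preimage[OF A unital_subring_integers_at[OF prime]])
  fix v :: "rat vec" assume v: "v \<in> carrier_vec n"
  have "\<forall>\<^sub>F k in sequentially. \<forall>j\<in>{..<n}. of_int q ^ k * v $ j \<in> integers_at q"
    using prime by (intro eventually_ball_finite ballI eventually_power_mult_mem_integers_at) auto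
  then obtain k where k: "\<forall>j\<in>{..<n}. of_int q ^ k * v $ j \<in> integers_at q" "k \<ge> 1"
    using eventually_happens'[OF sequentially_bot eventually_conj[OF _ eventually_ge_at_top[of 1]]] by blast
  let ?g = "\<lambda>j. (1 / rat_of_int q ^ k) \<cdot>\<^sub>v unit_vec n j"
  have "?g j \<in> power_preimage (integers_at q) A" if "j < n" for j
    using p_inf_padic_unit_vec[OF q1 k(2)] q that generators_subset_group group_of_mat_subset_local[OF prime]
    unfolding generators_def by blast
  then have "vec n (\<lambda>i. \<Sum>j<n. (of_int q ^ k * v $ j) * ?g j $ i) \<in> power_preimage (integers_at q) A"
    using k(1) by (intro vec_combination) auto
  also have "vec n (\<lambda>i. \<Sum>j<n. (of_int q ^ k * v $ j) * ?g j $ i) = v"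
  proof (rule eq_vecI)
    fix i assume "i < dim_vec v"
    then have i: "i < n" using v by simp
    have "(\<Sum>j<n. (of_int q ^ k * v $ j) * ?g j $ i) = (\<Sum>j<n. if j = i then v $ i else 0)"
      using i q1 by (intro sum.cong) (auto simp: unit_vec_def)
    then show "vec n (\<lambda>i. \<Sum>j<n. (of_int q ^ k * v $ j) * ?g j $ i) $ i = v $ i" using i by simp
  qed (use v in simp)
  finally show "v \<in> power_preimage (integers_at q) A" .
qed

end

locale characteristic_at = characteristic_mat +
  fixes p :: int
  assumes p: "p \<in> primes_of_mat' A"
begin

abbreviation t :: nat where "t \<equiv> zero_mult A p"

lemma prime_p: "prime p" and p_gt_1: "p > 1"
  using p prime_gt_1_int by (auto simp: primes_of_mat'_def primes_of_mat_def)

lemma \<alpha>_closed: "i < t \<Longrightarrow> t \<le> k \<Longrightarrow> k < n \<Longrightarrow> \<alpha> p i k \<in> carrier (padic_int p)"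
  using characteristic p A by (simp add: is_characteristic_def Let_def)

abbreviation Z\<^sub>p :: "rat set" where "Z\<^sub>p \<equiv> integers_at p"

abbreviation G\<^sub>p :: "rat vec set" where "G\<^sub>p \<equiv> power_preimage Z\<^sub>p A"

sublocale Z\<^sub>p: unital_subring Z\<^sub>p
  using prime_p by (rule unital_subring_integers_at)

sublocale G\<^sub>p: vec_submodule Z\<^sub>p n G\<^sub>p
  using A Z\<^sub>p.unital_subring_axioms by (rule vec_submodule_power_preimage)

definition char_trunc :: "nat \<Rightarrow> nat \<Rightarrow> rat vec" where
  "char_trunc i M = map_vec (\<lambda>a. rat_of_int (padic_trunc p M a)) (char_vec \<alpha> n t p i)"

lemma char_trunc_carrier: "char_trunc i M \<in> carrier_vec n"
  by (simp add: char_trunc_def char_vec_def)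

lemma char_trunc_nth:
  assumes "i < t" "j < n" "M \<ge> 1"
  shows "char_trunc i M $ j = (if j = i then 1 else if j < t then 0 else of_int (\<alpha> p i j M))"
  using assms padic_trunc_one[OF p_gt_1 assms(3)] padic_trunc_zero padic_trunc_eq[OF \<alpha>_closed]
  by (auto simp: char_trunc_def char_vec_def)

lemma char_trunc_over_Ints: "char_trunc i M \<in> vecs_over \<int> n"
  by (auto simp: vecs_over_def char_trunc_def char_vec_def)

lemma char_trunc_divide_mem_group:
  assumes "i < t" "M \<ge> 1"
  shows "(1 / of_int p ^ M) \<cdot>\<^sub>v char_trunc i M \<in> group_of_mat A"
proof -
  have "(1 / of_int p ^ M) \<cdot>\<^sub>v char_trunc i M \<in> p_inf p (char_vec \<alpha> n t p i)"
    using assms(2) by (auto simp: p_inf_def char_trunc_def)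
  then have "(1 / of_int p ^ M) \<cdot>\<^sub>v char_trunc i M \<in> generators"
    using p assms(1) unfolding generators_def by blast
  then show ?thesis using generators_subset_group by blast
qed

text \<open>A truncation of the \<open>p\<close>-adic linear form $v \mapsto v_k - \sum_i v_i \alpha_{pik}$.\<close>

definition char_form :: "nat \<Rightarrow> nat \<Rightarrow> rat vec \<Rightarrow> rat" where
  "char_form k M v = v $ k - (\<Sum>i<t. v $ i * of_int (\<alpha> p i k M))"

lemma char_form_add:
  assumes "k \<in> {t..<n}" "v \<in> carrier_vec n" "w \<in> carrier_vec n"
  shows "char_form k M (v + w) = char_form k M v + char_form k M w"
proof -
  have "(\<Sum>i<t. (v + w) $ i * of_int (\<alpha> p i k M)) =
      (\<Sum>i<t. v $ i * of_int (\<alpha> p i k M)) + (\<Sum>i<t. w $ i * of_int (\<alpha> p i k M))"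
    unfolding sum.distrib[symmetric] using assms by (intro sum.cong) (auto simp: distrib_right)
  then show ?thesis using assms by (simp add: char_form_def)
qed

lemma char_form_smult:
  assumes "k \<in> {t..<n}" "v \<in> carrier_vec n"
  shows "char_form k M (c \<cdot>\<^sub>v v) = c * char_form k M v"
proof -
  have "(\<Sum>i<t. (c \<cdot>\<^sub>v v) $ i * of_int (\<alpha> p i k M)) = c * (\<Sum>i<t. v $ i * of_int (\<alpha> p i k M))"
    unfolding sum_distrib_left using assms by (intro sum.cong) auto
  then show ?thesis using assms by (simp add: char_form_def right_diff_distrib)
qed

definition form_lattice :: "rat vec set" where
  "form_lattice = {v \<in> carrier_vec n. \<forall>k\<in>{t..<n}. \<forall>\<^sub>F M in sequentially. char_form k M v \<in> Z\<^sub>p}"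

lemma vecs_over_subset_form_lattice: "vecs_over Z\<^sub>p n \<subseteq> form_lattice"
proof
  fix v assume v: "v \<in> vecs_over Z\<^sub>p n"
  have "char_form k M v \<in> Z\<^sub>p" if "k \<in> {t..<n}" for k M
    using v that unfolding char_form_def
    by (intro Z\<^sub>p.diff_closed Z\<^sub>p.sum_closed Z\<^sub>p.mult_closed Z\<^sub>p.of_int_closed) (auto simp: vecs_over_def)
  then show "v \<in> form_lattice" using v by (simp add: form_lattice_def vecs_over_carrier)
qed

lemma vec_submodule_form_lattice: "vec_submodule Z\<^sub>p n form_lattice"
proof
  show "0\<^sub>v n \<in> form_lattice" using vecs_over_subset_form_lattice Z\<^sub>p.vecs_over.vec_zero by blast
  show carrier: "v \<in> carrier_vec n" if "v \<in> form_lattice" for v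
    using that by (simp add: form_lattice_def)
  fix v assume v: "v \<in> form_lattice"
  show "v + w \<in> form_lattice" if w: "w \<in> form_lattice" for w
  proof -
    have "\<forall>\<^sub>F M in sequentially. char_form k M v + char_form k M w \<in> Z\<^sub>p" if "k \<in> {t..<n}" for k
      using eventually_conj[of "\<lambda>M. char_form k M v \<in> Z\<^sub>p" sequentially "\<lambda>M. char_form k M w \<in> Z\<^sub>p"] v w that
      by (auto simp: form_lattice_def elim!: eventually_mono intro: Z\<^sub>p.add_closed)
    then show ?thesis using carrier[OF v] carrier[OF w] by (simp add: form_lattice_def char_form_add)
  qed
  show "c \<cdot>\<^sub>v v \<in> form_lattice" if c: "c \<in> Z\<^sub>p" for c
  proof -
    have "\<forall>\<^sub>F M in sequentially. c * char_form k M v \<in> Z\<^sub>p" if "k \<in> {t..<n}" for k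
      using v that by (auto simp: form_lattice_def elim!: eventually_mono intro: Z\<^sub>p.mult_closed[OF c])
    then show ?thesis using carrier[OF v] by (simp add: form_lattice_def char_form_smult)
  qed
qed

lemma char_trunc_divide_mem_form_lattice:
  assumes i: "i < t" and m: "m \<ge> 1"
  shows "(1 / of_int p ^ m) \<cdot>\<^sub>v char_trunc i m \<in> form_lattice"
proof -
  have "char_form k M ((1 / of_int p ^ m) \<cdot>\<^sub>v char_trunc i m) \<in> Z\<^sub>p"
    if k: "k \<in> {t..<n}" and M: "M \<ge> m" for k M
  proof -
    have "(\<Sum>j<t. char_trunc i m $ j * of_int (\<alpha> p j k M)) = (\<Sum>j<t. if j = i then of_int (\<alpha> p i k M) else 0)"
      using k i m by (intro sum.cong) (auto simp: char_trunc_nth)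
    then have "char_form k M (char_trunc i m) = of_int (\<alpha> p i k m - \<alpha> p i k M)"
      using k i m by (simp add: char_form_def char_trunc_nth)
    moreover have "p ^ m dvd \<alpha> p i k m - \<alpha> p i k M"
      using padic_int_cong[OF \<alpha>_closed[OF i] M, of k] k by (simp add: cong_iff_dvd_diff dvd_diff_commute)
    then obtain z where "\<alpha> p i k m - \<alpha> p i k M = p ^ m * z" by blast
    ultimately have "char_form k M ((1 / of_int p ^ m) \<cdot>\<^sub>v char_trunc i m) = of_int z"
      using k p_gt_1 by (simp add: char_form_smult char_trunc_carrier)
    then show ?thesis using Z\<^sub>p.of_int_closed by simp
  qed
  then show ?thesis
    using char_trunc_carrier by (auto simp: form_lattice_def intro!: eventually_sequentiallyI[of m])
qed

lemma generators_subset_form_lattice: "generators \<subseteq> form_lattice"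
proof
  have other_prime: "p_inf q x \<subseteq> form_lattice" if "prime q" "p \<noteq> q" "x \<in> carrier_vec n" for q x
    using p_inf_other_prime_over_integers_at[OF prime_p that] vecs_over_subset_form_lattice by blast
  fix v assume "v \<in> generators"
  then consider (unit) j where "v = unit_vec n j"
    | (nilpotent) q j where "q \<in> primes_of_mat A - primes_of_mat' A" "v \<in> p_inf q (padic_unit_vec q n j)"
    | (mixed) q i where "q \<in> primes_of_mat' A" "i < zero_mult A q"
        "v \<in> p_inf q (char_vec \<alpha> n (zero_mult A q) q i)"
    unfolding generators_def by blast
  then show "v \<in> form_lattice"
  proof cases
    case unit
    then show ?thesis using vecs_over_subset_form_lattice unit_vec_over[OF Z\<^sub>p.unital_subring_axioms] by blast
  next
    case nilpotent
    have "prime q" "p \<noteq> q" using nilpotent(1) p by (auto simp: primes_of_mat_def)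
    then show ?thesis
      using nilpotent(2) other_prime[of q "padic_unit_vec q n j"] by (auto simp: padic_unit_vec_def)
  next
    case mixed
    have "prime q" using mixed(1) by (simp add: primes_of_mat'_def primes_of_mat_def)
    show ?thesis
    proof (cases "q = p")
      case True
      then show ?thesis
        using char_trunc_divide_mem_form_lattice mixed(2,3) unfolding p_inf_def char_trunc_def by blast
    next
      case False
      then show ?thesis
        using mixed(3) \<open>prime q\<close> other_prime[of q "char_vec \<alpha> n (zero_mult A q) q i"]
        by (auto simp: char_vec_def)
    qed
  qed
qed

lemma group_of_mat_subset_form_lattice: "group_of_mat A \<subseteq> form_lattice"
  unfolding group_of_mat_eq_generate
  using vec_submodule_form_lattice generators_subset_form_lattice by (rule vec_submodule.generate_subset)

text \<open>The first \<open>t\<close> coordinates of \<open>v\<close> are matched by multiples of the generators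
  $p^{-M} \mathbf{x}_{pi}^{(M)}$; the linear forms control the remaining ones.\<close>

lemma form_lattice_mem_imp_close:
  assumes v: "v \<in> form_lattice"
  obtains w where "w \<in> G\<^sub>p" "v - w \<in> vecs_over Z\<^sub>p n"
proof -
  have "\<forall>\<^sub>F M in sequentially. (\<forall>k\<in>{t..<n}. char_form k M v \<in> Z\<^sub>p) \<and>
      (\<forall>i\<in>{..<n}. of_int p ^ M * v $ i \<in> Z\<^sub>p) \<and> M \<ge> 1"
    using v prime_p
    by (intro eventually_conj eventually_ball_finite eventually_ge_at_top)
      (auto simp: form_lattice_def eventually_power_mult_mem_integers_at)
  then obtain M where forms: "\<And>k. k \<in> {t..<n} \<Longrightarrow> char_form k M v \<in> Z\<^sub>p"
    and pv: "\<And>i. i < n \<Longrightarrow> of_int p ^ M * v $ i \<in> Z\<^sub>p" and M: "M \<ge> 1"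
    using eventually_happens' sequentially_bot by blast
  define w where "w = vec n (\<lambda>k. \<Sum>i<min t n.
    (of_int p ^ M * v $ i) * ((1 / of_int p ^ M) \<cdot>\<^sub>v char_trunc i M) $ k)"
  have w_nth: "w $ k = (\<Sum>i<min t n. v $ i * char_trunc i M $ k)" if "k < n" for k
    using that p_gt_1 by (simp add: w_def carrier_vecD[OF char_trunc_carrier])
  have "v $ k - w $ k \<in> Z\<^sub>p" if k: "k < n" for k
  proof (cases "k < t")
    case True
    then have "w $ k = (\<Sum>i<min t n. if i = k then v $ k else 0)"
      unfolding w_nth[OF k] using k M by (intro sum.cong) (auto simp: char_trunc_nth)
    then show ?thesis using True k Z\<^sub>p.zero_closed by simp
  next
    case False
    then have "w $ k = (\<Sum>i<t. v $ i * of_int (\<alpha> p i k M))"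
      unfolding w_nth[OF k] using k M by (intro sum.cong) (auto simp: char_trunc_nth)
    then show ?thesis using forms[of k] False k by (simp add: char_form_def)
  qed
  then have "v - w \<in> vecs_over Z\<^sub>p n" using v by (simp add: vecs_over_def w_def form_lattice_def)
  moreover have "w \<in> G\<^sub>p"
    unfolding w_def using M pv char_trunc_divide_mem_group group_of_mat_subset_local[OF prime_p]
    by (intro G\<^sub>p.vec_combination) auto
  ultimately show ?thesis using that by blast
qed

lemma form_lattice_subset_local: "form_lattice \<subseteq> G\<^sub>p"
proof
  fix v assume v: "v \<in> form_lattice"
  then obtain w where w: "w \<in> G\<^sub>p" "v - w \<in> vecs_over Z\<^sub>p n" by (rule form_lattice_mem_imp_close)
  then have "(v - w) + w \<in> G\<^sub>p" using vecs_over_subset_power_preimage[OF A] by (intro G\<^sub>p.vec_add) blast+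
  also have "(v - w) + w = v"
    using v power_preimage_carrier[OF A w(1)] by (intro eq_vecI) (auto simp: form_lattice_def)
  finally show "v \<in> G\<^sub>p" .
qed

context
  fixes T :: "rat mat"
  assumes T: "T \<in> carrier_mat n n"
    and approx: "\<And>g. g \<in> group_of_mat A \<Longrightarrow> \<exists>y\<in>vecs_over \<int> n. T *\<^sub>v (g - y) \<in> G\<^sub>p"
begin

abbreviation H :: "rat vec set" where
  "H \<equiv> {v \<in> carrier_vec n. T *\<^sub>v v \<in> G\<^sub>p}"

interpretation H: vec_submodule Z\<^sub>p n H
  using T by (rule G\<^sub>p.vec_submodule_vimage)

lemma char_trunc_mem_vimage:
  assumes "i < t"
  obtains k where "k \<ge> 1" "char_trunc i k \<in> H"
proof -
  have "\<forall>\<^sub>F k in sequentially. \<forall>a\<in>{..<n}. \<forall>b\<in>{..<n}. of_int p ^ k * T $$ (a, b) \<in> Z\<^sub>p"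
    using prime_p by (intro eventually_ball_finite ballI eventually_power_mult_mem_integers_at) auto
  then obtain k where k: "\<forall>a\<in>{..<n}. \<forall>b\<in>{..<n}. of_int p ^ k * T $$ (a, b) \<in> Z\<^sub>p" "k \<ge> 1"
    using eventually_happens'[OF sequentially_bot eventually_conj[OF _ eventually_ge_at_top[of 1]]] by blast
  then have pT: "of_int p ^ k \<cdot>\<^sub>m T \<in> mats_over Z\<^sub>p n" using T by (auto simp: mats_over_def)
  let ?g = "(1 / of_int p ^ k) \<cdot>\<^sub>v char_trunc i k"
  obtain y where y: "y \<in> vecs_over \<int> n" "T *\<^sub>v (?g - y) \<in> G\<^sub>p"
    using approx[OF char_trunc_divide_mem_group[OF assms k(2)]] by blast
  have y': "y \<in> carrier_vec n" "y \<in> vecs_over Z\<^sub>p n"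
    using y(1) vecs_over_carrier vecs_over_mono[OF Ints_subset_integers_at[OF prime_p]] by auto
  have "?g - y \<in> H" using y y'(1) char_trunc_carrier by auto
  then have "of_int p ^ k \<cdot>\<^sub>v (?g - y) \<in> H"
    using Z\<^sub>p.power_closed[OF Z\<^sub>p.of_int_closed] by (intro H.vec_smult)
  moreover have "of_int p ^ k \<cdot>\<^sub>v y \<in> H"
  proof -
    have "T *\<^sub>v (of_int p ^ k \<cdot>\<^sub>v y) = (of_int p ^ k \<cdot>\<^sub>m T) *\<^sub>v y"
      using T y'(1) by (intro eq_vecI) (auto simp: scalar_prod_def sum_distrib_left mult_ac)
    also have "\<dots> \<in> G\<^sub>p"
      using Z\<^sub>p.mult_mat_vec_over[OF pT y'(2)] vecs_over_subset_power_preimage[OF A] by blast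
    finally show ?thesis using y'(1) by simp
  qed
  ultimately have "of_int p ^ k \<cdot>\<^sub>v (?g - y) + of_int p ^ k \<cdot>\<^sub>v y \<in> H" by (rule H.vec_add)
  also have "of_int p ^ k \<cdot>\<^sub>v (?g - y) + of_int p ^ k \<cdot>\<^sub>v y = char_trunc i k"
    using y'(1) char_trunc_carrier[of i k] p_gt_1 by (intro eq_vecI) (auto simp: algebra_simps)
  finally show ?thesis using that k(2) by blast
qed

lemma unit_vec_mem_vimage:
  assumes columns: "\<And>j. j \<in> {t..<n} \<Longrightarrow> T *\<^sub>v unit_vec n j \<in> G\<^sub>p" and i: "i < n"
  shows "unit_vec n i \<in> H"
proof (cases "i < t")
  case True
  obtain k where k: "k \<ge> 1" "char_trunc i k \<in> H" using char_trunc_mem_vimage[OF True] .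
  let ?z = "char_trunc i k - unit_vec n i"
  have "?z \<in> vecs_over Z\<^sub>p n"
    using char_trunc_over_Ints vecs_over_mono[OF Ints_subset_integers_at[OF prime_p]]
      unit_vec_over[OF Z\<^sub>p.unital_subring_axioms] by (intro Z\<^sub>p.vecs_over.vec_minus) auto
  moreover have "unit_vec n j \<in> H" if "j < n" "?z $ j \<noteq> 0" for j
  proof -
    have "j \<ge> t"
      using that i True k(1) char_trunc_carrier[of i k]
      by (cases "j < t") (auto simp: char_trunc_nth unit_vec_def split: if_splits)
    then show ?thesis using columns[of j] that(1) by simp
  qed
  ultimately have "?z \<in> H" by (rule H.vec_mem_if_unit_vecs_mem)
  then have "char_trunc i k - ?z \<in> H" by (rule H.vec_minus[OF k(2)])
  also have "char_trunc i k - ?z = unit_vec n i"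
    using char_trunc_carrier[of i k] by (intro eq_vecI) auto
  finally show ?thesis .
next
  case False
  then show ?thesis using columns[of i] i by simp
qed

lemma image_group_subset_local:
  assumes columns: "\<And>j. j \<in> {t..<n} \<Longrightarrow> T *\<^sub>v unit_vec n j \<in> G\<^sub>p" and g: "g \<in> group_of_mat A"
  shows "T *\<^sub>v g \<in> G\<^sub>p"
proof -
  obtain y where y: "y \<in> vecs_over \<int> n" "T *\<^sub>v (g - y) \<in> G\<^sub>p" using approx[OF g] by blast
  have carrier: "g \<in> carrier_vec n" "y \<in> carrier_vec n"
    using g group_of_mat_carrier y(1) vecs_over_carrier by auto
  have "unit_vec n i \<in> H" if "i < n" for i using columns that by (rule unit_vec_mem_vimage)
  then have "y \<in> H"
    by (rule H.vec_mem_if_unit_vecs_mem[OF vecs_over_mono[OF Ints_subset_integers_at[OF prime_p] y(1)]])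
  moreover have "g - y \<in> H" using y(2) carrier by simp
  ultimately have "(g - y) + y \<in> H" by (rule H.vec_add[rotated])
  also have "(g - y) + y = g" using carrier by (intro eq_vecI) auto
  finally show ?thesis by simp
qed

end

end

section \<open>Endomorphisms of $G_A$\<close>

lemma mult_unit_vec_nth:
  fixes M :: "'a :: semiring_1 mat"
  shows "M \<in> carrier_mat n n \<Longrightarrow> i < n \<Longrightarrow> j < n \<Longrightarrow> (M *\<^sub>v unit_vec n j) $ i = M $$ (i, j)"
  by (simp add: scalar_prod_right_unit)

lemma mats_over_if_columns:
  fixes M :: "'a :: semiring_1 mat"
  assumes "M \<in> carrier_mat n n" "\<And>j. j < n \<Longrightarrow> M *\<^sub>v unit_vec n j \<in> vecs_over R n"
  shows "M \<in> mats_over R n"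
  unfolding mats_over_def
proof (intro CollectI conjI allI impI assms(1))
  fix i j assume ij: "i < n" "j < n"
  have "(M *\<^sub>v unit_vec n j) $ i \<in> R" using assms(2)[OF ij(2)] ij(1) unfolding vecs_over_def by blast
  then show "M $$ (i, j) \<in> R" by (simp only: mult_unit_vec_nth[OF assms(1) ij])
qed

lemma of_rat_map_mat_of_int: "map_mat of_rat (map_mat rat_of_int M) = map_mat complex_of_int M"
  by (intro eq_matI) auto

context characteristic_mat
begin

lemma right_inverse_power_columns_mem_group:
  assumes B: "B \<in> carrier_mat n n" "map_mat rat_of_int (A ^\<^sub>m k) * B = 1\<^sub>m n"
  shows "B *\<^sub>v unit_vec n j \<in> group_of_mat A"
proof -
  have "A ^\<^sub>m k *\<^sub>\<int> (B *\<^sub>v unit_vec n j) = (map_mat rat_of_int (A ^\<^sub>m k) * B) *\<^sub>v unit_vec n j"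
    unfolding int_mat_act_def using A B(1) by (intro assoc_mult_mat_vec[symmetric]) auto
  then have "A ^\<^sub>m k *\<^sub>\<int> (B *\<^sub>v unit_vec n j) \<in> vecs_over \<int> n"
    using unit_vec_over[OF unital_subring_Ints] by (simp add: B(2))
  then show ?thesis
    unfolding group_of_mat_eq power_preimage_iff[OF A] using B(1) by auto
qed

lemma endomorphism_intertwining:
  assumes T: "T \<in> carrier_mat n n" and endo: "\<And>v. v \<in> group_of_mat A \<Longrightarrow> T *\<^sub>v v \<in> group_of_mat A"
  shows "\<exists>l. \<exists>M\<in>carrier_mat n n.
    map_mat rat_of_int (A ^\<^sub>m l) * T = map_mat rat_of_int M * map_mat rat_of_int (A ^\<^sub>m k)"
proof -
  let ?A = "\<lambda>m. map_mat rat_of_int (A ^\<^sub>m m)"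
  have pow: "?A m \<in> carrier_mat n n" for m using A by simp
  obtain B where B: "B \<in> carrier_mat n n" "?A k * B = 1\<^sub>m n" "B * ?A k = 1\<^sub>m n"
    using rat_inverse_exists[OF A det] pow_carrier_mat by metis
  have TB: "T * B \<in> carrier_mat n n" using T B(1) by simp
  have "T *\<^sub>v (B *\<^sub>v unit_vec n j) \<in> group_of_mat A" for j
    using B(1,2) by (intro endo right_inverse_power_columns_mem_group)
  then have "\<forall>\<^sub>F l in sequentially. \<forall>j\<in>{..<n}. A ^\<^sub>m l *\<^sub>\<int> (T *\<^sub>v (B *\<^sub>v unit_vec n j)) \<in> vecs_over \<int> n"
    unfolding group_of_mat_eq
    by (intro eventually_ball_finite ballI power_preimage_eventually[OF A unital_subring_Ints]) auto
  then obtain l where l: "\<forall>j\<in>{..<n}. A ^\<^sub>m l *\<^sub>\<int> (T *\<^sub>v (B *\<^sub>v unit_vec n j)) \<in> vecs_over \<int> n"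
    using eventually_happens' sequentially_bot by blast
  have "?A l * (T * B) \<in> mats_over \<int> n"
  proof (rule mats_over_if_columns)
    show "?A l * (T * B) \<in> carrier_mat n n" using pow TB by (rule mult_carrier_mat)
    fix j assume "j < n"
    moreover have "?A l * (T * B) *\<^sub>v unit_vec n j = A ^\<^sub>m l *\<^sub>\<int> (T *\<^sub>v (B *\<^sub>v unit_vec n j))"
      using assoc_mult_mat_vec[OF pow TB unit_vec_carrier] assoc_mult_mat_vec[OF T B(1) unit_vec_carrier]
      by (simp add: int_mat_act_def)
    ultimately show "?A l * (T * B) *\<^sub>v unit_vec n j \<in> vecs_over \<int> n" using l by simp
  qed
  then obtain M where M: "M \<in> carrier_mat n n" "?A l * (T * B) = map_mat rat_of_int M"
    by (rule mats_over_Ints_obtain)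
  have "map_mat rat_of_int M * ?A k = ?A l * (T * (B * ?A k))"
    using assoc_mult_mat[OF pow TB pow, of l k] assoc_mult_mat[OF T B(1) pow, of k] by (simp add: M(2))
  also have "\<dots> = ?A l * T" using B(3) T by simp
  finally show ?thesis using M(1) by metis
qed

lemma image_entries_mem_adjoin_inverse:
  assumes T: "T \<in> carrier_mat n n" and endo: "\<And>v. v \<in> group_of_mat A \<Longrightarrow> T *\<^sub>v v \<in> group_of_mat A"
  shows "elements_mat T \<subseteq> adjoin_inverse (det A)"
proof
  fix r assume "r \<in> elements_mat T"
  then obtain i j where ij: "i < n" "j < n" "r = T $$ (i, j)" using T by (auto simp: elements_mat_def)
  have "T *\<^sub>v unit_vec n j \<in> power_preimage \<int> A"
    using endo[OF unit_vec_mem_group] by (simp only: group_of_mat_eq)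
  then obtain k where "of_int (det A ^ k) \<cdot>\<^sub>v (T *\<^sub>v unit_vec n j) \<in> vecs_over \<int> n"
    by (rule det_power_smult_power_preimage_Ints[OF A])
  then have "of_int (det A ^ k) * (T *\<^sub>v unit_vec n j) $ i \<in> \<int>"
    using ij(1) T by (simp add: vecs_over_def del: index_mult_mat_vec)
  then show "r \<in> adjoin_inverse (det A)"
    using ij(3) mult_unit_vec_nth[OF T ij(1,2)] mem_adjoin_inverse_iff[OF det] by auto
qed

lemma endomorphism_preserves_eigenspace_at:
  assumes T: "T \<in> carrier_mat n n" and endo: "\<And>v. v \<in> group_of_mat A \<Longrightarrow> T *\<^sub>v v \<in> group_of_mat A"
    and E: "eigenspace_above F P p A n"
  shows "(\<lambda>v. map_mat of_rat T *\<^sub>v v) ` eigenspace_at F A P \<subseteq> eigenspace_at F A P"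
proof -
  interpret E: eigenspace_above F P p A n by (rule E)
  have "\<exists>l. \<exists>M\<in>carrier_mat n n. map_mat complex_of_int (A ^\<^sub>m l) * map_mat of_rat T =
      map_mat of_int M * map_mat of_int (A ^\<^sub>m k)" for k
  proof -
    obtain l M where M: "M \<in> carrier_mat n n"
      "map_mat rat_of_int (A ^\<^sub>m l) * T = map_mat rat_of_int M * map_mat rat_of_int (A ^\<^sub>m k)"
      using endomorphism_intertwining[OF T endo] by blast
    have hom: "map_mat complex_of_rat (B * C) = map_mat of_rat B * map_mat of_rat C"
      if "B \<in> carrier_mat n n" "C \<in> carrier_mat n n" for B C
      using that by (rule of_rat_hom.mat_hom_mult)
    have "map_mat complex_of_rat (map_mat rat_of_int (A ^\<^sub>m l) * T) =
        map_mat of_rat (map_mat rat_of_int M * map_mat rat_of_int (A ^\<^sub>m k))"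
      by (simp only: M(2))
    then have "map_mat of_int (A ^\<^sub>m l) * map_mat complex_of_rat T =
        map_mat of_int M * map_mat of_int (A ^\<^sub>m k)"
      using M(1) T A by (simp add: hom of_rat_map_mat_of_int)
    then show ?thesis using M(1) by blast
  qed
  moreover have "map_mat of_rat T \<in> mats_over F n"
    using T division_subring_of_rat_closed[OF E.F.division_subring_axioms] by (simp add: mats_over_def)
  ultimately show ?thesis
    unfolding E.eigenspace_at_eq_P_eigenspace using E.P_eigenspace_stable by blast
qed

lemma eigenspace_at_stable_imp_approximation:
  assumes T: "T \<in> carrier_mat n n" and E: "eigenspace_above F P p A n"
    and stable: "(\<lambda>v. map_mat of_rat T *\<^sub>v v) ` eigenspace_at F A P \<subseteq> eigenspace_at F A P"
    and g: "g \<in> group_of_mat A"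
  shows "\<exists>y\<in>vecs_over \<int> n. T *\<^sub>v (g - y) \<in> power_preimage (integers_at p) A"
proof -
  interpret E: eigenspace_above F P p A n by (rule E)
  let ?h = "map_vec complex_of_rat" and ?T = "map_mat complex_of_rat T"
  note of_rat_F = division_subring_of_rat_closed[OF E.F.division_subring_axioms]
  note pow = pow_carrier_mat[OF A]
  have g': "g \<in> carrier_vec n" using g by (rule group_of_mat_carrier)
  obtain s where s: "\<And>m. m \<ge> s \<Longrightarrow> A ^\<^sub>m m *\<^sub>\<int> g \<in> vecs_over \<int> n"
    using power_preimage_eventually[OF A unital_subring_Ints, of g] g
    unfolding group_of_mat_eq eventually_sequentially by blast
  have "?T \<in> mats_over F n" "?h g \<in> vecs_over F n"
    using T g' of_rat_F by (simp_all add: mats_over_def vecs_over_def)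
  moreover have "?T *\<^sub>v v \<in> E.P_eigenspace" if "v \<in> E.P_eigenspace" for v
    using stable that unfolding E.eigenspace_at_eq_P_eigenspace by blast
  ultimately obtain m where m: "m \<ge> s"
    "A ^\<^sub>m m *\<^sub>\<int> (?T *\<^sub>v (?h g - A ^\<^sub>m m *\<^sub>\<int> ?h g)) \<in> vecs_over E.local_ring n"
    using E.P_eigenspace_stable_imp_close by blast
  define y where "y = A ^\<^sub>m m *\<^sub>\<int> g"
  have y: "y \<in> carrier_vec n" unfolding y_def by (rule int_mat_act_carrier[OF pow])
  have Tgy: "T *\<^sub>v (g - y) \<in> carrier_vec n" using T g' y by simp
  have "?h (g - y) = ?h g - A ^\<^sub>m m *\<^sub>\<int> ?h g"
    unfolding y_def of_rat_int_mat_act[OF pow g', symmetric]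
    using g' int_mat_act_carrier[OF pow, of m g] by (intro eq_vecI) (auto simp: of_rat_diff)
  then have "?h (A ^\<^sub>m m *\<^sub>\<int> (T *\<^sub>v (g - y))) = A ^\<^sub>m m *\<^sub>\<int> (?T *\<^sub>v (?h g - A ^\<^sub>m m *\<^sub>\<int> ?h g))"
    unfolding of_rat_int_mat_act[OF pow Tgy] using g' y
    by (subst of_rat_hom.mult_mat_vec_hom[OF T]) auto
  then have "?h (A ^\<^sub>m m *\<^sub>\<int> (T *\<^sub>v (g - y))) \<in> vecs_over E.local_ring n" using m(2) by (simp only:)
  then have "A ^\<^sub>m m *\<^sub>\<int> (T *\<^sub>v (g - y)) \<in> vecs_over (integers_at p) n"
    by (auto simp: vecs_over_def E.of_rat_mem_local_ring_iff)
  then show ?thesis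
    using s[OF m(1)] Tgy unfolding power_preimage_iff[OF A] y_def by blast
qed

lemma image_subset_group_iff_local:
  assumes T: "T \<in> carrier_mat n n"
  shows "(\<lambda>v. T *\<^sub>v v) ` group_of_mat A \<subseteq> group_of_mat A \<longleftrightarrow>
    (\<forall>p. prime p \<longrightarrow> (\<forall>g\<in>group_of_mat A. T *\<^sub>v g \<in> power_preimage (integers_at p) A))"
proof
  show "\<forall>p. prime p \<longrightarrow> (\<forall>g\<in>group_of_mat A. T *\<^sub>v g \<in> power_preimage (integers_at p) A)"
    if "(\<lambda>v. T *\<^sub>v v) ` group_of_mat A \<subseteq> group_of_mat A"
    using that group_of_mat_subset_local by blast
  assume "\<forall>p. prime p \<longrightarrow> (\<forall>g\<in>group_of_mat A. T *\<^sub>v g \<in> power_preimage (integers_at p) A)"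
  then have "T *\<^sub>v g \<in> power_preimage \<int> A" if "g \<in> group_of_mat A" for g
    using that T group_of_mat_carrier[OF that] by (intro power_preimage_Ints_local[OF A]) auto
  then show "(\<lambda>v. T *\<^sub>v v) ` group_of_mat A \<subseteq> group_of_mat A"
    unfolding group_of_mat_eq[symmetric] by blast
qed

lemma image_local_away_from_det:
  assumes "T \<in> carrier_mat n n" "elements_mat T \<subseteq> adjoin_inverse (det A)"
    and "prime p" "\<not> p dvd det A" "g \<in> group_of_mat A"
  shows "T *\<^sub>v g \<in> power_preimage (integers_at p) A"
proof -
  have "T \<in> mats_over (integers_at p) n"
    using assms(1,2) adjoin_inverse_subset_integers_at[OF assms(3,4)]
    by (fastforce simp: mats_over_def elements_mat_def)
  moreover have "g \<in> vecs_over (integers_at p) n"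
    using assms(5) power_preimage_Ints_away_from_det[OF A assms(3,4)] by (simp add: group_of_mat_eq)
  ultimately have "T *\<^sub>v g \<in> vecs_over (integers_at p) n"
    by (rule unital_subring.mult_mat_vec_over[OF unital_subring_integers_at[OF assms(3)]])
  then show ?thesis using vecs_over_subset_power_preimage[OF A] by blast
qed

lemma image_local_at_nilpotent_prime:
  assumes "T \<in> carrier_mat n n" "q \<in> primes_of_mat A - primes_of_mat' A" "g \<in> group_of_mat A"
  shows "T *\<^sub>v g \<in> power_preimage (integers_at q) A"
  unfolding nilpotent_prime_local_eq_carrier[OF assms(2)]
  using assms(1) group_of_mat_carrier[OF assms(3)] by (rule mult_mat_vec_carrier)

definition columns_integral :: "rat mat \<Rightarrow> int \<Rightarrow> bool" where
  "columns_integral T p \<longleftrightarrow> (\<forall>j\<in>{zero_mult A p..<n}. \<forall>k\<in>{zero_mult A p..<n}.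
     padic_of_rat p (T $$ (k, j)) \<ominus>\<^bsub>padic_field p\<^esub>
       (\<Oplus>\<^bsub>padic_field p\<^esub>i\<in>{..<zero_mult A p}.
          padic_of_rat p (T $$ (i, j)) \<otimes>\<^bsub>padic_field p\<^esub> padic_emb p (\<alpha> p i k))
     \<in> padic_emb p ` carrier (padic_int p))"

end

context characteristic_at
begin

lemma columns_integral_iff_form_lattice:
  assumes T: "T \<in> carrier_mat n n"
  shows "columns_integral T p \<longleftrightarrow> (\<forall>j\<in>{t..<n}. T *\<^sub>v unit_vec n j \<in> form_lattice)"
proof -
  have "padic_of_rat p (T $$ (k, j)) \<ominus>\<^bsub>padic_field p\<^esub>
      (\<Oplus>\<^bsub>padic_field p\<^esub>i\<in>{..<t}. padic_of_rat p (T $$ (i, j)) \<otimes>\<^bsub>padic_field p\<^esub> padic_emb p (\<alpha> p i k))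
    \<in> padic_emb p ` carrier (padic_int p) \<longleftrightarrow>
    (\<forall>\<^sub>F M in sequentially. char_form k M (T *\<^sub>v unit_vec n j) \<in> Z\<^sub>p)"
    if jk: "j \<in> {t..<n}" "k \<in> {t..<n}" for j k
  proof -
    have "T $$ (k, j) - (\<Sum>i<t. T $$ (i, j) * of_int (\<alpha> p i k M)) = char_form k M (T *\<^sub>v unit_vec n j)" for M
      using jk mult_unit_vec_nth[OF T, of _ j] by (simp add: char_form_def del: index_mult_mat_vec)
    then show ?thesis
      using padic_form_integral_iff[OF prime_p, of "{..<t}" "\<lambda>i. \<alpha> p i k" "T $$ (k, j)" "\<lambda>i. T $$ (i, j)"]
        \<alpha>_closed jk by simp
  qed
  moreover have "T *\<^sub>v unit_vec n j \<in> carrier_vec n" for j using T by simp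
  ultimately show ?thesis by (simp add: columns_integral_def form_lattice_def)
qed

lemma endomorphism_columns_integral:
  assumes "T \<in> carrier_mat n n" "\<And>v. v \<in> group_of_mat A \<Longrightarrow> T *\<^sub>v v \<in> group_of_mat A"
  shows "columns_integral T p"
  unfolding columns_integral_iff_form_lattice[OF assms(1)]
  using assms(2) unit_vec_mem_group group_of_mat_subset_form_lattice by blast

lemma image_local_if_eigenspace_stable:
  assumes T: "T \<in> carrier_mat n n" and E: "eigenspace_above F P p A n"
    and stable: "(\<lambda>v. map_mat of_rat T *\<^sub>v v) ` eigenspace_at F A P \<subseteq> eigenspace_at F A P"
    and columns: "columns_integral T p" and g: "g \<in> group_of_mat A"
  shows "T *\<^sub>v g \<in> G\<^sub>p"
  using T eigenspace_at_stable_imp_approximation[OF T E stable] _ g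
proof (rule image_group_subset_local)
  show "T *\<^sub>v unit_vec n j \<in> G\<^sub>p" if "j \<in> {t..<n}" for j
    using columns that form_lattice_subset_local unfolding columns_integral_iff_form_lattice[OF T] by blast
qed

end

locale characteristic_number_field = characteristic_mat +
  fixes F :: "complex set"
  assumes number_field: "number_field F"
    and eigenvalues_F: "{l. eigenvalue (map_mat complex_of_int A) l} \<subseteq> F"
begin

lemma characteristic_atI: "p \<in> primes_of_mat' A \<Longrightarrow> characteristic_at A n \<alpha> p"
  by unfold_locales

lemma eigenspace_aboveI: "prime p \<Longrightarrow> prime_above F p P \<Longrightarrow> eigenspace_above F P p A n"
  using number_field eigenvalues_F A by unfold_locales

lemma endomorphism_if_local_conditions:
  assumes T: "T \<in> carrier_mat n n" and entries: "elements_mat T \<subseteq> adjoin_inverse (det A)"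
    and stable: "\<And>p P. p \<in> primes_of_mat' A \<Longrightarrow> prime_above F p P \<Longrightarrow>
      (\<lambda>v. map_mat of_rat T *\<^sub>v v) ` eigenspace_at F A P \<subseteq> eigenspace_at F A P"
    and columns: "\<And>p. p \<in> primes_of_mat' A \<Longrightarrow> columns_integral T p"
  shows "(\<lambda>v. T *\<^sub>v v) ` group_of_mat A \<subseteq> group_of_mat A"
  unfolding image_subset_group_iff_local[OF T]
proof (intro allI impI ballI)
  fix p :: int and g assume p: "prime p" and g: "g \<in> group_of_mat A"
  then consider (away) "\<not> p dvd det A" | (nilpotent) "p \<in> primes_of_mat A - primes_of_mat' A"
    | (mixed) "p \<in> primes_of_mat' A" by (auto simp: primes_of_mat_def)
  then show "T *\<^sub>v g \<in> power_preimage (integers_at p) A"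
  proof cases
    case away
    show ?thesis using T entries p away g by (rule image_local_away_from_det)
  next
    case nilpotent
    show ?thesis using T nilpotent g by (rule image_local_at_nilpotent_prime)
  next
    case mixed
    have "unital_subring F"
      using number_field_imp_division_subring[OF number_field] by (rule division_subring.axioms)
    then obtain P where P: "prime_above F p P" using prime_above_exists[OF _ p] by blast
    show ?thesis
      using T eigenspace_aboveI[OF p P] stable[OF mixed P] columns[OF mixed] g
      by (rule characteristic_at.image_local_if_eigenspace_stable[OF characteristic_atI[OF mixed]])
  qed
qed

end

theorem theorem3p5:
  fixes A :: "int mat" and T :: "rat mat" and n :: nat and F :: "complex set"
    and \<alpha> :: "int \<Rightarrow> nat \<Rightarrow> nat \<Rightarrow> (nat \<Rightarrow> int)"
  assumes "A \<in> carrier_mat n n" and "det A \<noteq> 0" and "primes_of_mat' A \<noteq> {}"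
    and "number_field F"
    and "{l. eigenvalue (map_mat complex_of_int A) l} \<subseteq> F"
    and "is_characteristic A \<alpha>"
    and "T \<in> carrier_mat n n"
  shows "(\<lambda>v. T *\<^sub>v v) ` group_of_mat A \<subseteq> group_of_mat A \<longleftrightarrow>
    elements_mat T \<subseteq> adjoin_inverse (det A) \<and>
    (\<forall>p\<in>primes_of_mat' A.
       (\<forall>P. prime_above F p P \<longrightarrow>
          (\<lambda>v. map_mat of_rat T *\<^sub>v v) ` eigenspace_at F A P \<subseteq> eigenspace_at F A P) \<and>
       (\<forall>j\<in>{zero_mult A p..<n}. \<forall>k\<in>{zero_mult A p..<n}.
          padic_of_rat p (T $$ (k, j)) \<ominus>\<^bsub>padic_field p\<^esub>
            (\<Oplus>\<^bsub>padic_field p\<^esub>i\<in>{..<zero_mult A p}.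
               padic_of_rat p (T $$ (i, j)) \<otimes>\<^bsub>padic_field p\<^esub> padic_emb p (\<alpha> p i k))
          \<in> padic_emb p ` carrier (padic_int p)))"
proof -
  interpret characteristic_number_field A n \<alpha> F using assms(1,2,4,5,6) by unfold_locales
  show ?thesis
    unfolding columns_integral_def[symmetric]
  proof (intro iffI conjI ballI allI impI)
    assume "(\<lambda>v. T *\<^sub>v v) ` group_of_mat A \<subseteq> group_of_mat A"
    then have endo: "T *\<^sub>v v \<in> group_of_mat A" if "v \<in> group_of_mat A" for v using that by blast
    show "elements_mat T \<subseteq> adjoin_inverse (det A)"
      using assms(7) endo by (rule image_entries_mem_adjoin_inverse)
    fix p assume p: "p \<in> primes_of_mat' A"
    interpret characteristic_at A n \<alpha> p using p by (rule characteristic_atI)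
    show "columns_integral T p" using assms(7) endo by (rule endomorphism_columns_integral)
    show "(\<lambda>v. map_mat of_rat T *\<^sub>v v) ` eigenspace_at F A P \<subseteq> eigenspace_at F A P"
      if "prime_above F p P" for P
      using assms(7) endo eigenspace_aboveI[OF prime_p that] by (rule endomorphism_preserves_eigenspace_at)
  qed (use endomorphism_if_local_conditions[OF assms(7)] in blast)
qed

end
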